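(* Let $k\in\mathbb Z\setminus\{0\}$ and let $g=\tilde h|_{\mathbb R\times\{0\}}$ for some $\tilde h\in\mathcal B_k$. Then $$\inf_{\mathcal E_{g,k}}E=2\pi|k|=E(g).$$ Moreover, for $d>k>0$, or for $d<k<0$ ($d\in\mathbb Z$), $$\inf_{\mathcal E_{g,d}}E=2\pi|d|,$$ and this infimum is not attained.
   Context: $I=(-1,1)$, $\mathbb S^1=\{z\in\mathbb C:|z|=1\}$, $\mathbb C_+$ is the open upper half-plane. $\dot H^{\frac12}(\mathbb R,\mathbb S^1)$ is the set of measurable $u:\mathbb R\to\mathbb C$ (up to a.e. equality) with $|u|=1$ a.e. and $\int_{\mathbb R}\int_{\mathbb R}\frac{|u(x)-u(y)|^2}{|x-y|^2}\,dx\,dy<\infty$, and $E(u)=\frac1{2\pi}\int_{\mathbb R}\int_{\mathbb R}\frac{|u(x)-u(y)|^2}{|x-y|^2}\,dx\,dy$. For $g\in\dot H^{\frac12}(\mathbb R,\mathbb S^1)$ and $d\in\mathbb Z$: $\mathcal E_{g,d}:=\{u\in\dot H^{\frac12}(\mathbb R,\mathbb S^1):u=g\text{ in }\mathbb R\setminus I,\ \deg(u)=d\}$. Degree: $\deg(u):=\deg(u\circ\pi)\in\mathbb Z$, where $\pi:\mathbb S^1\setminus\{i\}\to\mathbb R$, $\pi(e^{i\theta})=\frac{\cos\theta}{1-\sin\theta}$, is the stereographic projection from the north pole. The degree on $H^{\frac12}(\mathbb S^1,\mathbb S^1)$ is the unique extension, continuous in the $H^{\frac12}$ norm, of the usual degree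 $\frac1{2\pi i}\int_{\mathbb S^1}\bar f f'\,d\theta$ of $C^1$ maps (equivalently $\deg f=\sum_{n\in\mathbb Z}n|\hat f(n)|^2$). Blaschke products: for $k>0$, $\mathcal B_k$ is the set of maps $\tilde h:\overline{\mathbb C_+}\to\overline{D^2}$ of the form $\tilde h(z)=e^{i\theta_0}\prod_{j=1}^k\frac{z-\beta_j}{z-\bar\beta_j}$ with $\beta_1,\dots,\beta_k\in\mathbb C_+$ and $\theta_0\in\mathbb R$, and $\mathcal B_{-k}$ is the set of complex conjugates $\overline{\tilde h}$ of $\tilde h\in\mathcal B_k$. *)

theory Defs
  imports "HOL-Analysis.Analysis"
begin

text \<open>
  Elements of the Sobolev spaces are represented by Borel functions; every class of measurable
  functions modulo a.e. equality has such a representative, and energies and degrees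
  of Sobolev maps depend only on the class. The integrands vanish on the diagonal since \<open>0 / 0 = 0\<close>. Energies take
  values in \<open>ennreal\<close>, so that the infimum over an empty class would be \<open>\<infinity>\<close>.
\<close>

definition gagliardo_line :: "(real \<Rightarrow> complex) \<Rightarrow> ennreal" where
  "gagliardo_line u =
     (\<integral>\<^sup>+ x. (\<integral>\<^sup>+ y. ennreal ((cmod (u x - u y))\<^sup>2 / \<bar>x - y\<bar>\<^sup>2) \<partial>lborel) \<partial>lborel)"

definition hhalf_line :: "(real \<Rightarrow> complex) set" where
  "hhalf_line = {u. u \<in> borel_measurable lborel \<and> (AE x in lborel. cmod (u x) = 1) \<and>
                    gagliardo_line u < \<infinity>}"

definition energy :: "(real \<Rightarrow> complex) \<Rightarrow> ennreal" where
  "energy u = ennreal (1 / (2 * pi)) * gagliardo_line u"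

text \<open>
  Functions on the unit circle are functions on \<open>complex\<close> of which only the values at the
  points \<open>cis \<theta>\<close> matter; integrals are taken with respect to arc length.
\<close>

definition gagliardo_circle :: "(complex \<Rightarrow> complex) \<Rightarrow> ennreal" where
  "gagliardo_circle f =
     (\<integral>\<^sup>+ s\<in>{0..2*pi}. (\<integral>\<^sup>+ t\<in>{0..2*pi}.
        ennreal ((cmod (f (cis s) - f (cis t)))\<^sup>2 / (cmod (cis s - cis t))\<^sup>2) \<partial>lborel) \<partial>lborel)"

definition hhalf_circle_norm_sq :: "(complex \<Rightarrow> complex) \<Rightarrow> ennreal" where
  "hhalf_circle_norm_sq f =
     (\<integral>\<^sup>+ s\<in>{0..2*pi}. ennreal ((cmod (f (cis s)))\<^sup>2) \<partial>lborel) + gagliardo_circle f"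

definition hhalf_circle :: "(complex \<Rightarrow> complex) set" where
  "hhalf_circle = {f. (\<lambda>s. f (cis s)) \<in> borel_measurable lborel \<and>
                      (AE s in lborel. cmod (f (cis s)) = 1) \<and>
                      gagliardo_circle f < \<infinity>}"

definition C1_circle :: "(complex \<Rightarrow> complex) set" where
  "C1_circle = {f. (\<lambda>s. f (cis s)) C1_differentiable_on UNIV \<and> (\<forall>s. cmod (f (cis s)) = 1)}"

definition C1_degree :: "(complex \<Rightarrow> complex) \<Rightarrow> complex" where
  "C1_degree f = 1 / (2 * complex_of_real pi * \<i>) *
     integral {0..2*pi} (\<lambda>s. cnj (f (cis s)) * vector_derivative (\<lambda>t. f (cis t)) (at s))"

definition degree_extension :: "((complex \<Rightarrow> complex) \<Rightarrow> complex) \<Rightarrow> bool" where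
  "degree_extension D \<longleftrightarrow>
     (\<forall>f\<in>C1_circle. D f = C1_degree f) \<and>
     (\<forall>f\<in>hhalf_circle. \<forall>\<epsilon>>0. \<exists>\<delta>>0. \<forall>h\<in>hhalf_circle.
        hhalf_circle_norm_sq (\<lambda>z. h z - f z) < ennreal (\<delta>\<^sup>2) \<longrightarrow> cmod (D h - D f) < \<epsilon>)"

text \<open>
  On \<open>hhalf_circle\<close> the continuous extension exists and is unique; quantifying over all
  extensions names its value. Outside \<open>hhalf_circle\<close> (which contains \<open>C1_circle\<close>) extensions
  are unconstrained, so no degree is assigned there.
\<close>

definition circle_has_degree :: "(complex \<Rightarrow> complex) \<Rightarrow> int \<Rightarrow> bool" where
  "circle_has_degree f d \<longleftrightarrow> (\<forall>D. degree_extension D \<longrightarrow> D f = of_int d)"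

text \<open>Stereographic projection from \<open>\<i>\<close>; its junk value at \<open>\<i>\<close> itself affects a null set only.\<close>

definition stereo :: "complex \<Rightarrow> real" where
  "stereo z = Re z / (1 - Im z)"

definition line_has_degree :: "(real \<Rightarrow> complex) \<Rightarrow> int \<Rightarrow> bool" where
  "line_has_degree u d \<longleftrightarrow> circle_has_degree (u \<circ> stereo) d"

definition admissible :: "(real \<Rightarrow> complex) \<Rightarrow> int \<Rightarrow> (real \<Rightarrow> complex) set" where
  "admissible g d = {u \<in> hhalf_line. (AE x in lborel. x \<notin> {-1<..<1} \<longrightarrow> u x = g x) \<and>
                                     line_has_degree u d}"

text \<open>Maps on the closed upper half-plane: values of \<open>h\<close> elsewhere are irrelevant.\<close>

definition blaschke_pos :: "nat \<Rightarrow> (complex \<Rightarrow> complex) set" where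
  "blaschke_pos k = {h. \<exists>(\<theta>\<^sub>0::real) \<beta>. (\<forall>j\<in>{1..k}. Im (\<beta> j) > 0) \<and>
     (\<forall>z. Im z \<ge> 0 \<longrightarrow> h z = cis \<theta>\<^sub>0 * (\<Prod>j=1..k. (z - \<beta> j) / (z - cnj (\<beta> j))))}"

text \<open>Meaningful for \<open>k \<noteq> 0\<close> only.\<close>

definition blaschke :: "int \<Rightarrow> (complex \<Rightarrow> complex) set" where
  "blaschke k = (if k > 0 then blaschke_pos (nat k)
                 else {\<lambda>z. cnj (h z) | h. h \<in> blaschke_pos (nat (- k))})"

end

theory Submission
  imports Defs "HOL-Complex_Analysis.Complex_Analysis"
begin

text \<open>
  The Gagliardo seminorm is invariant under the stereographic projection, and on the circle
  \<open>gagliardo_circle f = 4 \<pi>\<^sup>2 \<Sum> \<bar>n\<bar> \<bar>f\<^sub>n\<bar>\<^sup>2\<close>, obtained by letting \<open>r \<rightarrow> 1\<close> in the Abel sums \<open>\<Sum> \<bar>n\<bar> r\<^bsup>\<bar>n\<bar>\<^esup> \<bar>f\<^sub>n\<bar>\<^sup>2\<close>,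
  whose kernel is dominated by \<open>\<bar>z - w\<bar>\<^bsup>-2\<^esup>\<close>. The functional \<open>\<Sum> n \<bar>f\<^sub>n\<bar>\<^sup>2\<close> is continuous and agrees with the
  degree of \<open>C\<^sup>1\<close> maps, so \<open>E(u) \<ge> 2\<pi>\<bar>d\<bar>\<close> for every map of degree \<open>d\<close>. For \<open>d > 0\<close> equality means that all negative
  frequencies vanish, which holds for Blaschke products.

  For \<open>d > k\<close>, multiply the Blaschke product \<open>g\<close> by the \<open>(d - k)\<close>-th power of a factor with zero at \<open>\<i>\<epsilon>\<close>. The product is again a Blaschke
  product, hence has energy \<open>2\<pi>d\<close>, and it differs from \<open>g\<close> outside \<open>I\<close> by a phase of size \<open>\<epsilon>\<close>,
  which can be removed at a cost of order \<open>\<epsilon>\<close>. A map attaining \<open>2\<pi>d\<close> would have no negative frequencies and agree with \<open>g\<close>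
  on an arc; then it agrees with \<open>g\<close> everywhere and has degree \<open>k \<noteq> d\<close>. The case \<open>k < 0\<close> follows by complex
  conjugation.
\<close>

section \<open>Fourier coefficients on the circle\<close>

text \<open>A degree in the sense of \<open>circle_has_degree\<close> has to be the value of every
  continuous extension, and this shapes both halves of the proof. The lower bound specialises the
  quantifier to one extension, \<open>fourier_degree\<close>. A competitor, on the contrary, must
  get the same value from all extensions; continuity yields this for maps that equal a C1 map of the
  circle almost everywhere, so every competitor is the \<open>lift\<close> of a C1 map. In
  particular the phase correction must be C1 on the whole circle, also over infinity and over the
  singularity 0 of \<open>1 / x\<close>. The series of \<open>n w^n\<close> diverges for
  \<open>|w| = 1\<close>, which is why radii below 1 are needed. The measure \<open>circ\<close> has
  mass \<open>2 pi\<close>, so a product of two coefficients carries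
  \<open>1 / (4 pi\<^sup>2)\<close>, and dividing the seminorm by \<open>2 pi\<close> leaves the
  factor \<open>2 pi\<close> in the energy. The interval \<open>I\<close> corresponds to the open
  lower half circle \<open>sin s < 0\<close>. The order of the removal cost comes from a correction
  of seminorm \<open>\<epsilon>\<^sup>2\<close> that enters with weight
  \<open>1 + 1 / \<epsilon>\<close>.\<close>

definition circ :: "real measure" where
  "circ = restrict_space lborel {0..2*pi}"

lemma space_circ [simp]: "space circ = {0..2*pi}"
  by (simp add: circ_def space_restrict_space)

lemma measurable_circI [measurable (raw)]: "f \<in> borel_measurable borel \<Longrightarrow> f \<in> borel_measurable circ"
  unfolding circ_def by (rule measurable_restrict_space1) simp

lemma borel_measurable_cis [measurable (raw)]:
  "f \<in> borel_measurable M \<Longrightarrow> (\<lambda>x. cis (f x)) \<in> borel_measurable M"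
  by (rule borel_measurable_continuous_on) (auto intro: continuous_intros)

lemma borel_measurable_cnj [measurable (raw)]:
  "f \<in> borel_measurable M \<Longrightarrow> (\<lambda>x. cnj (f x)) \<in> borel_measurable M"
  by (rule borel_measurable_continuous_on) (auto intro: continuous_intros)

lemma borel_measurable_circ_ident [measurable]: "(\<lambda>s. s) \<in> borel_measurable circ"
  by (rule measurable_circI) simp

lemma borel_measurable_circ2_fst_snd [measurable]:
  "fst \<in> borel_measurable (circ \<Otimes>\<^sub>M circ)" "snd \<in> borel_measurable (circ \<Otimes>\<^sub>M circ)"
  using measurable_compose[OF measurable_fst borel_measurable_circ_ident]
    measurable_compose[OF measurable_snd borel_measurable_circ_ident] by auto

lemma emeasure_circ: "emeasure circ (space circ) = ennreal (2 * pi)"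
  by (simp add: circ_def emeasure_restrict_space space_restrict_space)

lemma measure_circ: "measure circ {0..2*pi} = 2 * pi"
  using emeasure_circ by (simp add: measure_def)

interpretation circ: finite_measure circ
  by standard (simp add: emeasure_circ del: space_circ)

interpretation circ2: pair_sigma_finite circ circ ..

lemma finite_measure_circ2: "finite_measure (circ \<Otimes>\<^sub>M circ)"
  by (rule finite_measure_pair_measure) (rule circ.finite_measure_axioms)+

interpretation circ2: finite_measure "circ \<Otimes>\<^sub>M circ"
  by (rule finite_measure_circ2)

lemma nn_integral_circ:
  "(\<integral>\<^sup>+ s. F s \<partial>circ) = (\<integral>\<^sup>+ s\<in>{0..2*pi}. F s \<partial>lborel)"
  unfolding circ_def by (rule nn_integral_restrict_space) simp

lemma AE_circI: "AE s in lborel. P s \<Longrightarrow> AE s in circ. P s"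
  unfolding circ_def by (subst AE_restrict_space_iff) auto

lemma integrable_circ_bounded:
  fixes F :: "real \<Rightarrow> complex"
  assumes "F \<in> borel_measurable circ" "\<And>s. cmod (F s) \<le> C"
  shows "integrable circ F"
  by (rule circ.integrable_const_bound[of _ C]) (use assms in auto)

lemma integrable_circ2_bounded:
  fixes F :: "real \<times> real \<Rightarrow> complex"
  assumes "F \<in> borel_measurable (circ \<Otimes>\<^sub>M circ)" "\<And>s. cmod (F s) \<le> C"
  shows "integrable (circ \<Otimes>\<^sub>M circ) F"
  by (rule circ2.integrable_const_bound[of _ C]) (use assms in auto)

text \<open>Weierstrass majorants on a finite measure: the \<open>n\<close>-th term has
  \<open>L1\<close> norm at most \<open>C n\<close> times the total mass, which is what
  \<open>sums_integral\<close> asks for. The power series kernels below are dominated in this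
  way.\<close>

lemma finite_measure_bounded_sums_integral:
  fixes g :: "nat \<Rightarrow> 'a \<Rightarrow> complex"
  assumes "finite_measure M"
    and meas [measurable]: "\<And>n. g n \<in> borel_measurable M"
    and bound: "\<And>n x. cmod (g n x) \<le> C n" and "summable C"
  shows "(\<lambda>n. \<integral>x. g n x \<partial>M) sums (\<integral>x. (\<Sum>n. g n x) \<partial>M)"
proof (rule sums_integral)
  interpret finite_measure M by fact
  show int: "integrable M (g n)" for n
    by (rule integrable_const_bound[of _ "C n"]) (use bound in auto)
  show "AE x in M. summable (\<lambda>n. norm (g n x))"
    by (intro AE_I2 summable_comparison_test'[OF \<open>summable C\<close>, of 0]) (use bound in auto)
  have "norm (\<integral>x. norm (g n x) \<partial>M) \<le> C n * measure M (space M)" for n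
  proof -
    have "(\<integral>x. norm (g n x) \<partial>M) \<le> (\<integral>x. C n \<partial>M)"
      by (intro integral_mono integrable_norm int) (use bound in auto)
    then show ?thesis by (simp add: integral_nonneg_AE mult.commute)
  qed
  then show "summable (\<lambda>n. \<integral>x. norm (g n x) \<partial>M)"
    by (intro summable_comparison_test'[OF summable_mult2[OF \<open>summable C\<close>, of "measure M (space M)"], of 0])
qed

definition fc :: "(complex \<Rightarrow> complex) \<Rightarrow> int \<Rightarrow> complex" where
  "fc f n = (1 / (2 * pi)) * (\<integral>s. f (cis s) * cis (- (of_int n * s)) \<partial>circ)"

text \<open>Conjugation exchanges the frequencies \<open>n\<close> and \<open>- n\<close>, so
  negative frequencies are reached by series in nonnegative powers applied to the conjugate
  map.\<close>

lemma fc_uminus: "fc f (- n) = cnj (fc (\<lambda>z. cnj (f z)) n)"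
proof -
  have "(\<integral>s. f (cis s) * cis (of_int n * s) \<partial>circ) =
        (\<integral>s. cnj (cnj (f (cis s)) * cis (- (of_int n * s))) \<partial>circ)"
    by (simp add: cis_cnj)
  also have "\<dots> = cnj (\<integral>s. cnj (f (cis s)) * cis (- (of_int n * s)) \<partial>circ)"
    by (rule Bochner_Integration.integral_cnj)
  finally show ?thesis by (simp add: fc_def)
qed

lemma fc_cong_AE:
  assumes [measurable]: "(\<lambda>s. f (cis s)) \<in> borel_measurable circ" "(\<lambda>s. g (cis s)) \<in> borel_measurable circ"
    and "AE s in circ. f (cis s) = g (cis s)"
  shows "fc f n = fc g n"
proof -
  have "(\<integral>s. f (cis s) * cis (- (of_int n * s)) \<partial>circ) =
        (\<integral>s. g (cis s) * cis (- (of_int n * s)) \<partial>circ)"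
    by (rule integral_cong_AE) (use assms in auto)
  then show ?thesis by (simp add: fc_def)
qed

lemma integral_circ_real:
  fixes F :: "real \<Rightarrow> complex"
  assumes "continuous_on {0..2*pi} F"
  shows "(\<integral>s. F s \<partial>circ) = integral {0..2*pi} F"
proof -
  have i: "set_integrable lborel {0..2*pi} F"
    by (rule borel_integrable_atLeastAtMost') fact
  have "(\<integral>s. F s \<partial>circ) = set_lebesgue_integral lborel {0..2*pi} F"
    by (simp add: circ_def integral_restrict_space set_lebesgue_integral_def)
  also have "\<dots> = integral {0..2*pi} F"
    by (rule set_borel_integral_eq_integral(2)[OF i])
  finally show ?thesis .
qed

lemma has_vector_derivative_cis_linear:
  "((\<lambda>s. cis (a * s)) has_vector_derivative \<i> * of_real a * cis (a * s)) (at s within S)"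
proof -
  have "((\<lambda>s. exp (\<i> * of_real a * of_real s)) has_vector_derivative (\<i> * of_real a * exp (\<i> * of_real a * of_real s))) (at s within S)"
    by (rule has_vector_derivative_real_field[of "\<lambda>z. exp (\<i> * of_real a * z)", THEN has_vector_derivative_at_within])
       (auto intro!: derivative_eq_intros)
  then show ?thesis by (simp add: cis_conv_exp mult.assoc)
qed

lemma integral_circ_derivative:
  fixes F :: "real \<Rightarrow> complex"
  assumes "\<And>s. (F has_vector_derivative F' s) (at s)" "continuous_on UNIV F'" "F (2*pi) = F 0"
  shows "(\<integral>s. F' s \<partial>circ) = 0"
proof -
  have "(F' has_integral F (2*pi) - F 0) {0..2*pi}"
    by (rule fundamental_theorem_of_calculus)
       (use assms in \<open>auto intro: has_vector_derivative_at_within\<close>)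
  moreover have "continuous_on {0..2*pi} F'"
    using assms(2) continuous_on_subset by blast
  ultimately show ?thesis
    by (simp add: integral_circ_real integral_unique assms(3))
qed

lemma fc_one: "fc (\<lambda>z. 1) n = (if n = 0 then 1 else 0)"
proof (cases "n = 0")
  case True
  then show ?thesis by (simp add: fc_def measure_circ scaleR_conv_of_real)
next
  case False
  have "(\<integral>s. \<i> * of_real (- of_int n) * cis (- of_int n * s) \<partial>circ) = 0"
  proof (rule integral_circ_derivative)
    show "((\<lambda>s. cis (- of_int n * s)) has_vector_derivative \<i> * of_real (- of_int n) * cis (- of_int n * s)) (at s)" for s
      by (rule has_vector_derivative_cis_linear)
    have "cis (of_int (-n) * (2*pi)) = 1"
      using cis_multiple_2pi[of "of_int (-n)"] by (simp add: mult.commute mult.left_commute)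
    then show "cis (- of_int n * (2*pi)) = cis (- of_int n * 0)" by simp
  qed (auto intro!: continuous_intros simp: cis.ctr)
  then show ?thesis using False by (simp add: fc_def)
qed

text \<open>Each summand is a double integral against \<open>cis (t - s) ^ n\<close>, and the
  majorants allow summing inside. The weights stay free: \<open>n r^n\<close> produces the kernel of
  the seminorm, \<open>r^n\<close> the Poisson kernel.\<close>

lemma fc_sums_pair:
  fixes a b :: "complex \<Rightarrow> complex" and c :: "nat \<Rightarrow> complex"
  assumes [measurable]: "(\<lambda>s. a (cis s)) \<in> borel_measurable circ" "(\<lambda>s. b (cis s)) \<in> borel_measurable circ"
    and ba: "\<And>s. cmod (a (cis s)) \<le> A" and bb: "\<And>s. cmod (b (cis s)) \<le> B"
    and c: "summable (\<lambda>n. norm (c n))"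
  shows "(\<lambda>n. c n * (fc a n * cnj (fc b n))) sums
     ((1 / (4 * pi\<^sup>2)) * (\<integral>p. a (cis (fst p)) * cnj (b (cis (snd p))) *
         (\<Sum>n. c n * cis (snd p - fst p) ^ n) \<partial>(circ \<Otimes>\<^sub>M circ)))"
proof -
  let ?g = "\<lambda>n p. a (cis (fst p)) * cnj (b (cis (snd p))) * (c n * cis (snd p - fst p) ^ n)"
  let ?C = "\<lambda>n. A * B * norm (c n)"
  have A0: "0 \<le> A" using ba[of 0] norm_ge_zero order_trans by blast
  have [measurable]: "?g n \<in> borel_measurable (circ \<Otimes>\<^sub>M circ)" for n
    by measurable
  have bound: "cmod (?g n p) \<le> ?C n" for n p
  proof -
    have "cmod (a (cis (fst p))) * cmod (b (cis (snd p))) \<le> A * B"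
      by (intro mult_mono ba bb A0) auto
    then show ?thesis by (simp add: norm_mult norm_power mult_right_mono)
  qed
  have int: "(\<integral>p. ?g n p \<partial>(circ \<Otimes>\<^sub>M circ)) = 4 * pi\<^sup>2 * (c n * (fc a n * cnj (fc b n)))" for n
  proof -
    have i: "integrable (circ \<Otimes>\<^sub>M circ) (?g n)"
      by (rule integrable_circ2_bounded[OF _ bound]) simp
    have e: "cis (t - s) ^ n = cis (- (n * s)) * cnj (cis (- (n * t)))" for s t :: real
      by (simp add: Complex.DeMoivre cis_cnj cis_mult algebra_simps)
    have "(\<integral>p. ?g n p \<partial>(circ \<Otimes>\<^sub>M circ)) = (\<integral>s. (\<integral>t. ?g n (s, t) \<partial>circ) \<partial>circ)"
      using circ2.integral_fst'[OF i] by simp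
    also have "\<dots> = (\<integral>s. (\<integral>t. (c n * (a (cis s) * cis (- (n * s)))) * cnj (b (cis t) * cis (- (n * t))) \<partial>circ) \<partial>circ)"
      by (simp only: fst_conv snd_conv e complex_cnj_mult mult_ac)
    also have "\<dots> = (\<integral>s. (c n * (a (cis s) * cis (- (n * s)))) * cnj (\<integral>t. b (cis t) * cis (- (n * t)) \<partial>circ) \<partial>circ)"
      by (subst integral_mult_right_zero) (simp only: Bochner_Integration.integral_cnj)
    also have "\<dots> = c n * (\<integral>s. (a (cis s) * cis (- (n * s))) \<partial>circ) * cnj (\<integral>t. b (cis t) * cis (- (n * t)) \<partial>circ)"
      by (subst integral_mult_left_zero, subst integral_mult_right_zero) simp
    finally show ?thesis by (simp add: fc_def power2_eq_square)
  qed
  have "(\<lambda>n. \<integral>p. ?g n p \<partial>(circ \<Otimes>\<^sub>M circ)) sums (\<integral>p. (\<Sum>n. ?g n p) \<partial>(circ \<Otimes>\<^sub>M circ))"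
    by (rule finite_measure_bounded_sums_integral[OF finite_measure_circ2 _ bound])
       (auto intro!: summable_mult c)
  also have "(\<lambda>p. \<Sum>n. ?g n p) = (\<lambda>p. a (cis (fst p)) * cnj (b (cis (snd p))) *
         (\<Sum>n. c n * cis (snd p - fst p) ^ n))"
    by (intro ext suminf_mult summable_norm_cancel[of "\<lambda>n. c n * _ ^ n"]) (simp add: norm_mult norm_power c)
  finally have "(\<lambda>n. (1 / (4 * pi\<^sup>2)) * (4 * pi\<^sup>2 * (c n * (fc a n * cnj (fc b n))))) sums
     ((1 / (4 * pi\<^sup>2)) * (\<integral>p. a (cis (fst p)) * cnj (b (cis (snd p))) *
         (\<Sum>n. c n * cis (snd p - fst p) ^ n) \<partial>(circ \<Otimes>\<^sub>M circ)))"
    unfolding int by (intro sums_mult) simp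
  then show ?thesis by simp
qed

section \<open>The Gagliardo seminorm in terms of Fourier coefficients\<close>

text \<open>Radii along a sequence, as dominated convergence asks for; the shift by 2 keeps
  \<open>abel 0 = 1/2\<close> strictly inside \<open>(0, 1)\<close>.\<close>

definition abel :: "nat \<Rightarrow> real" where
  "abel N = 1 - 1 / (real N + 2)"

lemma abel_bounds: "0 < abel N" "abel N < 1"
  by (auto simp: abel_def field_simps)

lemma abel_tendsto: "abel \<longlonglongrightarrow> 1"
proof -
  have "(\<lambda>N. 1 - 1 / (real N + 2)) \<longlonglongrightarrow> 1 - 0"
    using LIMSEQ_ignore_initial_segment[OF lim_1_over_n[where 'a=real], of 2]
    by (intro tendsto_diff tendsto_const) (simp add: add.commute)
  then show ?thesis by (simp add: abel_def[abs_def])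
qed

text \<open>For nonnegative terms Abel summability implies summability: a partial sum is the limit
  of partial Abel sums, which lie below \<open>A N\<close>, hence is at most \<open>S\<close>;
  conversely \<open>A N \<le> suminf a\<close>.\<close>

lemma abel_limit_nonneg:
  fixes a :: "nat \<Rightarrow> real"
  assumes nn: "\<And>n. 0 \<le> a n" and sums: "\<And>N. (\<lambda>n. abel N ^ n * a n) sums A N" and lim: "A \<longlonglongrightarrow> S"
  shows "a sums S"
proof -
  have partial: "sum a {..<K} \<le> S" for K
  proof (rule LIMSEQ_le)
    show "(\<lambda>N. \<Sum>n<K. abel N ^ n * a n) \<longlonglongrightarrow> sum a {..<K}"
      using tendsto_sum[where I="{..<K}", OF tendsto_mult_right[OF tendsto_power[OF abel_tendsto]]]
      by simp
    show "A \<longlonglongrightarrow> S" by fact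
    have "(\<Sum>n<K. abel N ^ n * a n) \<le> A N" for N
      unfolding sums_unique[OF sums]
      by (rule sum_le_suminf) (use sums_summable[OF sums] abel_bounds[of N] nn in auto)
    then show "\<exists>M. \<forall>N\<ge>M. (\<Sum>n<K. abel N ^ n * a n) \<le> A N" by blast
  qed
  have "summable a"
    by (rule summableI_nonneg_bounded[of _ S]) (use nn partial in auto)
  moreover have "suminf a \<le> S"
    by (rule suminf_le_const) fact+
  moreover have "S \<le> suminf a"
  proof (rule LIMSEQ_le_const2[OF lim], intro exI[of _ 0] allI impI)
    fix N
    have "A N = (\<Sum>n. abel N ^ n * a n)" using sums by (simp add: sums_iff)
    also have "\<dots> \<le> suminf a"
    proof (rule suminf_le)
      show "abel N ^ n * a n \<le> a n" for n
        using abel_bounds[of N] nn[of n] by (simp add: mult_left_le_one_le power_le_one)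
    qed (use sums \<open>summable a\<close> in \<open>auto simp: sums_iff\<close>)
    finally show "A N \<le> suminf a" .
  qed
  ultimately show ?thesis by (simp add: sums_iff)
qed

section \<open>The Abel kernels of the seminorm\<close>

lemma sums_nat_times_power:
  fixes q :: complex
  assumes "cmod q < 1"
  shows "(\<lambda>n. of_nat n * q ^ n) sums (q / (1 - q)\<^sup>2)"
proof -
  have "(\<lambda>n. q * (of_nat (Suc n) * q ^ n)) sums (q * (1 / (1 - q)\<^sup>2))"
    by (intro sums_mult geometric_deriv_sums assms)
  then have "(\<lambda>n. of_nat (Suc n) * q ^ Suc n) sums (q / (1 - q)\<^sup>2)"
    by (simp add: mult_ac)
  then show ?thesis by (subst (asm) sums_Suc_iff) simp
qed

lemma summable_abel_weight:
  assumes "0 < r" "r < 1"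
  shows "summable (\<lambda>n. norm (of_nat n * of_real r ^ n :: complex))"
proof -
  have "summable (\<lambda>n. of_real (real n * r ^ n) :: complex)"
    using sums_summable[OF sums_nat_times_power[of "of_real r"]] assms by simp
  then have "summable (\<lambda>n. real n * r ^ n)"
    by (subst (asm) summable_complex_of_real)
  then show ?thesis using assms by (simp add: norm_mult norm_power)
qed

text \<open>The two nonnegative summands serve separately as lower bounds: the first for a fixed
  radius, the second uniformly in the radius.\<close>

lemma cmod_one_minus_scaled:
  assumes "cmod w = 1"
  shows "(cmod (1 - of_real r * w))\<^sup>2 = (1 - r)\<^sup>2 + r * (cmod (1 - w))\<^sup>2"
proof -
  have "(Im w)\<^sup>2 = 1 - (Re w)\<^sup>2" using assms cmod_power2[of w] by simp
  then show ?thesis by (simp add: cmod_power2 power2_diff power_mult_distrib) (simp add: algebra_simps)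
qed

text \<open>The factor \<open>r\<close> of the numerator cancels the one in the lower bound
  \<open>r |1 - w|^2\<close> of the denominator. The constant is therefore 1, and the integrand of
  the seminorm is itself the majorant.\<close>

lemma abel_kernel_bound:
  assumes "cmod w = 1" "0 < r" "r < 1" "w \<noteq> 1"
  shows "cmod (of_real r * w / (1 - of_real r * w)\<^sup>2) \<le> 1 / (cmod (1 - w))\<^sup>2"
proof -
  have pos: "0 < (cmod (1 - w))\<^sup>2" using assms by simp
  have "r * (cmod (1 - w))\<^sup>2 \<le> (cmod (1 - of_real r * w))\<^sup>2"
    using cmod_one_minus_scaled[OF assms(1), of r] by simp
  moreover have "0 < r * (cmod (1 - w))\<^sup>2" using pos assms by simp
  ultimately have "r / (cmod (1 - of_real r * w))\<^sup>2 \<le> r / (r * (cmod (1 - w))\<^sup>2)"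
    using assms pos by (intro divide_left_mono mult_pos_pos) linarith+
  then show ?thesis using assms by (simp add: norm_divide norm_mult norm_power)
qed

text \<open>On the circle \<open>1 - w = - w (1 - cnj w)\<close>, hence
  \<open>(1 - w)^2 = - w |1 - w|^2\<close>. This is the origin of the minus sign in front of the
  kernel.\<close>

lemma abel_kernel_limit:
  assumes "cmod w = 1" "w \<noteq> 1"
  shows "- (w / (1 - w)\<^sup>2) = of_real (1 / (cmod (1 - w))\<^sup>2)"
proof -
  have "w * cnj w = 1" using assms by (metis complex_norm_square of_real_1 power_one)
  moreover have "of_real ((cmod (1 - w))\<^sup>2) = (1 - w) * (1 - cnj w)"
    by (metis complex_norm_square complex_cnj_diff complex_cnj_one)
  moreover have nz: "w \<noteq> 0" "1 - w \<noteq> 0" using assms by auto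
  moreover have "1 - w = - w * (1 - cnj w)" using \<open>w * cnj w = 1\<close> by (simp add: algebra_simps)
  then have "(1 - w)\<^sup>2 = - w * ((1 - w) * (1 - cnj w))"
    by (metis mult.assoc mult.left_commute power2_eq_square)
  ultimately show ?thesis by (simp del: of_real_power)
qed

lemma gagliardo_circle_circ2:
  assumes [measurable]: "(\<lambda>s. f (cis s)) \<in> borel_measurable circ"
  shows "gagliardo_circle f = (\<integral>\<^sup>+p. ennreal ((cmod (f (cis (fst p)) - f (cis (snd p))))\<^sup>2 /
     (cmod (cis (fst p) - cis (snd p)))\<^sup>2) \<partial>(circ \<Otimes>\<^sub>M circ))"
  unfolding gagliardo_circle_def nn_integral_circ[symmetric]
  by (subst circ.nn_integral_fst[symmetric]) auto

text \<open>The frequencies \<open>n\<close> and \<open>- n\<close> are grouped, so that series over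
  the integers become series over \<open>nat\<close>.\<close>

definition freq :: "(complex \<Rightarrow> complex) \<Rightarrow> nat \<Rightarrow> real" where
  "freq f n = real n * ((cmod (fc f (int n)))\<^sup>2 + (cmod (fc f (- int n)))\<^sup>2)"

lemma freq_nonneg: "0 \<le> freq f n"
  by (simp add: freq_def)

text \<open>Summation gives the kernel tested against \<open>f(s) cnj f(t)\<close> and its
  conjugate. The square \<open>|f(s) - f(t)|^2\<close> is completed by \<open>|f(s)|^2\<close> and
  \<open>|f(t)|^2\<close>, whose integrals against the kernel vanish because the weight at frequency
  0 is 0.\<close>

lemma gagliardo_fourier_abel:
  assumes meas [measurable]: "(\<lambda>s. f (cis s)) \<in> borel_measurable circ"
    and bd: "\<And>s. cmod (f (cis s)) \<le> B" and r: "0 < r" "r < 1"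
  shows "(\<lambda>n. of_real (r ^ n * freq f n)) sums
    (1 / (4 * pi\<^sup>2) * (\<integral>p. of_real ((cmod (f (cis (fst p)) - f (cis (snd p))))\<^sup>2) *
       (- (of_real r * cis (snd p - fst p) / (1 - of_real r * cis (snd p - fst p))\<^sup>2)) \<partial>(circ \<Otimes>\<^sub>M circ)))"
proof -
  define S where "S p = of_real r * cis (snd p - fst p) / (1 - of_real r * cis (snd p - fst p))\<^sup>2" for p :: "real \<times> real"
  define c where "c n = (of_nat n * of_real r ^ n :: complex)" for n
  have c: "summable (\<lambda>n. norm (c n))"
    unfolding c_def by (rule summable_abel_weight) (use r in auto)
  have S: "(\<Sum>n. c n * cis (snd p - fst p) ^ n) = S p" for p
    using sums_nat_times_power[of "of_real r * cis (snd p - fst p)"] r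
    by (simp add: S_def c_def norm_mult power_mult_distrib mult.assoc sums_iff)
  have [measurable]: "S \<in> borel_measurable (circ \<Otimes>\<^sub>M circ)"
    unfolding S_def[abs_def] by measurable
  have Sb: "cmod (S p) \<le> 1 / (1 - r)\<^sup>2" for p
  proof -
    have "(1 - r)\<^sup>2 \<le> (cmod (1 - of_real r * cis (snd p - fst p)))\<^sup>2"
      using cmod_one_minus_scaled[of "cis (snd p - fst p)" r] r by simp
    then show ?thesis
      unfolding S_def using r by (auto simp: norm_divide norm_mult norm_power intro!: frac_le)
  qed
  let ?I = "\<lambda>G. \<integral>p. G p * S p \<partial>(circ \<Otimes>\<^sub>M circ)"
  let ?fs = "\<lambda>p. f (cis (fst p))" and ?ft = "\<lambda>p. f (cis (snd p))"
  have B0: "0 \<le> B" using bd[of 0] norm_ge_zero order_trans by blast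
  have s1: "(\<lambda>n. c n * (fc a n * cnj (fc b n))) sums (1 / (4 * pi\<^sup>2) * ?I (\<lambda>p. a (cis (fst p)) * cnj (b (cis (snd p)))))"
    if "(\<lambda>s. a (cis s)) \<in> borel_measurable circ" "(\<lambda>s. b (cis s)) \<in> borel_measurable circ"
      "\<And>s. cmod (a (cis s)) \<le> A" "\<And>s. cmod (b (cis s)) \<le> C" for a b A C
    using fc_sums_pair[OF that c] unfolding S .
  have fcnj: "\<And>s. cmod (cnj (f (cis s))) \<le> B" using bd by simp
  have fsq: "\<And>s. cmod (of_real ((cmod (f (cis s)))\<^sup>2)) \<le> B\<^sup>2" using bd by (simp add: norm_power power_mono)
  have one: "\<And>s. cmod ((\<lambda>z. 1) (cis s)) \<le> 1" by simp
  \<comment> \<open>When one of the two functions is constant, only frequency 0 could contribute,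
    and there \<open>c 0 = 0\<close>.\<close>
  have zero: "?I G = 0" if "(\<lambda>n. c n * (fc a n * cnj (fc b n))) sums (1 / (4 * pi\<^sup>2) * ?I G)"
     "\<And>n. n \<noteq> 0 \<Longrightarrow> fc a (int n) = 0 \<or> fc b (int n) = 0" for G a b
  proof -
    have "c n * (fc a n * cnj (fc b n)) = 0" for n
      using that(2)[of n] by (cases "n = 0") (auto simp: c_def)
    then have "(\<lambda>n. c n * (fc a n * cnj (fc b n))) = (\<lambda>n. 0)" by blast
    then have "1 / (4 * pi\<^sup>2) * ?I G = 0" using sums_unique2[OF that(1), of 0] by simp
    then show ?thesis by simp
  qed
  have z1: "?I (\<lambda>p. of_real ((cmod (?fs p))\<^sup>2)) = 0"
    using zero[OF s1[of "\<lambda>z. of_real ((cmod (f z))\<^sup>2)" "\<lambda>z. 1" "B\<^sup>2" 1, OF _ _ fsq one]] by (simp add: fc_one)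
  have z2: "?I (\<lambda>p. of_real ((cmod (?ft p))\<^sup>2)) = 0"
    using zero[OF s1[of "\<lambda>z. 1" "\<lambda>z. of_real ((cmod (f z))\<^sup>2)" 1 "B\<^sup>2", OF _ _ one fsq]] by (simp add: fc_one)
  \<comment> \<open>The pair \<open>f\<close>, \<open>f\<close> gives the positive frequencies, the
    pair of conjugates the negative ones.\<close>
  have "(\<lambda>n. c n * (fc f n * cnj (fc f n)) + c n * (fc (\<lambda>z. cnj (f z)) n * cnj (fc (\<lambda>z. cnj (f z)) n))) sums
     (1 / (4 * pi\<^sup>2) * ?I (\<lambda>p. ?fs p * cnj (?ft p)) + 1 / (4 * pi\<^sup>2) * ?I (\<lambda>p. cnj (?fs p) * cnj (cnj (?ft p))))"
    by (intro sums_add s1[of f f, OF _ _ bd bd] s1[of "\<lambda>z. cnj (f z)" "\<lambda>z. cnj (f z)", OF _ _ fcnj fcnj]) measurable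
  also have "(\<lambda>n. c n * (fc f n * cnj (fc f n)) + c n * (fc (\<lambda>z. cnj (f z)) n * cnj (fc (\<lambda>z. cnj (f z)) n))) =
     (\<lambda>n. of_real (r ^ n * freq f n))"
    by (rule ext) (simp add: c_def freq_def fc_uminus complex_norm_square[symmetric] algebra_simps)
  also have "1 / (4 * pi\<^sup>2) * ?I (\<lambda>p. ?fs p * cnj (?ft p)) + 1 / (4 * pi\<^sup>2) * ?I (\<lambda>p. cnj (?fs p) * cnj (cnj (?ft p)))
    = 1 / (4 * pi\<^sup>2) * (?I (\<lambda>p. ?fs p * cnj (?ft p)) + ?I (\<lambda>p. cnj (?fs p) * cnj (cnj (?ft p)))
        - ?I (\<lambda>p. of_real ((cmod (?fs p))\<^sup>2)) - ?I (\<lambda>p. of_real ((cmod (?ft p))\<^sup>2)))"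
    unfolding z1 z2 by (simp add: algebra_simps)
  also have "?I (\<lambda>p. ?fs p * cnj (?ft p)) + ?I (\<lambda>p. cnj (?fs p) * cnj (cnj (?ft p)))
        - ?I (\<lambda>p. of_real ((cmod (?fs p))\<^sup>2)) - ?I (\<lambda>p. of_real ((cmod (?ft p))\<^sup>2)) =
     (\<integral>p. ?fs p * cnj (?ft p) * S p + cnj (?fs p) * cnj (cnj (?ft p)) * S p
        - of_real ((cmod (?fs p))\<^sup>2) * S p - of_real ((cmod (?ft p))\<^sup>2) * S p \<partial>(circ \<Otimes>\<^sub>M circ))"
  proof -
    have int: "integrable (circ \<Otimes>\<^sub>M circ) (\<lambda>p. G p * S p)"
      if [measurable]: "G \<in> borel_measurable (circ \<Otimes>\<^sub>M circ)" and "\<And>p. cmod (G p) \<le> B * B" for G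
    proof (rule integrable_circ2_bounded)
      show "cmod (G p * S p) \<le> (B * B) * (1 / (1 - r)\<^sup>2)" for p
        unfolding norm_mult by (intro mult_mono that Sb) (auto simp: B0)
    qed simp
    have bb: "x \<le> B \<Longrightarrow> y \<le> B \<Longrightarrow> 0 \<le> y \<Longrightarrow> x * y \<le> B * B" for x y
      by (rule mult_mono) (auto simp: B0)
    have i1: "integrable (circ \<Otimes>\<^sub>M circ) (\<lambda>p. ?fs p * cnj (?ft p) * S p)"
      by (rule int) (auto simp: norm_mult bd bb)
    have i2: "integrable (circ \<Otimes>\<^sub>M circ) (\<lambda>p. cnj (?fs p) * cnj (cnj (?ft p)) * S p)"
      by (rule int) (auto simp: norm_mult bd bb)
    have i3: "integrable (circ \<Otimes>\<^sub>M circ) (\<lambda>p. of_real ((cmod (?fs p))\<^sup>2) * S p)"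
      by (rule int) (auto simp: norm_mult power2_eq_square bd bb)
    have i4: "integrable (circ \<Otimes>\<^sub>M circ) (\<lambda>p. of_real ((cmod (?ft p))\<^sup>2) * S p)"
      by (rule int) (auto simp: norm_mult power2_eq_square bd bb)
    show ?thesis
      by (subst Bochner_Integration.integral_diff Bochner_Integration.integral_add; (intro i1 i2 i3 i4 Bochner_Integration.integrable_diff Bochner_Integration.integrable_add)?)+ simp
  qed
  also have "(\<lambda>p. ?fs p * cnj (?ft p) * S p + cnj (?fs p) * cnj (cnj (?ft p)) * S p
        - of_real ((cmod (?fs p))\<^sup>2) * S p - of_real ((cmod (?ft p))\<^sup>2) * S p)
      = (\<lambda>p. of_real ((cmod (?fs p - ?ft p))\<^sup>2) * (- S p))"
    unfolding complex_norm_square by (rule ext) (simp add: algebra_simps)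
  finally show ?thesis by (simp only: S_def)
qed

lemma gagliardo_integrable:
  assumes [measurable]: "(\<lambda>s. f (cis s)) \<in> borel_measurable circ" and fin: "gagliardo_circle f < \<infinity>"
  defines "F \<equiv> \<lambda>p. (cmod (f (cis (fst p)) - f (cis (snd p))))\<^sup>2 / (cmod (cis (fst p) - cis (snd p)))\<^sup>2"
  shows "integrable (circ \<Otimes>\<^sub>M circ) F" "gagliardo_circle f = ennreal (integral\<^sup>L (circ \<Otimes>\<^sub>M circ) F)"
proof -
  have [measurable]: "F \<in> borel_measurable (circ \<Otimes>\<^sub>M circ)" unfolding F_def by measurable
  have G: "gagliardo_circle f = (\<integral>\<^sup>+p. ennreal (F p) \<partial>(circ \<Otimes>\<^sub>M circ))"
    unfolding F_def by (rule gagliardo_circle_circ2) simp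
  show i: "integrable (circ \<Otimes>\<^sub>M circ) F"
    by (rule integrableI_nonneg) (use fin in \<open>auto simp: G F_def[symmetric]\<close>, auto simp: F_def)
  show "gagliardo_circle f = ennreal (integral\<^sup>L (circ \<Otimes>\<^sub>M circ) F)"
    unfolding G by (rule nn_integral_eq_integral[OF i]) (simp add: F_def)
qed

lemma cmod_cis_diff: "cmod (cis s - cis t) = cmod (1 - cis (t - s))"
proof -
  have "cis s - cis t = cis s * (1 - cis (t - s))" by (simp add: right_diff_distrib cis_mult)
  then show ?thesis by (simp add: norm_mult)
qed

lemma gagliardo_fourier_bounded:
  assumes meas [measurable]: "(\<lambda>s. f (cis s)) \<in> borel_measurable circ"
    and bd: "\<And>s. cmod (f (cis s)) \<le> B" and fin: "gagliardo_circle f < \<infinity>"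
  shows "freq f sums (enn2real (gagliardo_circle f) / (4 * pi\<^sup>2))"
proof -
  define F where "F p = (cmod (f (cis (fst p)) - f (cis (snd p))))\<^sup>2 / (cmod (cis (fst p) - cis (snd p)))\<^sup>2" for p
  note F = gagliardo_integrable[OF meas fin, folded F_def[abs_def]]
  have [measurable]: "F \<in> borel_measurable (circ \<Otimes>\<^sub>M circ)" using F(1) by auto
  have G: "enn2real (gagliardo_circle f) = integral\<^sup>L (circ \<Otimes>\<^sub>M circ) F"
    unfolding F(2) by (intro enn2real_ennreal Bochner_Integration.integral_nonneg) (simp add: F_def)
  define K where "K N p = of_real ((cmod (f (cis (fst p)) - f (cis (snd p))))\<^sup>2) *
       (- (of_real (abel N) * cis (snd p - fst p) / (1 - of_real (abel N) * cis (snd p - fst p))\<^sup>2))" for N p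
  have [measurable]: "K N \<in> borel_measurable (circ \<Otimes>\<^sub>M circ)" for N unfolding K_def by measurable
  have sums: "(\<lambda>n. of_real (abel N ^ n * freq f n)) sums (1 / (4 * pi\<^sup>2) * integral\<^sup>L (circ \<Otimes>\<^sub>M circ) (K N))" for N
    unfolding K_def by (rule gagliardo_fourier_abel[OF meas bd abel_bounds])
  have "(\<lambda>N. integral\<^sup>L (circ \<Otimes>\<^sub>M circ) (K N)) \<longlonglongrightarrow> (\<integral>p. complex_of_real (F p) \<partial>(circ \<Otimes>\<^sub>M circ))"
  proof (rule integral_dominated_convergence[where w=F])
    show "AE p in circ \<Otimes>\<^sub>M circ. norm (K N p) \<le> F p" for N
    proof (rule AE_I2)
      fix p :: "real \<times> real"
      show "norm (K N p) \<le> F p"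
      \<comment> \<open>If the two points of the circle coincide, which includes the pair of end
        points \<open>0\<close> and \<open>2 pi\<close>, both sides are 0: the values of
        \<open>f\<close> agree, and division by 0 gives 0.\<close>
      proof (cases "cis (fst p) = cis (snd p)")
        case False
        then have ne: "cis (snd p - fst p) \<noteq> 1"
          by (metis cis_divide cis_neq_zero divide_eq_1_iff)
        have "norm (K N p) \<le> (cmod (f (cis (fst p)) - f (cis (snd p))))\<^sup>2 * (1 / (cmod (1 - cis (snd p - fst p)))\<^sup>2)"
          unfolding K_def norm_mult norm_minus_cancel
          by (intro mult_mono abel_kernel_bound ne abel_bounds) (auto simp: norm_power)
        then show ?thesis by (simp add: F_def cmod_cis_diff)
      qed (simp add: K_def F_def)
    qed
    show "AE p in circ \<Otimes>\<^sub>M circ. (\<lambda>N. K N p) \<longlonglongrightarrow> complex_of_real (F p)"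
    proof (rule AE_I2)
      fix p :: "real \<times> real"
      show "(\<lambda>N. K N p) \<longlonglongrightarrow> complex_of_real (F p)"
      proof (cases "cis (fst p) = cis (snd p)")
        case False
        define w where "w = cis (snd p - fst p)"
        have w: "w \<noteq> 1" "cmod w = 1" using False unfolding w_def
          by (metis cis_divide cis_neq_zero divide_eq_1_iff, simp)
        have "(\<lambda>N. of_real ((cmod (f (cis (fst p)) - f (cis (snd p))))\<^sup>2) *
          (- (of_real (abel N) * w / (1 - of_real (abel N) * w)\<^sup>2))) \<longlonglongrightarrow>
           of_real ((cmod (f (cis (fst p)) - f (cis (snd p))))\<^sup>2) * (- (of_real 1 * w / (1 - of_real 1 * w)\<^sup>2))"
          by (intro tendsto_intros abel_tendsto) (use w in auto)
        then show ?thesis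
          unfolding of_real_1 mult_1_left abel_kernel_limit[OF w(2,1)]
          by (simp add: K_def F_def cmod_cis_diff w_def del: of_real_power)
      qed (simp add: K_def F_def)
    qed
  qed (use F in auto)
  also have "(\<integral>p. complex_of_real (F p) \<partial>(circ \<Otimes>\<^sub>M circ)) = of_real (integral\<^sup>L (circ \<Otimes>\<^sub>M circ) F)"
    by simp
  finally have lim: "(\<lambda>N. 1 / (4 * pi\<^sup>2) * integral\<^sup>L (circ \<Otimes>\<^sub>M circ) (K N)) \<longlonglongrightarrow> complex_of_real (1 / (4 * pi\<^sup>2)) * of_real (integral\<^sup>L (circ \<Otimes>\<^sub>M circ) F)"
    by (intro tendsto_mult tendsto_const)
  show ?thesis
  proof (rule abel_limit_nonneg[OF freq_nonneg])
    show "(\<lambda>n. abel N ^ n * freq f n) sums Re (1 / (4 * pi\<^sup>2) * integral\<^sup>L (circ \<Otimes>\<^sub>M circ) (K N))" for N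
      using sums_Re[OF sums[of N]] by simp
    show "(\<lambda>N. Re (1 / (4 * pi\<^sup>2) * integral\<^sup>L (circ \<Otimes>\<^sub>M circ) (K N))) \<longlonglongrightarrow> enn2real (gagliardo_circle f) / (4 * pi\<^sup>2)"
      using tendsto_Re[OF lim] by (simp add: G)
  qed
qed

lemma gagliardo_circle_cong_AE:
  assumes "AE s in circ. f (cis s) = g (cis s)"
  shows "gagliardo_circle f = gagliardo_circle g"
  unfolding gagliardo_circle_def nn_integral_circ[symmetric]
  using assms
  by (intro nn_integral_cong_AE, eventually_elim) (intro nn_integral_cong_AE, use assms in eventually_elim, simp)

text \<open>The kernel lemmas need pointwise bounds, whereas a Sobolev map is bounded only almost
  everywhere. Cutting it off on the exceptional null set changes neither the coefficients nor the
  seminorm.\<close>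

lemma gagliardo_fourier:
  assumes meas [measurable]: "(\<lambda>s. f (cis s)) \<in> borel_measurable circ"
    and bd: "AE s in circ. cmod (f (cis s)) \<le> B" and fin: "gagliardo_circle f < \<infinity>"
  shows "freq f sums (enn2real (gagliardo_circle f) / (4 * pi\<^sup>2))"
proof -
  define g where "g z = (if cmod (f z) \<le> B then f z else 0)" for z
  have [measurable]: "(\<lambda>s. g (cis s)) \<in> borel_measurable circ" unfolding g_def by measurable
  have ae: "AE s in circ. f (cis s) = g (cis s)" using bd by eventually_elim (simp add: g_def)
  note gag = gagliardo_circle_cong_AE[OF ae]
  have "freq f = freq g" by (simp add: freq_def[abs_def] fc_cong_AE[OF _ _ ae])
  moreover have "freq g sums (enn2real (gagliardo_circle g) / (4 * pi\<^sup>2))"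
  proof (rule gagliardo_fourier_bounded)
    show "cmod (g (cis s)) \<le> max B 0" for s by (auto simp: g_def)
  qed (use fin gag in auto)
  ultimately show ?thesis using gag by simp
qed

section \<open>Continuously differentiable maps of the circle\<close>

lemma sin_ge_half:
  fixes x :: real
  assumes "0 \<le> x" "x \<le> pi / 2"
  shows "x / 2 \<le> sin x"
proof -
  have "\<bar>sin x - x\<bar> \<le> x ^ 3 / 6"
    using Maclaurin_sin_bound[of x 3] assms
    by (simp add: numeral_3_eq_3 sin_coeff_def fact_numeral)
  \<comment> \<open>\<open>pi / 2 < 8/5\<close> and \<open>(8/5)\<^sup>2 < 3\<close>, so the cubic
    error \<open>x ^ 3 / 6\<close> is at most \<open>x / 2\<close>.\<close>
  moreover have "x\<^sup>2 \<le> (8/5)\<^sup>2"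
    by (rule power_mono) (use assms pi_less_4 pi_approx in auto)
  then have "x * x\<^sup>2 \<le> x * 3" using assms by (intro mult_left_mono) (auto simp: power2_eq_square)
  then have "x ^ 3 \<le> x * 3" by (simp add: power3_eq_cube power2_eq_square)
  ultimately show ?thesis by linarith
qed

text \<open>The chord has length \<open>2 |sin (t / 2)|\<close>, which \<open>sin_ge_half\<close>
  bounds below by \<open>|t| / 2\<close>.\<close>

lemma cmod_one_minus_cis_ge:
  assumes "\<bar>t\<bar> \<le> pi"
  shows "\<bar>t\<bar> \<le> 2 * cmod (1 - cis t)"
proof -
  have "(cmod (1 - cis t))\<^sup>2 = 2 - 2 * cos t"
    using sin_cos_squared_add[of t] by (simp add: cmod_power2 power2_diff)
  also have "\<dots> = 4 * (sin (t / 2))\<^sup>2"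
    using cos_double_sin[of "t/2"] by simp
  finally have "(cmod (1 - cis t))\<^sup>2 = 4 * (sin (t / 2))\<^sup>2" .
  then have "cmod (1 - cis t) = 2 * \<bar>sin (t / 2)\<bar>"
    by - (rule power2_eq_imp_eq, auto simp: power_mult_distrib)
  also have "\<bar>sin (t / 2)\<bar> = \<bar>sin (\<bar>t\<bar> / 2)\<bar>"
    by (cases "t \<ge> 0") (auto simp: abs_if)
  finally show ?thesis using sin_ge_half[of "\<bar>t\<bar> / 2"] assms by simp
qed

lemma cis_eq_shift:
  assumes "cis s = cis t"
  shows "cis (x + (t - s)) = cis x"
  using assms by (metis cis_divide cis_mult cis_neq_zero divide_self mult.right_neutral)

text \<open>The shift by \<open>t - s\<close> leaves \<open>f (cis s)\<close> unchanged, so the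
  derivative is periodic too. It can then be bounded on one compact period and regarded as a
  function of the point instead of the angle.\<close>

lemma cis_C1_cong:
  assumes d: "\<And>s. ((\<lambda>s. f (cis s)) has_vector_derivative F' s) (at s)" and "cis s = cis t"
  shows "F' s = F' t"
proof -
  have "(((\<lambda>s. f (cis s)) \<circ> (\<lambda>x. x + (t - s))) has_vector_derivative (1 *\<^sub>R F' t)) (at s)"
    by (rule vector_diff_chain_at) (use d[of t] in \<open>auto intro!: derivative_eq_intros\<close>)
  then have "((\<lambda>s. f (cis s)) has_vector_derivative F' t) (at s)"
    by (simp add: o_def cis_eq_shift[OF assms(2)])
  with d[of s] show ?thesis by (rule vector_derivative_unique_at)
qed

lemma cis_C1_bounded:
  fixes f :: "complex \<Rightarrow> 'a::real_normed_vector"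
  assumes d: "\<And>s. ((\<lambda>s. f (cis s)) has_vector_derivative F' s) (at s)" and c: "continuous_on UNIV F'"
  obtains L where "0 \<le> L" "\<And>s. norm (F' s) \<le> L"
proof -
  have "bounded (F' ` {0..2*pi})"
    by (intro compact_imp_bounded compact_continuous_image continuous_on_subset[OF c]) auto
  then obtain L where L: "0 < L" "\<And>s. s \<in> {0..2*pi} \<Longrightarrow> norm (F' s) \<le> L"
    by (auto simp: bounded_pos)
  have "norm (F' s) \<le> L" for s
  proof -
    have "cis (Arg2pi (cis s)) = cis s" using Arg2pi_eq[of "cis s"] by (simp add: cis_conv_exp)
    then have "F' s = F' (Arg2pi (cis s))" using cis_C1_cong[OF d] by metis
    moreover have "Arg2pi (cis s) \<in> {0..2*pi}"
      using Arg2pi_ge_0 Arg2pi_lt_2pi by (auto intro: less_imp_le)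
    ultimately show ?thesis using L by simp
  qed
  then show ?thesis using that[of L] L by auto
qed

text \<open>The mean value bound is in terms of angles, and nearby points may have distant angles.
  Moving \<open>t\<close> by a multiple of \<open>2 pi\<close> brings the difference
  \<open>u\<close> into \<open>[- pi, pi]\<close>, where arc and chord are comparable.\<close>

lemma cis_C1_lipschitz:
  fixes f :: "complex \<Rightarrow> 'a::real_normed_vector"
  assumes d: "\<And>s. ((\<lambda>s. f (cis s)) has_vector_derivative F' s) (at s)" and c: "continuous_on UNIV F'"
  obtains L where "0 \<le> L" "\<And>s t. norm (f (cis s) - f (cis t)) \<le> L * cmod (cis s - cis t)"
proof -
  obtain L where L: "0 \<le> L" "\<And>s. norm (F' s) \<le> L" using cis_C1_bounded[OF d c] by blast
  have lip: "norm (f (cis s) - f (cis t)) \<le> L * \<bar>s - t\<bar>" for s t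
  proof -
    have "norm (f (cis s) - f (cis t)) \<le> L * norm (s - t)"
    proof (rule differentiable_bound[of UNIV])
      show "((\<lambda>s. f (cis s)) has_derivative (\<lambda>h. h *\<^sub>R F' x)) (at x within UNIV)" for x
        using d[of x] by (simp add: has_vector_derivative_def)
      show "onorm (\<lambda>h. h *\<^sub>R F' x) \<le> L" for x
        using L by (intro onorm_le) (simp add: mult.commute[of L] mult_left_mono)
    qed auto
    then show ?thesis by simp
  qed
  have "norm (f (cis s) - f (cis t)) \<le> (2 * L) * cmod (cis s - cis t)" for s t
  proof -
    define u where "u = Arg (cis (t - s))"
    have u: "\<bar>u\<bar> \<le> pi" "cis u = cis (t - s)"
      using Arg_bounded[of "cis (t - s)"] cis_Arg[of "cis (t - s)"] by (auto simp: u_def sgn_div_norm abs_le_iff)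
    have "cis (s + u) = cis t" by (simp add: cis_mult[symmetric] u(2)) (simp add: cis_mult)
    then have "norm (f (cis s) - f (cis t)) \<le> L * \<bar>s - (s + u)\<bar>"
      using lip[of s "s + u"] by simp
    also have "\<dots> \<le> L * (2 * cmod (1 - cis u))"
      using cmod_one_minus_cis_ge[OF u(1)] L by (intro mult_left_mono) auto
    finally show ?thesis by (simp add: cmod_cis_diff u(2))
  qed
  then show ?thesis using that[of "2 * L"] L by auto
qed

text \<open>The integrand is at most \<open>L\<^sup>2\<close>, and the square of angles has area
  \<open>(2 * pi)\<^sup>2\<close>.\<close>

lemma gagliardo_circle_lipschitz:
  assumes m: "(\<lambda>s. f (cis s)) \<in> borel_measurable circ" and L: "0 \<le> L"
    and lip: "\<And>s t. cmod (f (cis s) - f (cis t)) \<le> L * cmod (cis s - cis t)"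
  shows "gagliardo_circle f \<le> ennreal (L\<^sup>2 * (2 * pi)\<^sup>2)"
proof -
  have le: "(cmod (f (cis s) - f (cis t)))\<^sup>2 / (cmod (cis s - cis t))\<^sup>2 \<le> L\<^sup>2" for s t
  proof (cases "cis s = cis t")
    case False
    have "(cmod (f (cis s) - f (cis t)))\<^sup>2 \<le> (L * cmod (cis s - cis t))\<^sup>2"
      using lip by (intro power_mono) auto
    then show ?thesis using False by (simp add: power_mult_distrib divide_le_eq)
  qed simp
  have "gagliardo_circle f \<le> (\<integral>\<^sup>+p. ennreal (L\<^sup>2) \<partial>(circ \<Otimes>\<^sub>M circ))"
    unfolding gagliardo_circle_circ2[OF m] by (intro nn_integral_mono ennreal_leI le)
  also have "\<dots> = ennreal (L\<^sup>2) * (ennreal (2 * pi) * ennreal (2 * pi))"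
    using emeasure_circ by (simp add: space_pair_measure circ.emeasure_pair_measure_Times del: space_circ)
  also have "\<dots> = ennreal (L\<^sup>2 * (2 * pi)\<^sup>2)"
    by (simp add: ennreal_mult'[symmetric] power2_eq_square)
  finally show ?thesis .
qed

lemma C1_degree_eq:
  assumes d: "\<And>s. ((\<lambda>s. f (cis s)) has_vector_derivative F' s) (at s)" and c: "continuous_on UNIV F'"
  shows "C1_degree f = 1 / (2 * complex_of_real pi * \<i>) * (\<integral>s. cnj (f (cis s)) * F' s \<partial>circ)"
proof -
  have "continuous_on UNIV (\<lambda>s. f (cis s))"
    using d by (meson continuous_at_imp_continuous_on has_vector_derivative_continuous)
  then have "continuous_on {0..2*pi} (\<lambda>s. cnj (f (cis s)) * F' s)"
    by (intro continuous_intros) (auto intro: continuous_on_subset c)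
  then show ?thesis
    using vector_derivative_at[OF d] by (simp add: C1_degree_def integral_circ_real)
qed

lemma C1_circleE:
  assumes "f \<in> C1_circle"
  obtains F' where "\<And>s. ((\<lambda>s. f (cis s)) has_vector_derivative F' s) (at s)" "continuous_on UNIV F'"
    "\<And>s. cmod (f (cis s)) = 1"
    "C1_degree f = 1 / (2 * complex_of_real pi * \<i>) * (\<integral>s. cnj (f (cis s)) * F' s \<partial>circ)"
proof -
  from assms obtain F' where F': "\<And>s. ((\<lambda>s. f (cis s)) has_vector_derivative F' s) (at s)" "continuous_on UNIV F'"
    and n: "\<And>s. cmod (f (cis s)) = 1"
    by (auto simp: C1_circle_def C1_differentiable_on_def)
  show ?thesis using that[OF F' n C1_degree_eq[OF F']] .
qed

lemma C1_circleI:
  assumes "\<And>s. ((\<lambda>s. f (cis s)) has_vector_derivative F' s) (at s)" "continuous_on UNIV F'"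
    "\<And>s. cmod (f (cis s)) = 1"
  shows "f \<in> C1_circle"
  using assms by (auto simp: C1_circle_def C1_differentiable_on_def)

lemma C1_cis_measurable:
  fixes f :: "complex \<Rightarrow> 'a::real_normed_vector"
  assumes "\<And>s. ((\<lambda>s. f (cis s)) has_vector_derivative F' s) (at s)"
  shows "(\<lambda>s. f (cis s)) \<in> borel_measurable borel"
  using assms by (intro borel_measurable_continuous_onI)
    (meson continuous_at_imp_continuous_on has_vector_derivative_continuous)

lemma C1_circle_subset_hhalf: "C1_circle \<subseteq> hhalf_circle"
proof
  fix f assume f: "f \<in> C1_circle"
  from C1_circleE[OF f] obtain F' where F': "\<And>s. ((\<lambda>s. f (cis s)) has_vector_derivative F' s) (at s)" "continuous_on UNIV F'"
    and n: "\<And>s. cmod (f (cis s)) = 1" by metis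
  note m = C1_cis_measurable[OF F'(1)]
  obtain L where L: "0 \<le> L" "\<And>s t. norm (f (cis s) - f (cis t)) \<le> L * cmod (cis s - cis t)"
    using cis_C1_lipschitz[OF F'] by blast
  have "gagliardo_circle f < \<infinity>"
    using gagliardo_circle_lipschitz[OF measurable_circI[OF m] L]
    by (simp add: order_le_less_trans ennreal_less_top)
  then show "f \<in> hhalf_circle" using m n by (simp add: hhalf_circle_def)
qed

section \<open>The degree as a Fourier series\<close>

definition sfreq :: "(complex \<Rightarrow> complex) \<Rightarrow> nat \<Rightarrow> real" where
  "sfreq f n = real n * ((cmod (fc f (int n)))\<^sup>2 - (cmod (fc f (- int n)))\<^sup>2)"

definition fourier_degree :: "(complex \<Rightarrow> complex) \<Rightarrow> real" where
  "fourier_degree f = suminf (sfreq f)"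

lemma abs_sfreq_le: "\<bar>sfreq f n\<bar> \<le> freq f n"
proof -
  have "\<bar>x\<^sup>2 - y\<^sup>2\<bar> \<le> x\<^sup>2 + y\<^sup>2" for x y :: real
    using zero_le_power2[of x] zero_le_power2[of y] by linarith
  then show ?thesis unfolding sfreq_def freq_def abs_mult by (intro mult_mono) auto
qed

lemma hhalf_circleD:
  assumes "f \<in> hhalf_circle"
  shows "(\<lambda>s. f (cis s)) \<in> borel_measurable circ" "AE s in circ. cmod (f (cis s)) = 1"
    "gagliardo_circle f < \<infinity>"
  using assms AE_circI by (auto simp: hhalf_circle_def)

lemma hhalf_circle_freq_sums:
  assumes "f \<in> hhalf_circle"
  shows "freq f sums (enn2real (gagliardo_circle f) / (4 * pi\<^sup>2))"
  by (rule gagliardo_fourier[where B=1]) (use hhalf_circleD[OF assms] in auto)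

lemma summable_sfreq: "summable (freq f) \<Longrightarrow> summable (\<lambda>n. norm (sfreq f n))"
  by (rule summable_comparison_test'[of "freq f" 0]) (auto simp: abs_sfreq_le)

lemma fourier_degree_bound:
  assumes "f \<in> hhalf_circle"
  shows "\<bar>fourier_degree f\<bar> \<le> enn2real (gagliardo_circle f) / (4 * pi\<^sup>2)"
proof -
  have s: "summable (freq f)" "suminf (freq f) = enn2real (gagliardo_circle f) / (4 * pi\<^sup>2)"
    using hhalf_circle_freq_sums[OF assms] by (auto simp: sums_iff)
  have "\<bar>fourier_degree f\<bar> \<le> (\<Sum>n. norm (sfreq f n))"
    unfolding fourier_degree_def using summable_norm[OF summable_sfreq[OF s(1)]] by simp
  also have "\<dots> \<le> suminf (freq f)"
    by (rule suminf_le) (auto simp: abs_sfreq_le summable_sfreq s(1) summable_sfreq[OF s(1), simplified])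
  finally show ?thesis using s(2) by simp
qed

text \<open>\<open>freq f n - sfreq f n\<close> is \<open>2 n |fc f (- n)|^2\<close>; equality makes
  the sum of these nonnegative terms 0.\<close>

lemma fourier_degree_eq_imp_fc_negative:
  assumes "f \<in> hhalf_circle" "fourier_degree f = enn2real (gagliardo_circle f) / (4 * pi\<^sup>2)" "n > 0"
  shows "fc f (- int n) = 0"
proof -
  have s: "summable (freq f)" "suminf (freq f) = enn2real (gagliardo_circle f) / (4 * pi\<^sup>2)"
    using hhalf_circle_freq_sums[OF assms(1)] by (auto simp: sums_iff)
  have s': "summable (sfreq f)" using summable_norm_cancel[OF summable_sfreq[OF s(1)]] .
  have "(\<Sum>n. freq f n - sfreq f n) = 0"
    using suminf_diff[OF s(1) s'] s(2) assms(2) by (simp add: fourier_degree_def)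
  then have "\<forall>n. freq f n - sfreq f n = 0"
    by (subst (asm) suminf_eq_zero_iff) (use abs_sfreq_le in \<open>auto intro!: summable_diff s s' simp: abs_le_iff\<close>)
  then have "freq f n = sfreq f n" by (metis eq_iff_diff_eq_0)
  then show ?thesis using assms(3) by (auto simp: freq_def sfreq_def)
qed

lemma fc_diff:
  assumes [measurable]: "(\<lambda>s. f (cis s)) \<in> borel_measurable circ" "(\<lambda>s. g (cis s)) \<in> borel_measurable circ"
    and bd: "AE s in circ. cmod (f (cis s)) \<le> A" "AE s in circ. cmod (g (cis s)) \<le> B"
  shows "fc (\<lambda>z. f z - g z) n = fc f n - fc g n"
proof -
  have "integrable circ (\<lambda>s. f (cis s) * cis (- (of_int n * s)))"
    by (rule circ.integrable_const_bound[of _ A]) (use bd in \<open>auto simp: norm_mult\<close>)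
  moreover have "integrable circ (\<lambda>s. g (cis s) * cis (- (of_int n * s)))"
    by (rule circ.integrable_const_bound[of _ B]) (use bd in \<open>auto simp: norm_mult\<close>)
  ultimately show ?thesis
    by (simp add: fc_def left_diff_distrib right_diff_distrib)
qed

text \<open>The left side is at most \<open>|a - b| (2 |b| + |a - b|)\<close>, and Young's
  inequality with the free weight \<open>\<eta>\<close> splits the mixed term.\<close>

lemma cmod_sq_perturb:
  fixes a b :: complex
  assumes "0 < \<eta>"
  shows "\<bar>(cmod a)\<^sup>2 - (cmod b)\<^sup>2\<bar> \<le> (1 + 1 / \<eta>) * (cmod (a - b))\<^sup>2 + \<eta> * (cmod b)\<^sup>2"
proof -
  define x y z where "x = cmod a" "y = cmod b" "z = cmod (a - b)"
  have tri: "x \<le> y + z" "y \<le> x + z" "0 \<le> x" "0 \<le> y" "0 \<le> z"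
    unfolding x_y_z_def using norm_triangle_sub[of a b] norm_triangle_sub[of b a]
    by (auto simp: norm_minus_commute add.commute)
  have "0 \<le> (z - \<eta> * y)\<^sup>2 / \<eta>" using assms by simp
  then have am: "2 * y * z \<le> z\<^sup>2 / \<eta> + \<eta> * y\<^sup>2"
    using assms by (simp add: power2_diff field_simps power2_eq_square)
  have "\<bar>x - y\<bar> \<le> z" "x + y \<le> 2 * y + z" using tri by auto
  then have "\<bar>x - y\<bar> * (x + y) \<le> z * (2 * y + z)"
    using tri by (intro mult_mono) auto
  moreover have "\<bar>x\<^sup>2 - y\<^sup>2\<bar> = \<bar>x - y\<bar> * (x + y)"
    using tri by (simp add: power2_eq_square square_diff_square_factored abs_mult)
  ultimately have "\<bar>x\<^sup>2 - y\<^sup>2\<bar> \<le> (1 + 1 / \<eta>) * z\<^sup>2 + \<eta> * y\<^sup>2"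
    using am by (simp add: algebra_simps power2_eq_square)
  then show ?thesis by (simp add: x_y_z_def)
qed

text \<open>Weighting \<open>cmod_sq_perturb\<close> by \<open>n\<close> and summing leaves a
  multiple of the seminorm of \<open>h - f\<close> and a multiple of the fixed seminorm of
  \<open>f\<close> that is small with \<open>\<eta>\<close>.\<close>

lemma fourier_degree_continuous:
  assumes f: "f \<in> hhalf_circle" and h: "h \<in> hhalf_circle" and \<eta>: "0 < \<eta>"
    and fin: "gagliardo_circle (\<lambda>z. h z - f z) < \<infinity>"
  shows "\<bar>fourier_degree h - fourier_degree f\<bar> \<le> (1 + 1 / \<eta>) * enn2real (gagliardo_circle (\<lambda>z. h z - f z))
      + \<eta> * (enn2real (gagliardo_circle f) / (4 * pi\<^sup>2))"
proof -
  note f' [measurable] = hhalf_circleD[OF f] and h' [measurable] = hhalf_circleD[OF h]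
  let ?e = "\<lambda>z. h z - f z"
  let ?E = "enn2real (gagliardo_circle ?e)"
  have ae: "AE s in circ. cmod (f (cis s)) \<le> 1" "AE s in circ. cmod (h (cis s)) \<le> 1"
    using f'(2) h'(2) by auto
  have ae2: "AE s in circ. cmod (?e (cis s)) \<le> 2"
    using ae by eventually_elim (metis add_mono norm_triangle_ineq4 one_add_one order_trans)
  have e: "freq ?e sums (?E / (4 * pi\<^sup>2))"
    by (rule gagliardo_fourier[OF _ ae2 fin]) measurable
  have ff: "freq f sums (enn2real (gagliardo_circle f) / (4 * pi\<^sup>2))" by (rule hhalf_circle_freq_sums[OF f])
  have hh: "freq h sums (enn2real (gagliardo_circle h) / (4 * pi\<^sup>2))" by (rule hhalf_circle_freq_sums[OF h])
  have fce: "fc ?e n = fc h n - fc f n" for n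
    by (rule fc_diff[OF _ _ ae(2,1)]) measurable
  have bound: "norm (sfreq h n - sfreq f n) \<le> (1 + 1 / \<eta>) * freq ?e n + \<eta> * freq f n" for n
  proof -
    let ?p = "\<lambda>n. (cmod (fc h n))\<^sup>2 - (cmod (fc f n))\<^sup>2"
    have "norm (sfreq h n - sfreq f n) = real n * \<bar>?p n - ?p (- int n)\<bar>"
    proof -
      have "sfreq h n - sfreq f n = real n * (?p n - ?p (- int n))"
        by (simp add: sfreq_def algebra_simps)
      then show ?thesis by (simp add: abs_mult)
    qed
    also have "\<dots> \<le> real n * (\<bar>?p n\<bar> + \<bar>?p (- int n)\<bar>)" by (intro mult_left_mono) auto
    also have "\<dots> \<le> real n * (((1 + 1 / \<eta>) * (cmod (fc ?e n))\<^sup>2 + \<eta> * (cmod (fc f n))\<^sup>2) +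
        ((1 + 1 / \<eta>) * (cmod (fc ?e (- int n)))\<^sup>2 + \<eta> * (cmod (fc f (- int n)))\<^sup>2))"
      unfolding fce by (intro mult_left_mono add_mono cmod_sq_perturb \<eta>) auto
    also have "\<dots> = (1 + 1 / \<eta>) * freq ?e n + \<eta> * freq f n"
      by (simp add: freq_def algebra_simps)
    finally show ?thesis .
  qed
  have sums: "(\<lambda>n. (1 + 1 / \<eta>) * freq ?e n + \<eta> * freq f n) sums
     ((1 + 1 / \<eta>) * (?E / (4 * pi\<^sup>2)) + \<eta> * (enn2real (gagliardo_circle f) / (4 * pi\<^sup>2)))"
    by (intro sums_add sums_mult e ff)
  have s: "summable (sfreq f)" "summable (sfreq h)"
    using ff hh summable_norm_cancel[OF summable_sfreq] by (auto simp: sums_iff)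
  have "\<bar>fourier_degree h - fourier_degree f\<bar> = norm (\<Sum>n. sfreq h n - sfreq f n)"
    unfolding fourier_degree_def using suminf_diff[OF s(2,1)] by simp
  also have "\<dots> \<le> (\<Sum>n. (1 + 1 / \<eta>) * freq ?e n + \<eta> * freq f n)"
    by (rule norm_suminf_le[OF bound]) (use sums in \<open>simp add: sums_iff\<close>)
  also have "\<dots> = (1 + 1 / \<eta>) * (?E / (4 * pi\<^sup>2)) + \<eta> * (enn2real (gagliardo_circle f) / (4 * pi\<^sup>2))"
    using sums by (simp add: sums_iff)
  also have "?E / (4 * pi\<^sup>2) \<le> ?E / 1"
  proof (rule divide_left_mono)
    have "1 * 1 \<le> pi * pi" using pi_gt3 by (intro mult_mono) auto
    then show "1 \<le> 4 * pi\<^sup>2" by (simp add: power2_eq_square)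
  qed auto
  finally show ?thesis using \<eta> by (simp add: mult_left_mono)
qed

section \<open>The Poisson kernel and the degree of C1 maps\<close>

lemma poisson_bound:
  assumes "cmod w = 1" "0 < r" "r < 1"
  shows "cmod (1 - w) * cmod (1 / (1 - of_real r * w) + 1 / (1 - of_real r * cnj w) - 1) \<le> 4"
    and "1 / (1 - of_real r * w) + 1 / (1 - of_real r * cnj w) - 1 = of_real ((1 - r\<^sup>2) / (cmod (1 - of_real r * w))\<^sup>2)"
proof -
  define q where "q = of_real r * w"
  have q: "cmod q = r" using assms by (simp add: q_def norm_mult)
  then have "q \<noteq> 1" using assms by auto
  have nz: "1 - q \<noteq> 0" "1 - cnj q \<noteq> 0" using \<open>q \<noteq> 1\<close>
    by (auto simp: complex_eq_iff)
  have qq: "q * cnj q = of_real (r\<^sup>2)" using q by (simp add: complex_norm_square[symmetric])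
  have "1 / (1 - q) + 1 / (1 - cnj q) - 1 = (1 - q * cnj q) / ((1 - q) * (1 - cnj q))"
    using nz by (simp add: divide_simps) (simp add: algebra_simps)
  also have "(1 - q) * (1 - cnj q) = of_real ((cmod (1 - q))\<^sup>2)"
    by (metis complex_norm_square complex_cnj_diff complex_cnj_one)
  also have "(1 - q * cnj q) / of_real ((cmod (1 - q))\<^sup>2) = of_real ((1 - r\<^sup>2) / (cmod (1 - q))\<^sup>2)"
    by (simp add: qq)
  finally have eq: "1 / (1 - q) + 1 / (1 - cnj q) - 1 = of_real ((1 - r\<^sup>2) / (cmod (1 - q))\<^sup>2)" .
  then show "1 / (1 - of_real r * w) + 1 / (1 - of_real r * cnj w) - 1 = of_real ((1 - r\<^sup>2) / (cmod (1 - of_real r * w))\<^sup>2)"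
    by (simp add: q_def)
  have pos: "0 < cmod (1 - q)" using nz by simp
  have a: "1 - r \<le> cmod (1 - q)" using q norm_triangle_ineq2[of 1 q] by simp
  \<comment> \<open>The kernel is \<open>(1 - r) (1 + r) / |1 - q|^2\<close>. Both
    \<open>1 - r\<close> and half of \<open>|1 - w|\<close> are at most \<open>|1 - q|\<close>, so a
    factor \<open>|1 - w|\<close> tames the peak uniformly in \<open>r\<close>; with
    \<open>1 + r \<le> 2\<close> the constant is 4.\<close>
  have "cmod (1 - w) \<le> cmod (1 - q) + cmod (q - w)" using norm_triangle_ineq[of "1 - q" "q - w"] by simp
  also have "q - w = of_real (r - 1) * w" by (simp add: q_def algebra_simps)
  also have "cmod \<dots> = 1 - r" unfolding norm_mult norm_of_real using assms by simp
  finally have b: "cmod (1 - w) \<le> 2 * cmod (1 - q)" using a by simp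
  have "cmod (1 - w) * ((1 - r) * (1 + r)) \<le> (2 * cmod (1 - q)) * (cmod (1 - q) * 2)"
    using a b assms by (intro mult_mono) auto
  then have "cmod (1 - w) * ((1 - r\<^sup>2) / (cmod (1 - q))\<^sup>2) \<le> 4"
    using pos by (simp add: divide_le_eq power2_eq_square algebra_simps)
  moreover have "r\<^sup>2 \<le> 1" using assms by (simp add: power_le_one)
  ultimately show "cmod (1 - w) * cmod (1 / (1 - of_real r * w) + 1 / (1 - of_real r * cnj w) - 1) \<le> 4"
    using eq by (simp add: q_def norm_divide norm_power del: of_real_diff of_real_power of_real_divide)
qed

lemma integral_circ2_product:
  assumes [measurable]: "(\<lambda>s. a (cis s)) \<in> borel_measurable circ" "(\<lambda>s. b (cis s)) \<in> borel_measurable circ"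
    and ba: "\<And>s. cmod (a (cis s)) \<le> A" and bb: "\<And>s. cmod (b (cis s)) \<le> B"
  shows "(\<integral>p. a (cis (fst p)) * cnj (b (cis (snd p))) \<partial>(circ \<Otimes>\<^sub>M circ)) = 4 * pi\<^sup>2 * (fc a 0 * cnj (fc b 0))"
proof -
  have A0: "0 \<le> A" using ba[of 0] norm_ge_zero order_trans by blast
  have i: "integrable (circ \<Otimes>\<^sub>M circ) (\<lambda>p. a (cis (fst p)) * cnj (b (cis (snd p))))"
    by (rule integrable_circ2_bounded[of _ "A * B"])
       (auto simp: norm_mult intro!: mult_mono ba bb A0)
  have "(\<integral>p. a (cis (fst p)) * cnj (b (cis (snd p))) \<partial>(circ \<Otimes>\<^sub>M circ)) =
      (\<integral>s. (\<integral>t. a (cis s) * cnj (b (cis t)) \<partial>circ) \<partial>circ)"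
    using circ2.integral_fst'[OF i] by simp
  also have "\<dots> = (\<integral>s. a (cis s) \<partial>circ) * cnj (\<integral>t. b (cis t) \<partial>circ)"
    by (simp only: integral_mult_right_zero integral_mult_left_zero Bochner_Integration.integral_cnj)
  finally show ?thesis by (simp add: fc_def power2_eq_square)
qed

text \<open>The series of the pair and of the conjugate pair sum to the two halves of
  \<open>P\<close>. Frequency 0 occurs in both, whereas \<open>P\<close> with its \<open>- 1\<close>
  counts it once; this accounts for the summand \<open>fc a 0 * cnj (fc b 0)\<close>.\<close>

lemma poisson_sums:
  assumes m [measurable]: "(\<lambda>s. a (cis s)) \<in> borel_measurable circ" "(\<lambda>s. b (cis s)) \<in> borel_measurable circ"
    and ba: "\<And>s. cmod (a (cis s)) \<le> A" and bb: "\<And>s. cmod (b (cis s)) \<le> B"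
    and r: "0 < r" "r < 1"
  defines "P \<equiv> \<lambda>p. 1 / (1 - of_real r * cis (snd p - fst p)) + 1 / (1 - of_real r * cnj (cis (snd p - fst p))) - 1"
  shows "(\<lambda>n. of_real r ^ n * (fc a (int n) * cnj (fc b (int n)) + fc a (- int n) * cnj (fc b (- int n)))) sums
    (1 / (4 * pi\<^sup>2) * (\<integral>p. a (cis (fst p)) * cnj (b (cis (snd p))) * P p \<partial>(circ \<Otimes>\<^sub>M circ))
      + fc a 0 * cnj (fc b 0))"
    and "integrable (circ \<Otimes>\<^sub>M circ) (\<lambda>p. a (cis (fst p)) * cnj (b (cis (snd p))) * P p)"
proof -
  let ?K = "\<lambda>p. 1 / (1 - of_real r * cis (snd p - fst p)) :: complex"
  have A0: "0 \<le> A" using ba[of 0] norm_ge_zero order_trans by blast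
  have B0: "0 \<le> B" using bb[of 0] norm_ge_zero order_trans by blast
  have c: "summable (\<lambda>n. norm (of_real r ^ n :: complex))"
    using r by (simp add: norm_power summable_geometric)
  have K: "(\<Sum>n. of_real r ^ n * cis (snd p - fst p) ^ n) = ?K p" for p
    using suminf_geometric[of "of_real r * cis (snd p - fst p)"] r
    by (simp add: norm_mult power_mult_distrib)
  have s1: "(\<lambda>n. of_real r ^ n * (fc a (int n) * cnj (fc b (int n)))) sums
      (1 / (4 * pi\<^sup>2) * (\<integral>p. a (cis (fst p)) * cnj (b (cis (snd p))) * ?K p \<partial>(circ \<Otimes>\<^sub>M circ)))"
    using fc_sums_pair[OF m ba bb c] unfolding K .
  have m': "(\<lambda>s. cnj (a (cis s))) \<in> borel_measurable circ" "(\<lambda>s. cnj (b (cis s))) \<in> borel_measurable circ"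
    by measurable
  have ba': "\<And>s. cmod (cnj (a (cis s))) \<le> A" and bb': "\<And>s. cmod (cnj (b (cis s))) \<le> B"
    using ba bb by simp_all
  have "(\<lambda>n. of_real r ^ n * (fc (\<lambda>z. cnj (a z)) (int n) * cnj (fc (\<lambda>z. cnj (b z)) (int n)))) sums
      (1 / (4 * pi\<^sup>2) * (\<integral>p. cnj (a (cis (fst p))) * cnj (cnj (b (cis (snd p)))) * ?K p \<partial>(circ \<Otimes>\<^sub>M circ)))"
    using fc_sums_pair[OF m' ba' bb' c] unfolding K .
  then have "(\<lambda>n. cnj (of_real r ^ n * (fc (\<lambda>z. cnj (a z)) (int n) * cnj (fc (\<lambda>z. cnj (b z)) (int n))))) sums
      cnj (1 / (4 * pi\<^sup>2) * (\<integral>p. cnj (a (cis (fst p))) * cnj (cnj (b (cis (snd p)))) * ?K p \<partial>(circ \<Otimes>\<^sub>M circ)))"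
    by (subst sums_cnj)
  also have "(\<lambda>n. cnj (of_real r ^ n * (fc (\<lambda>z. cnj (a z)) (int n) * cnj (fc (\<lambda>z. cnj (b z)) (int n))))) =
     (\<lambda>n. of_real r ^ n * (fc a (- int n) * cnj (fc b (- int n))))"
    by (simp add: fc_uminus)
  also have "cnj (1 / (4 * pi\<^sup>2) * (\<integral>p. cnj (a (cis (fst p))) * cnj (cnj (b (cis (snd p)))) * ?K p \<partial>(circ \<Otimes>\<^sub>M circ)))
     = 1 / (4 * pi\<^sup>2) * (\<integral>p. a (cis (fst p)) * cnj (b (cis (snd p))) * cnj (?K p) \<partial>(circ \<Otimes>\<^sub>M circ))"
    by (simp flip: Bochner_Integration.integral_cnj)
  finally have s2: "(\<lambda>n. of_real r ^ n * (fc a (- int n) * cnj (fc b (- int n)))) sums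
     (1 / (4 * pi\<^sup>2) * (\<integral>p. a (cis (fst p)) * cnj (b (cis (snd p))) * cnj (?K p) \<partial>(circ \<Otimes>\<^sub>M circ)))" .
  have Kb: "cmod (?K p) \<le> 1 / (1 - r)" for p
  proof -
    have "1 - r \<le> cmod (1 - of_real r * cis (snd p - fst p))"
      using norm_triangle_ineq2[of 1 "of_real r * cis (snd p - fst p)"] r by (simp add: norm_mult)
    then show ?thesis using r by (auto simp: norm_divide intro!: frac_le)
  qed
  have int: "integrable (circ \<Otimes>\<^sub>M circ) (\<lambda>p. a (cis (fst p)) * cnj (b (cis (snd p))) * G p)"
    if [measurable]: "G \<in> borel_measurable (circ \<Otimes>\<^sub>M circ)" and "\<And>p. cmod (G p) \<le> C" for G C
    by (rule integrable_circ2_bounded[of _ "A * B * C"])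
       (auto simp: norm_mult intro!: mult_mono ba bb A0 B0 that(2) mult_nonneg_nonneg)
  have iK: "integrable (circ \<Otimes>\<^sub>M circ) (\<lambda>p. a (cis (fst p)) * cnj (b (cis (snd p))) * ?K p)"
    by (rule int[OF _ Kb]) measurable
  have iK': "integrable (circ \<Otimes>\<^sub>M circ) (\<lambda>p. a (cis (fst p)) * cnj (b (cis (snd p))) * cnj (?K p))"
    by (rule int[of _ "1 / (1 - r)"]) (use Kb in \<open>auto simp del: complex_cnj_divide\<close>)
  have i1: "integrable (circ \<Otimes>\<^sub>M circ) (\<lambda>p. a (cis (fst p)) * cnj (b (cis (snd p))) * 1)"
    by (rule int[of _ 1]) auto
  have P: "(\<lambda>p. a (cis (fst p)) * cnj (b (cis (snd p))) * P p) =
    (\<lambda>p. a (cis (fst p)) * cnj (b (cis (snd p))) * ?K p + a (cis (fst p)) * cnj (b (cis (snd p))) * cnj (?K p)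
      - a (cis (fst p)) * cnj (b (cis (snd p))) * 1)"
    by (rule ext) (simp add: P_def algebra_simps)
  show "integrable (circ \<Otimes>\<^sub>M circ) (\<lambda>p. a (cis (fst p)) * cnj (b (cis (snd p))) * P p)"
    unfolding P by (intro Bochner_Integration.integrable_diff Bochner_Integration.integrable_add iK iK' i1)
  have I: "(\<integral>p. a (cis (fst p)) * cnj (b (cis (snd p))) * P p \<partial>(circ \<Otimes>\<^sub>M circ)) =
     (\<integral>p. a (cis (fst p)) * cnj (b (cis (snd p))) * ?K p \<partial>(circ \<Otimes>\<^sub>M circ)) +
     (\<integral>p. a (cis (fst p)) * cnj (b (cis (snd p))) * cnj (?K p) \<partial>(circ \<Otimes>\<^sub>M circ)) -
     4 * pi\<^sup>2 * (fc a 0 * cnj (fc b 0))"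
    unfolding P
    by (subst Bochner_Integration.integral_diff[OF Bochner_Integration.integrable_add[OF iK iK'] i1],
        subst Bochner_Integration.integral_add[OF iK iK'])
       (simp only: mult_1_right integral_circ2_product[OF m ba bb])
  show "(\<lambda>n. of_real r ^ n * (fc a (int n) * cnj (fc b (int n)) + fc a (- int n) * cnj (fc b (- int n)))) sums
    (1 / (4 * pi\<^sup>2) * (\<integral>p. a (cis (fst p)) * cnj (b (cis (snd p))) * P p \<partial>(circ \<Otimes>\<^sub>M circ))
      + fc a 0 * cnj (fc b 0))"
    using sums_add[OF s1 s2] unfolding I by (simp add: algebra_simps diff_divide_distrib)
qed

lemma integrable_circ_continuous:
  fixes G :: "real \<Rightarrow> complex"
  assumes "continuous_on UNIV G"
  shows "integrable circ G"
proof -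
  have "set_integrable lborel {0..2*pi} G"
    by (rule borel_integrable_atLeastAtMost') (rule continuous_on_subset[OF assms], simp)
  then show ?thesis by (simp add: circ_def integrable_restrict_space set_integrable_def)
qed

text \<open>Integration by parts: the derivative of the periodic product
  \<open>f (cis s) * cis (- (of_int n * s))\<close> has integral 0 over a period.\<close>

lemma fc_derivative:
  assumes d: "\<And>s. ((\<lambda>s. f (cis s)) has_vector_derivative F' s) (at s)" and c: "continuous_on UNIV F'"
    and a: "\<And>s. a (cis s) = F' s"
  shows "fc a n = \<i> * of_int n * fc f n"
proof -
  obtain L where L: "\<And>s. cmod (F' s) \<le> L" using cis_C1_bounded[OF d c] by blast
  have fcont: "continuous_on UNIV (\<lambda>s. f (cis s))"
    using d by (meson continuous_at_imp_continuous_on has_vector_derivative_continuous)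
  have ccont: "continuous_on UNIV (\<lambda>s. cis (- (of_int n * s)))" by (intro continuous_intros)
  have "(\<integral>s. F' s * cis (- (of_int n * s)) + f (cis s) * (- \<i> * of_int n * cis (- (of_int n * s))) \<partial>circ) = 0"
  proof (rule integral_circ_derivative)
    show "((\<lambda>s. f (cis s) * cis (- (of_int n * s))) has_vector_derivative
        F' s * cis (- (of_int n * s)) + f (cis s) * (- \<i> * of_int n * cis (- (of_int n * s)))) (at s)" for s
      using has_vector_derivative_mult[OF d[of s] has_vector_derivative_cis_linear[of "- of_int n" s UNIV]]
      by (simp add: algebra_simps)
    have "cis (- (of_int n * (2*pi))) = 1"
      using cis_multiple_2pi[of "of_int (-n)"] by (simp add: mult.commute mult.left_commute)
    moreover have "cis (2*pi) = cis 0" by simp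
    ultimately show "f (cis (2*pi)) * cis (- (of_int n * (2*pi))) = f (cis 0) * cis (- (of_int n * 0))"
      by simp
  qed (intro continuous_intros c fcont ccont)
  also have "(\<integral>s. F' s * cis (- (of_int n * s)) + f (cis s) * (- \<i> * of_int n * cis (- (of_int n * s))) \<partial>circ) =
     (\<integral>s. F' s * cis (- (of_int n * s)) \<partial>circ) + (\<integral>s. f (cis s) * (- \<i> * of_int n * cis (- (of_int n * s))) \<partial>circ)"
    by (intro Bochner_Integration.integral_add integrable_circ_continuous continuous_intros c fcont ccont)
  also have "(\<integral>s. f (cis s) * (- \<i> * of_int n * cis (- (of_int n * s))) \<partial>circ) =
     (\<integral>s. (- \<i> * of_int n) * (f (cis s) * cis (- (of_int n * s))) \<partial>circ)"
    by (simp add: mult_ac)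
  also have "\<dots> = - \<i> * of_int n * (\<integral>s. f (cis s) * cis (- (of_int n * s)) \<partial>circ)"
    by (rule integral_mult_right_zero)
  finally show ?thesis by (simp add: fc_def a algebra_simps)
qed

text \<open>Formally this is Parseval for the derivative of \<open>f\<close> and \<open>f\<close>.
  The Abel sums are Poisson integrals of \<open>a(s) cnj f(t)\<close>; with \<open>cnj f(s)\<close>
  in place of \<open>cnj f(t)\<close> they give the degree integral at every radius, and the error
  \<open>R\<close> tends to 0 because \<open>f\<close> is Lipschitz.\<close>

lemma fourier_degree_C1:
  assumes f: "f \<in> C1_circle"
  shows "C1_degree f = of_real (fourier_degree f)"
proof -
  from C1_circleE[OF f] obtain F' where d: "\<And>s. ((\<lambda>s. f (cis s)) has_vector_derivative F' s) (at s)"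
    and c: "continuous_on UNIV F'" and n1: "\<And>s. cmod (f (cis s)) = 1"
    and deg: "C1_degree f = 1 / (2 * complex_of_real pi * \<i>) * (\<integral>s. cnj (f (cis s)) * F' s \<partial>circ)"
    by metis
  obtain L where L: "0 \<le> L" "\<And>s. cmod (F' s) \<le> L" using cis_C1_bounded[OF d c] by blast
  obtain M where M: "0 \<le> M" "\<And>s t. cmod (f (cis s) - f (cis t)) \<le> M * cmod (cis s - cis t)"
    using cis_C1_lipschitz[OF d c] by blast
  \<comment> \<open>By \<open>cis_C1_cong\<close> any angle of the point gives the same value; as a
    function on the circle the derivative has Fourier coefficients.\<close>
  define a where "a z = F' (Arg z)" for z
  have a: "a (cis s) = F' s" for s
    unfolding a_def by (rule cis_C1_cong[OF d]) (use cis_Arg[of "cis s"] in \<open>simp add: sgn_div_norm\<close>)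
  have mf [measurable]: "(\<lambda>s. f (cis s)) \<in> borel_measurable circ"
    using C1_cis_measurable[OF d] by (rule measurable_circI)
  have ma [measurable]: "(\<lambda>s. a (cis s)) \<in> borel_measurable circ"
    unfolding a by (intro measurable_circI borel_measurable_continuous_onI c)
  have ba: "\<And>s. cmod (a (cis s)) \<le> L" and bf: "\<And>s. cmod (f (cis s)) \<le> 1"
    using L n1 by (auto simp: a)
  note fca = fc_derivative[OF d c a]
  let ?af = "\<lambda>z. a z * cnj (f z)"
  have maf: "(\<lambda>s. ?af (cis s)) \<in> borel_measurable circ" by measurable
  have baf: "\<And>s. cmod (?af (cis s)) \<le> L" using ba n1 by (simp add: norm_mult)
  have m1: "(\<lambda>s. (\<lambda>z. 1) (cis s)) \<in> borel_measurable circ" by simp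
  have b1: "\<And>s. cmod ((\<lambda>z. 1) (cis s)) \<le> 1" by simp
  define P where "P N p = 1 / (1 - of_real (abel N) * cis (snd p - fst p)) + 1 / (1 - of_real (abel N) * cnj (cis (snd p - fst p))) - 1"
    for N :: nat and p :: "real \<times> real"
  define R where "R N = (\<integral>p. a (cis (fst p)) * (cnj (f (cis (snd p))) - cnj (f (cis (fst p)))) * P N p \<partial>(circ \<Otimes>\<^sub>M circ))" for N
  have [measurable]: "P N \<in> borel_measurable (circ \<Otimes>\<^sub>M circ)" for N unfolding P_def by measurable
  have main: "(\<lambda>n. \<i> * of_real (abel N ^ n * sfreq f n)) sums (1 / (4 * pi\<^sup>2) * R N + fc ?af 0)" for N
  proof -
    note s1 = poisson_sums[OF ma mf ba bf abel_bounds[of N], folded P_def]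
    note s2 = poisson_sums[OF maf m1 baf b1 abel_bounds[of N], folded P_def]
    let ?I1 = "\<integral>p. a (cis (fst p)) * cnj (f (cis (snd p))) * P N p \<partial>(circ \<Otimes>\<^sub>M circ)"
    let ?I2 = "\<integral>p. ?af (cis (fst p)) * cnj 1 * P N p \<partial>(circ \<Otimes>\<^sub>M circ)"
    have "(\<lambda>n. \<i> * of_real (abel N ^ n * sfreq f n)) sums (1 / (4 * pi\<^sup>2) * ?I1)"
    proof -
      have "(\<lambda>n. of_real (abel N) ^ n * (fc a (int n) * cnj (fc f (int n)) + fc a (- int n) * cnj (fc f (- int n))))
          = (\<lambda>n. \<i> * of_real (abel N ^ n * sfreq f n))"
        by (rule ext) (simp add: fca sfreq_def complex_norm_square[symmetric] algebra_simps flip: of_real_power)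
      then show ?thesis using s1(1) by (simp add: fca)
    qed
    \<comment> \<open>Pairing with the constant 1 leaves only frequency 0: the Poisson kernel has
      mean 1.\<close>
    moreover have I2: "1 / (4 * pi\<^sup>2) * ?I2 = fc ?af 0"
    proof -
      have "(\<lambda>n. of_real (abel N) ^ n * (fc ?af (int n) * cnj (fc (\<lambda>z. 1) (int n)) + fc ?af (- int n) * cnj (fc (\<lambda>z. 1) (- int n))))
         = (\<lambda>n. if n = 0 then 2 * fc ?af 0 else 0)"
        by (rule ext) (simp add: fc_one)
      then have "(\<lambda>n. if n = 0 then 2 * fc ?af 0 else 0) sums (1 / (4 * pi\<^sup>2) * ?I2 + fc ?af 0)"
        using s2(1) by (simp add: fc_one)
      moreover have "(\<lambda>n. if n = 0 then 2 * fc ?af 0 else 0) sums (2 * fc ?af 0)"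
        using sums_single[of 0 "\<lambda>n. 2 * fc ?af 0"] by simp
      ultimately have "1 / (4 * pi\<^sup>2) * ?I2 + fc ?af 0 = 2 * fc ?af 0" by (rule sums_unique2)
      then show ?thesis by (simp add: algebra_simps)
    qed
    moreover have Req: "R N = ?I1 - ?I2"
    proof -
      have "R N = (\<integral>p. a (cis (fst p)) * cnj (f (cis (snd p))) * P N p - ?af (cis (fst p)) * cnj 1 * P N p \<partial>(circ \<Otimes>\<^sub>M circ))"
        unfolding R_def by (simp add: algebra_simps)
      also have "\<dots> = ?I1 - ?I2" by (rule Bochner_Integration.integral_diff[OF s1(2) s2(2)])
      finally show ?thesis .
    qed
    have "1 / (4 * pi\<^sup>2) * ?I1 = 1 / (4 * pi\<^sup>2) * R N + fc ?af 0"
      unfolding Req right_diff_distrib by (simp only: I2 diff_add_cancel)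
    ultimately show ?thesis by (simp only:)
  qed
  \<comment> \<open>The Lipschitz bound supplies a factor \<open>|1 - cis (t - s)|\<close>, so
    \<open>poisson_bound\<close> yields the majorant \<open>4 * L * M\<close>. Off the diagonal the
    kernel tends to 0; on it the difference of values is 0.\<close>
  have "R \<longlonglongrightarrow> (\<integral>p. 0 \<partial>(circ \<Otimes>\<^sub>M circ))"
    unfolding R_def[abs_def]
  proof (rule integral_dominated_convergence[where w="\<lambda>_. 4 * L * M"])
    let ?G = "\<lambda>N p. a (cis (fst p)) * (cnj (f (cis (snd p))) - cnj (f (cis (fst p)))) * P N p"
    have fd: "cmod (cnj (f (cis t)) - cnj (f (cis s))) \<le> M * cmod (1 - cis (t - s))" for s t
      using M(2)[of s t] by (simp add: cmod_cis_diff norm_minus_commute flip: complex_cnj_diff)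
    show "AE p in circ \<Otimes>\<^sub>M circ. norm (?G N p) \<le> 4 * L * M" for N
    proof (rule AE_I2)
      fix p
      have "norm (?G N p) \<le> L * (M * cmod (1 - cis (snd p - fst p))) * cmod (P N p)"
        unfolding norm_mult by (intro mult_mono ba fd mult_nonneg_nonneg L M norm_ge_zero order_refl)
      also have "\<dots> = L * M * (cmod (1 - cis (snd p - fst p)) * cmod (P N p))" by simp
      also have "\<dots> \<le> L * M * 4"
        unfolding P_def by (intro mult_left_mono poisson_bound(1) abel_bounds mult_nonneg_nonneg L M) simp
      finally show "norm (?G N p) \<le> 4 * L * M" by simp
    qed
    show "AE p in circ \<Otimes>\<^sub>M circ. (\<lambda>N. ?G N p) \<longlonglongrightarrow> 0"
    proof (rule AE_I2)
      fix p
      show "(\<lambda>N. ?G N p) \<longlonglongrightarrow> 0"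
      proof (cases "cis (snd p - fst p) = 1")
        case True
        then show ?thesis using fd[of "snd p" "fst p"] by simp
      next
        case False
        have "(\<lambda>N. complex_of_real ((1 - (abel N)\<^sup>2) / (cmod (1 - of_real (abel N) * cis (snd p - fst p)))\<^sup>2)) \<longlonglongrightarrow>
            of_real ((1 - 1\<^sup>2) / (cmod (1 - of_real 1 * cis (snd p - fst p)))\<^sup>2)"
          by (intro tendsto_intros abel_tendsto) (use False in auto)
        then have "(\<lambda>N. P N p) \<longlonglongrightarrow> 0"
          unfolding P_def by (subst poisson_bound(2)[OF _ abel_bounds]) (simp_all del: of_real_divide of_real_diff of_real_power)
        then show ?thesis by (rule tendsto_mult_right_zero)
      qed
    qed
  qed (auto intro: measurable_compose)
  then have R: "(\<lambda>N. 1 / (4 * pi\<^sup>2) * R N + fc ?af 0) \<longlonglongrightarrow> complex_of_real (1 / (4 * pi\<^sup>2)) * 0 + fc ?af 0"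
    by (intro tendsto_intros) simp
  have sf: "summable (freq f)"
    using hhalf_circle_freq_sums[of f] C1_circle_subset_hhalf f by (auto simp: sums_iff)
  \<comment> \<open>These terms are signed, so \<open>abel_limit_nonneg\<close> does not apply; the
    summable \<open>freq f\<close> is the majorant for Tannery's theorem.\<close>
  have "(\<lambda>N. \<Sum>n. abel N ^ n * sfreq f n) \<longlonglongrightarrow> suminf (sfreq f)"
  proof (rule tannerys_theorem[where M="freq f", THEN conjunct2, THEN conjunct2])
    show "(\<lambda>N. abel N ^ n * sfreq f n) \<longlonglongrightarrow> sfreq f n" for n
      using tendsto_mult_right[OF tendsto_power[OF abel_tendsto, of n], of "sfreq f n"] by simp
    have "norm (abel N ^ n * sfreq f n) \<le> freq f n" for N n
    proof -
      have "\<bar>abel N ^ n\<bar> * \<bar>sfreq f n\<bar> \<le> 1 * freq f n"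
        using abel_bounds[of N] by (intro mult_mono abs_sfreq_le) (auto simp: power_le_one)
      then show ?thesis by (simp add: abs_mult)
    qed
    then show "\<forall>\<^sub>F (n, N) in sequentially \<times>\<^sub>F sequentially. norm (abel N ^ n * sfreq f n) \<le> freq f n"
      by (auto intro!: always_eventually)
  qed (use sf in auto)
  then have "(\<lambda>N. \<i> * of_real (\<Sum>n. abel N ^ n * sfreq f n)) \<longlonglongrightarrow> \<i> * of_real (fourier_degree f)"
    unfolding fourier_degree_def by (intro tendsto_intros)
  moreover have "\<i> * of_real (\<Sum>n. abel N ^ n * sfreq f n) = 1 / (4 * pi\<^sup>2) * R N + fc ?af 0" for N
  proof -
    have "(\<lambda>n. abel N ^ n * sfreq f n) sums Im (1 / (4 * pi\<^sup>2) * R N + fc ?af 0)"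
      using sums_Im[OF main[of N]] by simp
    then have "(\<lambda>n. \<i> * of_real (abel N ^ n * sfreq f n)) sums (\<i> * of_real (\<Sum>n. abel N ^ n * sfreq f n))"
      by (intro sums_mult sums_of_real) (simp add: sums_iff)
    then show ?thesis using main[of N] by (rule sums_unique2)
  qed
  ultimately have "\<i> * of_real (fourier_degree f) = fc ?af 0"
    using R LIMSEQ_unique by fastforce
  moreover have "C1_degree f = - \<i> * fc ?af 0"
    unfolding deg by (simp add: fc_def a mult.commute divide_simps)
  ultimately have "C1_degree f = - \<i> * (\<i> * of_real (fourier_degree f))" by simp
  then show ?thesis by simp
qed

text \<open>With one extension at hand, a degree assigned by \<open>circle_has_degree\<close> is
  forced to be the value of the Fourier series; if there were none, the quantification over
  extensions would be vacuous.\<close>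

theorem degree_extension_fourier_degree: "degree_extension (\<lambda>f. of_real (fourier_degree f))"
  unfolding degree_extension_def
proof (intro conjI ballI allI impI)
  show "complex_of_real (fourier_degree f) = C1_degree f" if "f \<in> C1_circle" for f
    using fourier_degree_C1[OF that] by simp
next
  fix f \<epsilon> assume f: "f \<in> hhalf_circle" and \<epsilon>: "(0::real) < \<epsilon>"
  define G where "G = enn2real (gagliardo_circle f) / (4 * pi\<^sup>2)"
  have G: "0 \<le> G" by (simp add: G_def)
  \<comment> \<open>\<open>G + 1\<close> avoids division by 0 when the seminorm vanishes. First
    \<open>\<eta>\<close>, then \<open>\<delta>\<close> is solved so that each part of
    \<open>fourier_degree_continuous\<close> costs at most \<open>\<epsilon> / 2\<close>.\<close>
  define \<eta> where "\<eta> = \<epsilon> / (2 * (G + 1))"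
  have \<eta>: "0 < \<eta>" using \<epsilon> G by (simp add: \<eta>_def)
  define \<delta> where "\<delta> = sqrt (\<epsilon> / (2 * (1 + 1 / \<eta>)))"
  have pos: "0 < \<epsilon> / (2 * (1 + 1 / \<eta>))" using \<epsilon> \<eta> by (intro divide_pos_pos mult_pos_pos add_pos_pos) auto
  have \<delta>: "0 < \<delta>" "(1 + 1 / \<eta>) * \<delta>\<^sup>2 = \<epsilon> / 2"
  proof -
    show "0 < \<delta>" using pos by (simp add: \<delta>_def)
    have "1 + 1 / \<eta> \<noteq> 0" using \<eta> by (simp add: add_pos_pos less_imp_neq[symmetric])
    then have "(1 + 1 / \<eta>) * (\<epsilon> / (2 * (1 + 1 / \<eta>))) = \<epsilon> / 2" by (metis nonzero_mult_div_cancel_right mult.commute times_divide_eq_right mult_divide_mult_cancel_left)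
    moreover have "\<delta>\<^sup>2 = \<epsilon> / (2 * (1 + 1 / \<eta>))" unfolding \<delta>_def using pos by (intro real_sqrt_pow2) simp
    ultimately show "(1 + 1 / \<eta>) * \<delta>\<^sup>2 = \<epsilon> / 2" by (simp only:)
  qed
  have "\<eta> * G < \<epsilon> / 2"
  proof -
    have "\<eta> * G < \<eta> * (G + 1)" using \<eta> by simp
    also have "\<dots> = \<epsilon> / 2" using G by (simp add: \<eta>_def field_simps)
    finally show ?thesis .
  qed
  show "\<exists>\<delta>>0. \<forall>h\<in>hhalf_circle. hhalf_circle_norm_sq (\<lambda>z. h z - f z) < ennreal (\<delta>\<^sup>2) \<longrightarrow>
      cmod (complex_of_real (fourier_degree h) - complex_of_real (fourier_degree f)) < \<epsilon>"
  proof (intro exI[of _ \<delta>] conjI ballI impI \<delta>(1))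
    fix h assume h: "h \<in> hhalf_circle" and close: "hhalf_circle_norm_sq (\<lambda>z. h z - f z) < ennreal (\<delta>\<^sup>2)"
    have le: "gagliardo_circle (\<lambda>z. h z - f z) \<le> hhalf_circle_norm_sq (\<lambda>z. h z - f z)"
      unfolding hhalf_circle_norm_sq_def by simp
    have lt: "gagliardo_circle (\<lambda>z. h z - f z) < ennreal (\<delta>\<^sup>2)" using le close by (rule le_less_trans)
    then have fin: "gagliardo_circle (\<lambda>z. h z - f z) < \<infinity>" by (simp add: order_less_trans)
    have E: "enn2real (gagliardo_circle (\<lambda>z. h z - f z)) \<le> \<delta>\<^sup>2"
      using enn2real_mono[OF less_imp_le[OF lt]] by simp
    have "\<bar>fourier_degree h - fourier_degree f\<bar> \<le> (1 + 1 / \<eta>) * enn2real (gagliardo_circle (\<lambda>z. h z - f z)) + \<eta> * G"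
      unfolding G_def by (rule fourier_degree_continuous[OF f h \<eta> fin])
    also have "\<dots> \<le> (1 + 1 / \<eta>) * \<delta>\<^sup>2 + \<eta> * G"
      using E \<eta> by (intro add_mono mult_left_mono) auto
    also have "\<dots> < \<epsilon>" using \<delta>(2) \<open>\<eta> * G < \<epsilon> / 2\<close> by simp
    finally show "cmod (complex_of_real (fourier_degree h) - complex_of_real (fourier_degree f)) < \<epsilon>"
      by (metis norm_of_real of_real_diff)
  qed
qed

text \<open>The two maps have distance 0, so continuity at \<open>f\<close> with tolerance
  \<open>|D h - D f|\<close>, tested on \<open>h\<close> itself, is contradictory. This pins down
  every extension at maps that are C1 up to a null set.\<close>

lemma degree_extension_cong_AE:
  assumes D: "degree_extension D" and f: "f \<in> hhalf_circle" and h: "h \<in> hhalf_circle"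
    and ae: "AE s in circ. f (cis s) = h (cis s)"
  shows "D f = D h"
proof (rule ccontr)
  assume "D f \<noteq> D h"
  then have "0 < cmod (D h - D f)" by simp
  then obtain \<delta> where \<delta>: "\<delta> > 0" "\<And>g. g \<in> hhalf_circle \<Longrightarrow> hhalf_circle_norm_sq (\<lambda>z. g z - f z) < ennreal (\<delta>\<^sup>2) \<Longrightarrow>
      cmod (D g - D f) < cmod (D h - D f)"
    using D f unfolding degree_extension_def by meson
  have ae0: "AE s in circ. h (cis s) - f (cis s) = (\<lambda>_. 0) (cis s)" using ae by auto
  have "gagliardo_circle (\<lambda>z. h z - f z) = gagliardo_circle (\<lambda>_. 0)"
    by (rule gagliardo_circle_cong_AE[OF ae0])
  also have "\<dots> = 0" by (simp add: gagliardo_circle_def)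
  finally have "gagliardo_circle (\<lambda>z. h z - f z) = 0" .
  moreover have "(\<integral>\<^sup>+ s. ennreal ((cmod (h (cis s) - f (cis s)))\<^sup>2) \<partial>circ) = (\<integral>\<^sup>+ s. 0 \<partial>circ)"
    by (rule nn_integral_cong_AE) (use ae in auto)
  ultimately have "hhalf_circle_norm_sq (\<lambda>z. h z - f z) = 0"
    by (simp add: hhalf_circle_norm_sq_def nn_integral_circ)
  then show False using \<delta>(2)[OF h] \<delta>(1) by simp
qed

section \<open>Unique continuation across an arc\<close>

text \<open>If \<open>g\<close> vanishes on an open arc, its Cauchy transform continues analytically across the arc from the exterior
  of the disc, where it is determined by the negative frequencies, to the interior, where its Taylor
  coefficients are the nonnegative ones.\<close>

lemma cauchy_transform_holomorphic:
  assumes [measurable]: "(\<lambda>s. g (cis s)) \<in> borel_measurable circ"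
    and bd: "\<And>s. cmod (g (cis s)) \<le> B"
    and S: "open S" and supp: "\<And>s. cis s \<in> S \<Longrightarrow> g (cis s) = 0"
  shows "(\<lambda>z. \<integral>s. g (cis s) * cis s / (cis s - z) \<partial>circ) holomorphic_on S"
proof (rule holomorphic_onI)
  let ?F = "\<lambda>z. \<integral>s. g (cis s) * cis s / (cis s - z) \<partial>circ"
  fix z assume "z \<in> S"
  then obtain \<delta> where \<delta>: "\<delta> > 0" "ball z \<delta> \<subseteq> S" using S openE by blast
  have B0: "0 \<le> B" using bd[of 0] norm_ge_zero order_trans by blast
  \<comment> \<open>Where \<open>g\<close> is nonzero, \<open>cis s\<close> lies outside the ball of
    radius \<open>\<delta>\<close> about \<open>z\<close>. Half of that distance remains for every
    \<open>w\<close> in the half ball and bounds the kernels uniformly.\<close>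
  have far: "\<delta> / 2 \<le> cmod (cis s - w)" if "g (cis s) \<noteq> 0" "dist w z < \<delta> / 2" for s w
  proof -
    have "cis s \<notin> ball z \<delta>" using that supp \<delta> by blast
    then have "\<delta> \<le> dist z (cis s)" by simp
    also have "\<dots> \<le> dist z w + dist w (cis s)" by (rule dist_triangle)
    finally show ?thesis using that(2) by (simp add: dist_norm norm_minus_commute)
  qed
  let ?K = "\<lambda>w s. g (cis s) * cis s / (cis s - w)"
  \<comment> \<open>Difference quotient of the Cauchy kernel between \<open>w\<close> and
    \<open>z\<close>; at \<open>w = z\<close> it is the derivative.\<close>
  let ?H = "\<lambda>w s. g (cis s) * cis s / ((cis s - w) * (cis s - z))"
  have Kb: "cmod (?K w s) \<le> B / (\<delta> / 2)" if "dist w z < \<delta> / 2" for w s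
  proof (cases "g (cis s) = 0")
    case False
    have "cmod (g (cis s)) / cmod (cis s - w) \<le> B / (\<delta> / 2)"
      using far[OF False that] \<delta>(1) bd[of s] B0 by (intro frac_le) auto
    then show ?thesis by (simp add: norm_divide norm_mult)
  qed (use B0 \<delta> in simp)
  have Ki: "integrable circ (?K w)" if "dist w z < \<delta> / 2" for w
    by (rule integrable_circ_bounded[OF _ Kb[OF that]]) measurable
  have Hb: "cmod (?H w s) \<le> B / (\<delta> / 2 * (\<delta> / 2))" if "dist w z < \<delta> / 2" for w s
  proof (cases "g (cis s) = 0")
    case False
    have "\<delta> / 2 * (\<delta> / 2) \<le> cmod (cis s - w) * cmod (cis s - z)"
      using \<delta>(1) far[OF False that] far[OF False, of z] by (intro mult_mono) auto
    then have "cmod (g (cis s)) / (cmod (cis s - w) * cmod (cis s - z)) \<le> B / (\<delta> / 2 * (\<delta> / 2))"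
      using \<delta>(1) bd[of s] B0 by (intro frac_le) auto
    then show ?thesis by (simp add: norm_divide norm_mult)
  qed (use B0 \<delta> in simp)
  have "(?F has_field_derivative (\<integral>s. ?H z s \<partial>circ)) (at z)"
    unfolding has_field_derivative_iff tendsto_at_iff_sequentially o_def
  proof (intro allI impI)
    fix X :: "nat \<Rightarrow> complex"
    assume X: "\<forall>i. X i \<in> UNIV - {z}" and lim: "X \<longlonglongrightarrow> z"
    obtain N where N: "\<And>i. i \<ge> N \<Longrightarrow> dist (X i) z < \<delta> / 2"
      using metric_LIMSEQ_D[OF lim, of "\<delta> / 2"] \<delta>(1) by auto
    have eq: "(?F (X i) - ?F z) / (X i - z) = (\<integral>s. ?H (X i) s \<partial>circ)" if "i \<ge> N" for i
    proof -
      have ne: "X i - z \<noteq> 0" using X by simp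
      have "?F (X i) - ?F z = (\<integral>s. ?K (X i) s - ?K z s \<partial>circ)"
        using Bochner_Integration.integral_diff[OF Ki[OF N[OF that]] Ki[of z]] \<delta>(1) by simp
      also have "\<dots> = (\<integral>s. (X i - z) * ?H (X i) s \<partial>circ)"
      proof (intro Bochner_Integration.integral_cong refl)
        fix s
        show "?K (X i) s - ?K z s = (X i - z) * ?H (X i) s"
        proof (cases "g (cis s) = 0")
          case False
          have "cis s - X i \<noteq> 0" "cis s - z \<noteq> 0"
            using far[OF False N[OF that]] far[OF False, of z] \<delta>(1) by auto
          then show ?thesis by (simp add: divide_simps) (simp add: algebra_simps)
        qed simp
      qed
      also have "\<dots> = (X i - z) * (\<integral>s. ?H (X i) s \<partial>circ)" by (rule integral_mult_right_zero)
      finally show ?thesis using ne by simp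
    qed
    have "(\<lambda>i. \<integral>s. ?H (X (i + N)) s \<partial>circ) \<longlonglongrightarrow> (\<integral>s. ?H z s \<partial>circ)"
    proof (rule integral_dominated_convergence[where w="\<lambda>_. B / (\<delta> / 2 * (\<delta> / 2))"])
      show "AE s in circ. (\<lambda>i. ?H (X (i + N)) s) \<longlonglongrightarrow> ?H z s"
      proof (rule AE_I2)
        fix s
        show "(\<lambda>i. ?H (X (i + N)) s) \<longlonglongrightarrow> ?H z s"
        proof (cases "g (cis s) = 0")
          case False
          have "cis s - z \<noteq> 0" using far[OF False, of z] \<delta>(1) by auto
          then show ?thesis by (intro tendsto_intros LIMSEQ_ignore_initial_segment lim) auto
        qed simp
      qed
      show "AE s in circ. norm (?H (X (i + N)) s) \<le> B / (\<delta> / 2 * (\<delta> / 2))" for i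
        by (intro AE_I2 Hb N) simp
    qed auto
    then have "(\<lambda>i. (?F (X (i + N)) - ?F z) / (X (i + N) - z)) \<longlonglongrightarrow> (\<integral>s. ?H z s \<partial>circ)"
      by (simp add: eq)
    then show "(\<lambda>i. (?F (X i) - ?F z) / (X i - z)) \<longlonglongrightarrow> (\<integral>s. ?H z s \<partial>circ)"
      by (rule LIMSEQ_offset)
  qed
  then show "?F field_differentiable at z within S"
    using field_differentiable_def field_differentiable_at_within by blast
qed

text \<open>For \<open>|z| > 1\<close> the kernel is minus the sum of the powers
  \<open>(cis s / z) ^ Suc n\<close>, which tests \<open>g\<close> against the frequencies
  \<open>-1, -2, ...\<close> only.\<close>

lemma cauchy_transform_outside:
  assumes [measurable]: "(\<lambda>s. g (cis s)) \<in> borel_measurable circ"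
    and bd: "\<And>s. cmod (g (cis s)) \<le> B" and neg: "\<And>n. n > 0 \<Longrightarrow> fc g (- int n) = 0"
    and z: "cmod z > 1"
  shows "(\<integral>s. g (cis s) * cis s / (cis s - z) \<partial>circ) = 0"
proof -
  let ?g = "\<lambda>n s. g (cis s) * (cis s / z) ^ Suc n"
  have B0: "0 \<le> B" using bd[of 0] norm_ge_zero order_trans by blast
  have "(\<lambda>n. \<integral>s. ?g n s \<partial>circ) sums (\<integral>s. (\<Sum>n. ?g n s) \<partial>circ)"
  proof (rule finite_measure_bounded_sums_integral[OF circ.finite_measure_axioms])
    show "cmod (?g n s) \<le> B * (1 / cmod z) ^ Suc n" for n s
      unfolding norm_mult norm_power norm_divide norm_cis by (intro mult_right_mono bd) simp
    have "summable (\<lambda>n. (1 / cmod z) ^ n)" using z by (intro summable_geometric) (simp add: divide_less_eq)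
    then show "summable (\<lambda>n. B * (1 / cmod z) ^ Suc n)" by (intro summable_mult) (subst summable_Suc_iff)
  qed measurable
  moreover have terms: "(\<integral>s. ?g n s \<partial>circ) = 0" for n
  proof -
    have e: "- (of_int (- int (Suc n)) * s) = real (Suc n) * s" for s by (simp add: algebra_simps)
    have "?g n s = (1 / z ^ Suc n) * (g (cis s) * cis (- (of_int (- int (Suc n)) * s)))" for s
      unfolding power_divide Complex.DeMoivre e by simp
    then have "(\<integral>s. ?g n s \<partial>circ) = (1 / z ^ Suc n) * (\<integral>s. g (cis s) * cis (- (of_int (- int (Suc n)) * s)) \<partial>circ)"
      by (simp only: integral_mult_right_zero)
    moreover have "(\<integral>s. g (cis s) * cis (- (of_int (- int (Suc n)) * s)) \<partial>circ) = 0"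
      using neg[of "Suc n"] unfolding fc_def by simp
    ultimately show ?thesis by simp
  qed
  ultimately have "(\<lambda>n. 0) sums (\<integral>s. (\<Sum>n. ?g n s) \<partial>circ)" by (simp only: terms)
  then have zero: "(\<integral>s. (\<Sum>n. ?g n s) \<partial>circ) = 0" using sums_unique2[OF _ sums_zero] by blast
  have "g (cis s) * cis s / (cis s - z) = - (\<Sum>n. ?g n s)" for s
  proof -
    have w: "cmod (cis s / z) < 1" using z by (simp add: norm_divide divide_less_eq)
    have z0: "z \<noteq> 0" "cis s \<noteq> z" using z by auto
    have "(\<lambda>n. g (cis s) * ((cis s / z) * (cis s / z) ^ n)) sums (g (cis s) * ((cis s / z) * (1 / (1 - cis s / z))))"
      by (intro sums_mult geometric_sums w)
    then have "(\<Sum>n. ?g n s) = g (cis s) * ((cis s / z) * (1 / (1 - cis s / z)))" by (simp add: sums_iff)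
    also have "(cis s / z) * (1 / (1 - cis s / z)) = - (cis s / (cis s - z))" using z0 by (simp add: field_simps)
    finally show ?thesis by simp
  qed
  then show ?thesis using zero by simp
qed

lemma cauchy_transform_inside:
  assumes [measurable]: "(\<lambda>s. g (cis s)) \<in> borel_measurable circ"
    and bd: "\<And>s. cmod (g (cis s)) \<le> B" and z: "cmod z < 1"
  shows "(\<lambda>n. (2 * pi * fc g (int n)) * z ^ n) sums (\<integral>s. g (cis s) * cis s / (cis s - z) \<partial>circ)"
proof -
  let ?g = "\<lambda>n s. g (cis s) * (z * cis (- s)) ^ n"
  have "(\<lambda>n. \<integral>s. ?g n s \<partial>circ) sums (\<integral>s. (\<Sum>n. ?g n s) \<partial>circ)"
  proof (rule finite_measure_bounded_sums_integral[OF circ.finite_measure_axioms])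
    show "cmod (?g n s) \<le> B * cmod z ^ n" for n s
      unfolding norm_mult norm_power norm_cis mult_1_right by (intro mult_right_mono bd) simp
    show "summable (\<lambda>n. B * cmod z ^ n)" using z by (intro summable_mult summable_geometric) simp
  qed measurable
  moreover have "(\<integral>s. ?g n s \<partial>circ) = (2 * pi * fc g (int n)) * z ^ n" for n
  proof -
    have "?g n s = z ^ n * (g (cis s) * cis (- (of_int (int n) * s)))" for s
      unfolding power_mult_distrib Complex.DeMoivre by simp
    then have "(\<integral>s. ?g n s \<partial>circ) = z ^ n * (\<integral>s. g (cis s) * cis (- (of_int (int n) * s)) \<partial>circ)"
      by (simp only: integral_mult_right_zero)
    then show ?thesis by (simp add: fc_def)
  qed
  moreover have "(\<Sum>n. ?g n s) = g (cis s) * cis s / (cis s - z)" for s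
  proof -
    have w: "cmod (z * cis (- s)) < 1" using z by (simp add: norm_mult)
    have z0: "cis s \<noteq> z" using z by auto
    have "(\<lambda>n. g (cis s) * (z * cis (- s)) ^ n) sums (g (cis s) * (1 / (1 - z * cis (- s))))"
      by (intro sums_mult geometric_sums w)
    moreover have "1 / (1 - z * cis (- s)) = cis s / (cis s - z)"
    proof -
      have "cis s * (1 - z * cis (- s)) = cis s - z" by (simp add: right_diff_distrib cis_mult mult.left_commute)
      then show ?thesis by (metis cis_neq_zero mult_divide_mult_cancel_left mult.right_neutral)
    qed
    ultimately show ?thesis by (simp add: sums_iff)
  qed
  ultimately show ?thesis by simp
qed

lemma unique_continuation:
  assumes m [measurable]: "(\<lambda>s. f (cis s)) \<in> borel_measurable circ"
    and bd: "AE s in circ. cmod (f (cis s)) \<le> B"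
    and zero: "AE s in circ. sin s \<ge> 0 \<longrightarrow> f (cis s) = 0"
    and neg: "\<And>n. n > 0 \<Longrightarrow> fc f (- int n) = 0"
  shows "fc f (int n) = 0"
proof -
  \<comment> \<open>The Cauchy transform needs vanishing at every point of the closed upper arc and
    a bound everywhere; both are arranged by a change on a null set.\<close>
  define g where "g z = (if Im z \<ge> 0 \<or> cmod (f z) > B then 0 else f z)" for z
  have mg [measurable]: "(\<lambda>s. g (cis s)) \<in> borel_measurable circ" unfolding g_def by simp
  have ae: "AE s in circ. f (cis s) = g (cis s)"
    using bd zero by eventually_elim (auto simp: g_def)
  have fcg: "fc f k = fc g k" for k by (rule fc_cong_AE[OF m mg ae])
  have bg: "\<And>s. cmod (g (cis s)) \<le> max B 0" by (auto simp: g_def)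
  define F where "F z = (\<integral>s. g (cis s) * cis s / (cis s - z) \<partial>circ)" for z
  \<comment> \<open>The upper half-plane joins the disc to the exterior across the arc on which
    \<open>g\<close> vanishes; \<open>\<i> / 2\<close> and \<open>2 * \<i>\<close> lie in the
    overlaps.\<close>
  define S where "S = {z. Im z > 0} \<union> ball 0 1 \<union> - cball (0::complex) 1"
  have "open S" unfolding S_def by (intro open_Un open_halfspace_Im_gt) auto
  have "connected S"
  proof -
    have "connected ({z. Im z > 0} \<union> ball (0::complex) 1)"
    proof (rule connected_Un)
      have "\<i> / 2 \<in> {z. Im z > 0} \<inter> ball 0 1" by (simp add: norm_divide)
      then show "{z. Im z > 0} \<inter> ball (0::complex) 1 \<noteq> {}" by blast
    qed (auto intro: convex_connected convex_halfspace_Im_gt)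
    then show ?thesis unfolding S_def
    proof (rule connected_Un)
      show "connected (- cball (0::complex) 1)"
        by (rule connected_complement_bounded_convex) auto
      have "2 * \<i> \<in> ({z. Im z > 0} \<union> ball 0 1) \<inter> - cball 0 1" by (simp add: norm_mult)
      then show "({z. Im z > 0} \<union> ball 0 1) \<inter> - cball (0::complex) 1 \<noteq> {}" by blast
    qed
  qed
  have hol: "F holomorphic_on S"
    unfolding F_def[abs_def]
    by (rule cauchy_transform_holomorphic[OF mg bg \<open>open S\<close>]) (auto simp: S_def g_def)
  have out: "F z = 0" if "z \<in> - cball 0 1" for z
    unfolding F_def by (rule cauchy_transform_outside[OF mg bg]) (use that neg fcg in auto)
  have F0: "F z = 0" if "z \<in> S" for z
  proof (rule analytic_continuation_open[of "- cball 0 1" S F "\<lambda>_. 0"])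
    have "2 \<in> - cball (0::complex) 1" by simp
    then show "- cball (0::complex) 1 \<noteq> {}" by blast
  qed (use out that hol \<open>open S\<close> \<open>connected S\<close> in \<open>auto simp: S_def\<close>)
  have sums: "(\<lambda>n. (2 * pi * fc g (int n)) * (z - 0) ^ n) sums F z" if "cmod (z - 0) < 1" for z
    using cauchy_transform_inside[OF mg bg, of z] that unfolding F_def by simp
  \<comment> \<open>Isolation of zeros by \<open>powser_0_nonzero\<close> starts from a nonzero
    coefficient of positive index, so the constant coefficient is first read off at the
    centre.\<close>
  have "2 * pi * fc g (int n) = 0"
  proof (cases "n = 0")
    case True
    have "F 0 = 2 * pi * fc g 0" using sums[of 0] sums_unique[OF sums[of 0]] powser_zero[of "\<lambda>n. 2 * pi * fc g (int n)"] by simp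
    then show ?thesis using F0[of 0] True by (simp add: S_def)
  next
    case False
    show ?thesis
    proof (rule ccontr)
      assume "2 * pi * fc g (int n) \<noteq> 0"
      then obtain r where r: "0 < r" "\<And>z. z \<in> cball 0 r - {0} \<Longrightarrow> F z \<noteq> 0"
        using powser_0_nonzero[of 1 0 "\<lambda>n. 2 * pi * fc g (int n)" F n] sums F0[of 0] False
        by (auto simp: S_def)
      have "complex_of_real (min r (1/2)) \<in> cball 0 r - {0}" "complex_of_real (min r (1/2)) \<in> S"
        using r(1) by (auto simp: S_def)
      then show False using r(2) F0 by blast
    qed
  qed
  then show ?thesis by (simp add: fcg)
qed

section \<open>Stereographic projection\<close>

definition sline :: "real \<Rightarrow> real" where
  "sline s = stereo (cis s)"

lemma sline_eq: "sline s = cos s / (1 - sin s)"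
  by (simp add: sline_def stereo_def)

text \<open>With \<open>t = s / 2 + pi / 4\<close> one has \<open>cos s = sin (2 * t)\<close> and
  \<open>sin s = - cos (2 * t)\<close>, and \<open>sin (2 * t) / (1 + cos (2 * t))\<close> is the
  half-angle form of \<open>tan t\<close>.\<close>

lemma sline_tan:
  assumes "s \<in> {- 3 * pi / 2 <..< pi / 2}"
  shows "sline s = tan (s / 2 + pi / 4)"
proof -
  define t where "t = s / 2 + pi / 4"
  have t: "\<bar>t\<bar> < pi / 2" unfolding t_def abs_less_iff using assms by auto
  then have c: "cos t > 0" by (intro cos_gt_zero_pi) auto
  have s: "s = 2 * t - pi / 2" by (simp add: t_def)
  have "cos s = sin (2 * t)" "sin s = - cos (2 * t)"
    unfolding s by (simp_all add: cos_diff sin_diff)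
  then have "sline s = 2 * sin t * cos t / (1 + cos (2 * t))"
    by (simp add: sline_eq sin_double)
  also have "1 + cos (2 * t) = 2 * (cos t)\<^sup>2" by (simp add: cos_double_cos)
  finally show ?thesis using c by (simp add: tan_def t_def power2_eq_square)
qed

lemma one_minus_sin_pos:
  assumes "s \<in> {- 3 * pi / 2 <..< pi / 2}"
  shows "0 < 1 - sin s"
proof -
  define t where "t = s / 2 + pi / 4"
  have "\<bar>t\<bar> < pi / 2" unfolding t_def abs_less_iff using assms by auto
  then have c: "cos t > 0" by (intro cos_gt_zero_pi) auto
  have "s = 2 * t - pi / 2" by (simp add: t_def)
  then have "1 - sin s = 2 * (cos t)\<^sup>2" by (simp add: sin_diff cos_double_cos)
  then show ?thesis using c by simp
qed

lemma sline_deriv: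
  assumes "sin s \<noteq> 1"
  shows "(sline has_real_derivative 1 / (1 - sin s)) (at s within S)"
proof -
  have "((\<lambda>s. cos s / (1 - sin s)) has_real_derivative 1 / (1 - sin s)) (at s within S)"
    using assms sin_cos_squared_add[of s] no_zero_divisors[of "1 - sin s" "1 - sin s"]
    by (auto intro!: derivative_eq_intros simp: field_simps power2_eq_square)
  then show ?thesis by (simp add: sline_eq[abs_def])
qed

lemma sline_measurable [measurable]: "sline \<in> borel_measurable borel"
  unfolding sline_eq[abs_def] by measurable

text \<open>The circle, cut at \<open>\<i>\<close>, is parametrised by \<open>s \<in> (-3\<pi>/2, \<pi>/2)\<close>, where \<open>sline s = tan (s/2 + \<pi>/4)\<close>.\<close>

lemma lborel_sline:
  "distr (density lborel (\<lambda>s. ennreal (1 / (1 - sin s)) * indicator {- 3 * pi / 2 <..< pi / 2} s)) borel sline = lborel"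
  (is "?M = _")
proof (rule lborel_eqI[symmetric])
  let ?J = "{- 3 * pi / 2 <..< pi / 2 :: real}"
  fix l u :: real
  assume "\<And>b. b \<in> Basis \<Longrightarrow> l \<bullet> b \<le> u \<bullet> b"
  then have lu: "l \<le> u" by simp
  define a b where "a = 2 * arctan l - pi / 2" and "b = 2 * arctan u - pi / 2"
  have ab: "a \<in> ?J" "b \<in> ?J" "a \<le> b"
    using arctan_bounded[of l] arctan_bounded[of u] lu by (auto simp: a_def b_def arctan_monotone')
  \<comment> \<open>On the cut circle \<open>sline\<close> is increasing with inverse
    \<open>2 * arctan x - pi / 2\<close>, so the preimage of a box is an interval, whose weighted
    length is computed by the fundamental theorem.\<close>
  have iff: "s \<in> ?J \<and> sline s \<in> box l u \<longleftrightarrow> s \<in> {a<..<b}" for s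
  proof (cases "s \<in> ?J")
    case True
    then have t: "- (pi / 2) < s / 2 + pi / 4" "s / 2 + pi / 4 < pi / 2" by auto
    have "l < tan (s / 2 + pi / 4) \<longleftrightarrow> arctan l < s / 2 + pi / 4"
      using arctan_tan[OF t] by (metis arctan_less_iff)
    moreover have "tan (s / 2 + pi / 4) < u \<longleftrightarrow> s / 2 + pi / 4 < arctan u"
      using arctan_tan[OF t] by (metis arctan_less_iff)
    ultimately show ?thesis using True by (auto simp: sline_tan a_def b_def)
  next
    case False
    then show ?thesis using ab by auto
  qed
  have "emeasure ?M (box l u) = (\<integral>\<^sup>+ s. ennreal (1 / (1 - sin s)) * indicator {- 3 * pi / 2 <..< pi / 2} s * indicator (sline -` box l u) s \<partial>lborel)"
  proof -
    have "sline -` box l u \<in> sets borel" by (rule measurable_sets_borel[OF sline_measurable]) simp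
    then show ?thesis by (simp add: emeasure_distr emeasure_density)
  qed
  also have "\<dots> = (\<integral>\<^sup>+ s. ennreal (1 / (1 - sin s)) * indicator {a<..<b} s \<partial>lborel)"
    by (intro nn_integral_cong) (use iff in \<open>auto simp: indicator_def\<close>)
  also have "\<dots> = (\<integral>\<^sup>+ s. ennreal (1 / (1 - sin s)) * indicator {a..b} s \<partial>lborel)"
  proof (rule nn_integral_cong_AE)
    show "AE s in lborel. ennreal (1 / (1 - sin s)) * indicator {a<..<b} s = ennreal (1 / (1 - sin s)) * indicator {a..b} s"
      using AE_lborel_singleton[of a] AE_lborel_singleton[of b]
      by eventually_elim (auto simp: indicator_def)
  qed
  also have "\<dots> = sline b - sline a"
  proof (rule nn_integral_FTC_Icc)
    show "(\<lambda>s::real. 1 / (1 - sin s)) \<in> borel_measurable borel" by measurable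
    fix s assume "s \<in> {a..b}"
    then have "s \<in> ?J" using ab by auto
    then have p: "0 < 1 - sin s" by (rule one_minus_sin_pos)
    then show "(sline has_real_derivative 1 / (1 - sin s)) (at s)" by (intro sline_deriv) auto
    show "0 \<le> 1 / (1 - sin s)" using p by simp
  qed (use ab in auto)
  also have "sline b = u" using ab(2) by (subst sline_tan) (simp_all add: b_def diff_divide_distrib tan_arctan)
  also have "sline a = l" using ab(1) by (subst sline_tan) (simp_all add: a_def diff_divide_distrib tan_arctan)
  finally show "emeasure ?M (box l u) = ennreal (\<Prod>b\<in>Basis. (u - l) \<bullet> b)" by simp
qed simp

lemma nn_integral_sline:
  fixes F :: "real \<Rightarrow> ennreal"
  assumes [measurable]: "F \<in> borel_measurable borel"
  shows "(\<integral>\<^sup>+ x. F x \<partial>lborel) =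
    (\<integral>\<^sup>+ s\<in>{- 3 * pi / 2 <..< pi / 2}. ennreal (1 / (1 - sin s)) * F (sline s) \<partial>lborel)"
  by (subst lborel_sline[symmetric], subst nn_integral_distr)
     (auto simp: nn_integral_density mult_ac intro!: nn_integral_cong)

text \<open>The piece below 0 is moved up by one period; the pieces then tile
  \<open>[0, 2 pi]\<close> up to finitely many points.\<close>

lemma nn_integral_periodic:
  fixes F :: "real \<Rightarrow> ennreal"
  assumes [measurable]: "F \<in> borel_measurable borel" and per: "\<And>s. F (s + 2 * pi) = F s"
  shows "(\<integral>\<^sup>+ s\<in>{- 3 * pi / 2 <..< pi / 2}. F s \<partial>lborel) = (\<integral>\<^sup>+ s. F s \<partial>circ)"
proof -
  have "(\<integral>\<^sup>+ s\<in>{- 3 * pi / 2 <..< 0}. F s \<partial>lborel) = (\<integral>\<^sup>+ s. F (- 2 * pi + 1 * s) * indicator {- 3 * pi / 2 <..< 0} (- 2 * pi + 1 * s) \<partial>lborel)"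
    by (subst nn_integral_real_affine[of _ 1 "- 2 * pi"]) auto
  also have "\<dots> = (\<integral>\<^sup>+ s\<in>{pi / 2 <..< 2 * pi}. F s \<partial>lborel)"
    by (intro nn_integral_cong) (use per[of "_ - 2 * pi"] in \<open>auto simp: indicator_def algebra_simps\<close>)
  finally have e: "(\<integral>\<^sup>+ s\<in>{- 3 * pi / 2 <..< 0}. F s \<partial>lborel) = (\<integral>\<^sup>+ s\<in>{pi / 2 <..< 2 * pi}. F s \<partial>lborel)" .
  have "(\<integral>\<^sup>+ s\<in>{- 3 * pi / 2 <..< pi / 2}. F s \<partial>lborel) =
     (\<integral>\<^sup>+ s. F s * indicator {- 3 * pi / 2 <..< 0} s + F s * indicator {0 <..< pi / 2} s \<partial>lborel)"
    by (intro nn_integral_cong_AE eventually_mono[OF AE_lborel_singleton[of 0]])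
       (use pi_gt_zero in \<open>auto simp: indicator_def\<close>)
  also have "\<dots> = (\<integral>\<^sup>+ s\<in>{- 3 * pi / 2 <..< 0}. F s \<partial>lborel) + (\<integral>\<^sup>+ s\<in>{0 <..< pi / 2}. F s \<partial>lborel)"
    by (rule nn_integral_add) auto
  also have "\<dots> = (\<integral>\<^sup>+ s. F s * indicator {pi / 2 <..< 2 * pi} s + F s * indicator {0 <..< pi / 2} s \<partial>lborel)"
    unfolding e by (rule nn_integral_add[symmetric]) auto
  also have "\<dots> = (\<integral>\<^sup>+ s\<in>{0..2*pi}. F s \<partial>lborel)"
  proof (rule nn_integral_cong_AE)
    show "AE s in lborel. F s * indicator {pi / 2 <..< 2 * pi} s + F s * indicator {0 <..< pi / 2} s = F s * indicator {0..2*pi} s"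
      using AE_lborel_singleton[of 0] AE_lborel_singleton[of "pi/2"] AE_lborel_singleton[of "2*pi"]
      by eventually_elim (auto simp: indicator_def)
  qed
  finally show ?thesis by (simp add: nn_integral_circ)
qed

lemma nn_integral_line_circ:
  fixes F :: "real \<Rightarrow> ennreal"
  assumes [measurable]: "F \<in> borel_measurable borel"
  shows "(\<integral>\<^sup>+ x. F x \<partial>lborel) = (\<integral>\<^sup>+ s. ennreal (1 / (1 - sin s)) * F (sline s) \<partial>circ)"
  unfolding nn_integral_sline[OF assms]
  by (rule nn_integral_periodic) (auto simp: sline_eq)

lemma cis_cut_representative:
  assumes "sin s \<noteq> 1"
  obtains t where "t \<in> {- 3 * pi / 2 <..< pi / 2}" "cis t = cis s"
proof -
  define k where "k = \<lfloor>(s + 3 * pi / 2) / (2 * pi)\<rfloor>"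
  define t where "t = s - 2 * pi * k"
  have c: "cis t = cis s"
    using cis_multiple_2pi[of "of_int k"] by (simp add: t_def cis_divide[symmetric])
  have "k \<le> (s + 3 * pi / 2) / (2 * pi)" "(s + 3 * pi / 2) / (2 * pi) < k + 1"
    unfolding k_def by (rule of_int_floor_le, rule floor_correct[THEN conjunct2, THEN order_less_le_trans]) simp
  then have t: "- 3 * pi / 2 \<le> t" "t < pi / 2"
    by (simp_all add: t_def field_simps)
  \<comment> \<open>The floor leaves a half-open interval; its left end represents the cut point
    \<open>\<i>\<close>, which the hypothesis excludes.\<close>
  have "t \<noteq> - 3 * pi / 2"
  proof
    assume "t = - 3 * pi / 2"
    moreover have "- 3 * pi / 2 = pi / 2 - 2 * pi" by simp
    ultimately have "sin t = 1" by (simp only: sin_diff) simp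
    then show False using c assms by (metis cis.sel(2))
  qed
  with t c that show ?thesis by force
qed

lemma sline_cong: "cis s = cis t \<Longrightarrow> sline s = sline t"
  by (simp add: sline_def)

lemma countable_sin_eq_1: "countable {s::real. sin s = 1}"
proof -
  have "{s::real. sin s = 1} \<subseteq> range (\<lambda>n::int. (2 * of_int n + 1/2) * pi)"
    by (auto simp: sin_eq_1)
  then show ?thesis by (rule countable_subset) auto
qed

lemma AE_sin_neq_1: "AE s in lborel. sin s \<noteq> (1::real)"
  using AE_not_in[OF countable_imp_null_set_lborel[OF countable_sin_eq_1]] by simp

text \<open>The density is positive on the cut circle, so preimages of null sets are null there.
  Since \<open>hhalf_circle\<close> speaks of all real angles, the countably many translates by
  multiples of \<open>2 pi\<close> are collected; the angles with \<open>sin s = 1\<close> are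
  negligible.\<close>

lemma AE_sline:
  assumes "AE x in lborel. P x"
  shows "AE s in lborel. P (sline s)"
proof -
  from AE_E[OF assms] obtain N where N: "{x \<in> space lborel. \<not> P x} \<subseteq> N" "emeasure lborel N = 0" "N \<in> sets lborel"
    by metis
  have [measurable]: "N \<in> sets borel" using N by simp
  have "0 = (\<integral>\<^sup>+ x. indicator N x \<partial>lborel)" using N by simp
  also have "\<dots> = (\<integral>\<^sup>+ s\<in>{- 3 * pi / 2 <..< pi / 2}. ennreal (1 / (1 - sin s)) * indicator N (sline s) \<partial>lborel)"
    by (rule nn_integral_sline) simp
  finally have "AE s in lborel. ennreal (1 / (1 - sin s)) * indicator N (sline s) * indicator {- 3 * pi / 2 <..< pi / 2} s = 0"
    by (subst (asm) eq_commute, subst (asm) nn_integral_0_iff_AE) auto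
  then have ae: "AE s in lborel. s \<in> {- 3 * pi / 2 <..< pi / 2} \<longrightarrow> sline s \<notin> N"
  proof eventually_elim
    case (elim s)
    then show ?case using one_minus_sin_pos[of s] by (auto simp: indicator_def split: if_splits)
  qed
  have "AE s in lborel. \<forall>k::int. (- 2 * pi * k + 1 * s) \<in> {- 3 * pi / 2 <..< pi / 2} \<longrightarrow> sline (- 2 * pi * k + 1 * s) \<notin> N"
    unfolding AE_all_countable by (intro allI AE_borel_affine ae) auto
  with AE_sin_neq_1 show ?thesis
  proof eventually_elim
    case (elim s)
    obtain t where t: "t \<in> {- 3 * pi / 2 <..< pi / 2}" "cis t = cis s"
      using cis_cut_representative[OF elim(1)] .
    have "sin s = sin t \<and> cos s = cos t" using t(2) by (metis cis.sel)
    then obtain k :: int where "s = t + 2 * pi * k" using sin_cos_eq_iff[of s t] by auto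
    then have "sline t \<notin> N" using elim(2)[rule_format, of k] t(1) by simp
    then show ?case using N(1) sline_cong[OF t(2)] by auto
  qed
qed

text \<open>\<open>1 / (1 - sin s)\<close> and \<open>1 / (1 - sin t)\<close> are the Jacobians of
  the projection at the two points. They cancel in the double change of variables, which makes the
  seminorm conformally invariant.\<close>

lemma chord_sline:
  assumes "sin s \<noteq> 1" "sin t \<noteq> 1"
  shows "(sline s - sline t)\<^sup>2 = (cmod (cis s - cis t))\<^sup>2 / ((1 - sin s) * (1 - sin t))"
proof -
  define a b c d where abcd: "a = sin s" "b = sin t" "c = cos s" "d = cos t"
  have e: "c * c = 1 - a * a" "d * d = 1 - b * b"
    unfolding abcd using sin_cos_squared_add[of s] sin_cos_squared_add[of t] by (auto simp: power2_eq_square)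
  have n: "1 - a \<noteq> 0" "1 - b \<noteq> 0" using assms by (auto simp: abcd)
  have "sline s - sline t = (c * (1 - b) - d * (1 - a)) / ((1 - a) * (1 - b))"
    using n by (simp add: sline_eq abcd[symmetric] divide_simps)
  moreover have "(c * (1 - b) - d * (1 - a))\<^sup>2 = ((c - d)\<^sup>2 + (a - b)\<^sup>2) * ((1 - a) * (1 - b))"
    using e by algebra
  moreover have "(cmod (cis s - cis t))\<^sup>2 = (c - d)\<^sup>2 + (a - b)\<^sup>2"
    by (simp add: cmod_power2 abcd)
  ultimately show ?thesis
    using n by (simp add: power_divide abcd[symmetric] power2_eq_square)
qed

lemma one_minus_sin_pos': "sin s \<noteq> 1 \<Longrightarrow> 0 < 1 - sin (s::real)"
  using sin_le_one[of s] by linarith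

lemma gagliardo_line_circle:
  assumes [measurable]: "u \<in> borel_measurable borel"
  shows "gagliardo_line u = gagliardo_circle (u \<circ> stereo)"
proof -
  let ?J = "\<lambda>s. ennreal (1 / (1 - sin s))"
  let ?K = "\<lambda>x y. ennreal ((cmod (u x - u y))\<^sup>2 / \<bar>x - y\<bar>\<^sup>2)"
  have "gagliardo_line u = (\<integral>\<^sup>+ x. (\<integral>\<^sup>+ t. ?J t * ?K x (sline t) \<partial>circ) \<partial>lborel)"
    unfolding gagliardo_line_def by (intro nn_integral_cong nn_integral_line_circ) measurable
  also have "\<dots> = (\<integral>\<^sup>+ s. ?J s * (\<integral>\<^sup>+ t. ?J t * ?K (sline s) (sline t) \<partial>circ) \<partial>circ)"
    by (rule nn_integral_line_circ) measurable
  also have "\<dots> = (\<integral>\<^sup>+ s. (\<integral>\<^sup>+ t. ?J s * (?J t * ?K (sline s) (sline t)) \<partial>circ) \<partial>circ)"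
    by (intro nn_integral_cong nn_integral_cmult[symmetric]) measurable
  also have "\<dots> = (\<integral>\<^sup>+ s. (\<integral>\<^sup>+ t. ennreal ((cmod ((u \<circ> stereo) (cis s) - (u \<circ> stereo) (cis t)))\<^sup>2 / (cmod (cis s - cis t))\<^sup>2) \<partial>circ) \<partial>circ)"
  proof -
    have ae: "AE s in circ. sin s \<noteq> 1" by (rule AE_circI[OF AE_sin_neq_1])
    have "?J s * (?J t * ?K (sline s) (sline t)) =
        ennreal ((cmod ((u \<circ> stereo) (cis s) - (u \<circ> stereo) (cis t)))\<^sup>2 / (cmod (cis s - cis t))\<^sup>2)"
      if st: "sin s \<noteq> 1" "sin t \<noteq> 1" for s t
    proof -
      have p: "0 < 1 - sin s" "0 < 1 - sin t" using st one_minus_sin_pos' by blast+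
      have "?J s * (?J t * ?K (sline s) (sline t)) =
         ennreal (1 / (1 - sin s) * (1 / (1 - sin t) * ((cmod (u (sline s) - u (sline t)))\<^sup>2 / \<bar>sline s - sline t\<bar>\<^sup>2)))"
      proof -
        have "ennreal x * (ennreal y * ennreal z) = ennreal (x * (y * z))" if "0 \<le> x" "0 \<le> y" for x y z
          by (simp add: ennreal_mult' that)
        then show ?thesis using p by simp
      qed
      also have "1 / (1 - sin s) * (1 / (1 - sin t) * ((cmod (u (sline s) - u (sline t)))\<^sup>2 / \<bar>sline s - sline t\<bar>\<^sup>2)) =
         (cmod (u (sline s) - u (sline t)))\<^sup>2 / (cmod (cis s - cis t))\<^sup>2"
      proof -
        have "1 / p * (1 / q * (x / (y / (p * q)))) = x / y" if "p \<noteq> 0" "q \<noteq> 0" for p q x y :: real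
          using that by simp
        then show ?thesis using p unfolding power2_abs chord_sline[OF st] by simp
      qed
      finally show ?thesis by (simp add: sline_def)
    qed
    then show ?thesis
      by (intro nn_integral_cong_AE) (use ae in \<open>eventually_elim, intro nn_integral_cong_AE, use ae in eventually_elim, simp\<close>)
  qed
  finally show ?thesis by (simp add: gagliardo_circle_def nn_integral_circ)
qed

section \<open>Passing maps between the line and the circle\<close>

lemma hhalf_line_imp_circle:
  assumes "u \<in> hhalf_line"
  shows "u \<circ> stereo \<in> hhalf_circle"
proof -
  have m [measurable]: "u \<in> borel_measurable borel" and ae: "AE x in lborel. cmod (u x) = 1" and fin: "gagliardo_line u < \<infinity>"
    using assms by (auto simp: hhalf_line_def)
  have "(\<lambda>s. (u \<circ> stereo) (cis s)) = (\<lambda>s. u (sline s))" by (simp add: sline_def)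
  moreover have "(\<lambda>s. u (sline s)) \<in> borel_measurable borel" by measurable
  ultimately show ?thesis
    using AE_sline[OF ae] fin gagliardo_line_circle[OF m] by (simp add: hhalf_circle_def sline_def)
qed

text \<open>The angle of the point of the circle with projection \<open>x\<close> is \<open>2 arctan x - \<pi>/2\<close>.\<close>

definition lift :: "(complex \<Rightarrow> complex) \<Rightarrow> real \<Rightarrow> complex" where
  "lift G x = G (cis (2 * arctan x - pi / 2))"

lemma sline_arctan: "sline (2 * arctan x - pi / 2) = x"
proof -
  have "2 * arctan x - pi / 2 \<in> {- 3 * pi / 2 <..< pi / 2}" using arctan_bounded[of x] by auto
  then show ?thesis by (subst sline_tan) (simp_all add: diff_divide_distrib tan_arctan)
qed

lemma cis_arctan_sline:
  assumes "sin s \<noteq> 1"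
  shows "cis (2 * arctan (sline s) - pi / 2) = cis s"
proof -
  obtain t where t: "t \<in> {- 3 * pi / 2 <..< pi / 2}" "cis t = cis s"
    using cis_cut_representative[OF assms] .
  have "arctan (tan (t / 2 + pi / 4)) = t / 2 + pi / 4" by (rule arctan_tan) (use t(1) in auto)
  then have "2 * arctan (sline t) - pi / 2 = t" using sline_tan[OF t(1)] by simp
  then show ?thesis using t(2) sline_cong[OF t(2)] by metis
qed

lemma lift_stereo:
  assumes "sin s \<noteq> 1"
  shows "(lift G \<circ> stereo) (cis s) = G (cis s)"
  using cis_arctan_sline[OF assms] by (simp add: lift_def sline_def)

text \<open>On the circle \<open>lift G \<circ> stereo\<close> differs from \<open>G\<close> at most
  at the point \<open>\<i>\<close>, so every extension gives it the degree of \<open>G\<close>. The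
  competitors below all arise in this way.\<close>

lemma lift_C1:
  assumes G: "G \<in> C1_circle"
  shows "lift G \<in> hhalf_line" "gagliardo_line (lift G) = gagliardo_circle G"
    "degree_extension D \<Longrightarrow> D (lift G \<circ> stereo) = C1_degree G"
proof -
  have G': "G \<in> hhalf_circle" using G C1_circle_subset_hhalf by blast
  from C1_circleE[OF G] obtain F' where F': "\<And>s. ((\<lambda>s. G (cis s)) has_vector_derivative F' s) (at s)"
    and n: "\<And>s. cmod (G (cis s)) = 1" by metis
  have [measurable]: "(\<lambda>s. G (cis s)) \<in> borel_measurable borel" by (rule C1_cis_measurable[OF F'])
  have m [measurable]: "lift G \<in> borel_measurable borel"
    unfolding lift_def[abs_def] by measurable
  have ae: "AE s in circ. (lift G \<circ> stereo) (cis s) = G (cis s)"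
    using AE_circI[OF AE_sin_neq_1] by eventually_elim (rule lift_stereo)
  have e: "gagliardo_circle (lift G \<circ> stereo) = gagliardo_circle G"
    by (rule gagliardo_circle_cong_AE[OF ae])
  then show gag: "gagliardo_line (lift G) = gagliardo_circle G"
    using gagliardo_line_circle[OF m] by simp
  show h: "lift G \<in> hhalf_line"
    using m hhalf_circleD(3)[OF G'] by (simp add: hhalf_line_def gag) (simp add: lift_def n)
  show "D (lift G \<circ> stereo) = C1_degree G" if D: "degree_extension D"
    using degree_extension_cong_AE[OF D hhalf_line_imp_circle[OF h] G' ae] D G
    unfolding degree_extension_def by metis
qed

section \<open>Blaschke products on the circle\<close>

lemma cnj_mult_self_unit: "cmod z = 1 \<Longrightarrow> cnj z * z = 1"
  using complex_norm_square[of z] by (simp add: mult.commute)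

text \<open>For unimodular maps the integrand of the degree is the logarithmic derivative, which is
  additive on products.\<close>

lemma C1_circle_mult:
  assumes f: "f \<in> C1_circle" and g: "g \<in> C1_circle"
  shows "(\<lambda>z. f z * g z) \<in> C1_circle" "C1_degree (\<lambda>z. f z * g z) = C1_degree f + C1_degree g"
proof -
  from C1_circleE[OF f] obtain F where F: "\<And>s. ((\<lambda>s. f (cis s)) has_vector_derivative F s) (at s)"
    "continuous_on UNIV F" "\<And>s. cmod (f (cis s)) = 1"
    "C1_degree f = 1 / (2 * complex_of_real pi * \<i>) * (\<integral>s. cnj (f (cis s)) * F s \<partial>circ)"
    by metis
  from C1_circleE[OF g] obtain G where G: "\<And>s. ((\<lambda>s. g (cis s)) has_vector_derivative G s) (at s)"
    "continuous_on UNIV G" "\<And>s. cmod (g (cis s)) = 1"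
    "C1_degree g = 1 / (2 * complex_of_real pi * \<i>) * (\<integral>s. cnj (g (cis s)) * G s \<partial>circ)"
    by metis
  have cont: "continuous_on UNIV (\<lambda>s. f (cis s))" "continuous_on UNIV (\<lambda>s. g (cis s))"
    using F(1) G(1) by (meson continuous_at_imp_continuous_on has_vector_derivative_continuous)+
  let ?H = "\<lambda>s. f (cis s) * G s + F s * g (cis s)"
  have H: "((\<lambda>s. f (cis s) * g (cis s)) has_vector_derivative ?H s) (at s)" for s
    by (rule has_vector_derivative_mult[OF F(1) G(1)])
  have Hc: "continuous_on UNIV ?H" by (intro continuous_intros F G cont)
  show fg: "(\<lambda>z. f z * g z) \<in> C1_circle"
    by (rule C1_circleI[OF H Hc]) (simp add: norm_mult F G)
  have unit: "cnj (f (cis s)) * f (cis s) = 1" "cnj (g (cis s)) * g (cis s) = 1" for s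
    by (simp_all add: cnj_mult_self_unit F G)
  have "(\<integral>s. cnj (f (cis s) * g (cis s)) * ?H s \<partial>circ) = (\<integral>s. cnj (f (cis s)) * F s + cnj (g (cis s)) * G s \<partial>circ)"
  proof (intro Bochner_Integration.integral_cong refl)
    fix s
    have "cnj (f (cis s) * g (cis s)) * ?H s =
      (cnj (f (cis s)) * f (cis s)) * (cnj (g (cis s)) * G s) + (cnj (g (cis s)) * g (cis s)) * (cnj (f (cis s)) * F s)"
      by (simp add: algebra_simps)
    then show "cnj (f (cis s) * g (cis s)) * ?H s = cnj (f (cis s)) * F s + cnj (g (cis s)) * G s"
      by (simp add: unit)
  qed
  also have "\<dots> = (\<integral>s. cnj (f (cis s)) * F s \<partial>circ) + (\<integral>s. cnj (g (cis s)) * G s \<partial>circ)"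
    by (intro Bochner_Integration.integral_add integrable_circ_continuous continuous_intros F G cont)
  finally show "C1_degree (\<lambda>z. f z * g z) = C1_degree f + C1_degree g"
    by (simp add: C1_degree_eq[OF H Hc] F(4) G(4) distrib_left add_divide_distrib)
qed

text \<open>For a single-valued phase the logarithmic derivative is \<open>\<i> * \<phi>'\<close>,
  whose integral over a period is 0.\<close>

lemma C1_circle_cis:
  fixes \<phi> :: "complex \<Rightarrow> real"
  assumes d: "\<And>s. ((\<lambda>s. \<phi> (cis s)) has_real_derivative \<phi>' s) (at s)" and c: "continuous_on UNIV \<phi>'"
  shows "(\<lambda>z. cis (\<phi> z)) \<in> C1_circle" "C1_degree (\<lambda>z. cis (\<phi> z)) = 0"
proof -
  let ?F = "\<lambda>s. \<i> * of_real (\<phi>' s) * cis (\<phi> (cis s))"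
  have F: "((\<lambda>s. cis (\<phi> (cis s))) has_vector_derivative ?F s) (at s)" for s
  proof -
    have "((\<lambda>t. cis (1 * t)) \<circ> (\<lambda>s. \<phi> (cis s)) has_vector_derivative \<phi>' s *\<^sub>R (\<i> * of_real 1 * cis (1 * \<phi> (cis s)))) (at s)"
      by (rule vector_diff_chain_at[OF _ has_vector_derivative_cis_linear])
         (use d[of s] in \<open>simp add: has_real_derivative_iff_has_vector_derivative\<close>)
    then show ?thesis by (simp add: o_def scaleR_conv_of_real mult_ac)
  qed
  have pc: "continuous_on UNIV (\<lambda>s. \<phi> (cis s))"
    using d by (meson continuous_at_imp_continuous_on DERIV_isCont)
  have Fc: "continuous_on UNIV ?F" by (intro continuous_intros c pc)
  show C: "(\<lambda>z. cis (\<phi> z)) \<in> C1_circle" by (rule C1_circleI[OF F Fc]) simp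
  have e: "cnj (cis t) * (\<i> * of_real r * cis t) = \<i> * of_real r" for t r
    by (simp add: cis_cnj cis_mult mult.commute mult.left_commute)
  have "(\<integral>s. \<i> * of_real (\<phi>' s) \<partial>circ) = 0"
  proof (rule integral_circ_derivative[where F="\<lambda>s. \<i> * of_real (\<phi> (cis s))"])
    have "cis (2*pi) = cis 0" by simp
    then show "\<i> * complex_of_real (\<phi> (cis (2 * pi))) = \<i> * of_real (\<phi> (cis 0))" by simp
    show "((\<lambda>s. \<i> * complex_of_real (\<phi> (cis s))) has_vector_derivative \<i> * of_real (\<phi>' s)) (at s)" for s
      by (intro has_vector_derivative_mult_right has_vector_derivative_of_real)
         (use d[of s] in \<open>simp add: has_real_derivative_iff_has_vector_derivative\<close>)
  qed (intro continuous_intros c)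
  then show "C1_degree (\<lambda>z. cis (\<phi> z)) = 0"
    unfolding C1_degree_eq[OF F Fc] e by simp
qed

lemma C1_circle_const:
  shows "(\<lambda>z. cis \<theta>) \<in> C1_circle" "C1_degree (\<lambda>z. cis \<theta>) = 0"
  by (rule C1_circle_cis[where \<phi>="\<lambda>z. \<theta>" and \<phi>'="\<lambda>_. 0"]; simp)+

text \<open>The half-plane factor \<open>(x - \<beta>) / (x - cnj \<beta>)\<close> at \<open>x = (1 - \<i> z) / (z - \<i>)\<close>, the stereographic projection of \<open>z\<close>;
  unlike \<open>stereo\<close> it is regular at \<open>z = \<i>\<close>, with the value \<open>1\<close>.\<close>

definition blaschke_factor :: "complex \<Rightarrow> complex \<Rightarrow> complex" where
  "blaschke_factor \<beta> z = ((1 + \<i> * \<beta>) - (\<i> + \<beta>) * z) / ((1 + \<i> * cnj \<beta>) - (\<i> + cnj \<beta>) * z)"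

text \<open>Both differences of squared moduli equal \<open>4 * Im \<beta>\<close>. The first
  inequality keeps the denominator of the factor away from 0 on the closed disc, the second places
  the zero inside.\<close>

lemma blaschke_factor_coeff_less:
  assumes "Im \<beta> > 0"
  shows "cmod (\<i> + cnj \<beta>) < cmod (1 + \<i> * cnj \<beta>)" "cmod (1 + \<i> * \<beta>) < cmod (\<i> + \<beta>)"
proof -
  have "(cmod (\<i> + cnj \<beta>))\<^sup>2 < (cmod (1 + \<i> * cnj \<beta>))\<^sup>2" "(cmod (1 + \<i> * \<beta>))\<^sup>2 < (cmod (\<i> + \<beta>))\<^sup>2"
    unfolding cmod_power2 using assms by (simp_all add: power2_eq_square algebra_simps)
  then show "cmod (\<i> + cnj \<beta>) < cmod (1 + \<i> * cnj \<beta>)" "cmod (1 + \<i> * \<beta>) < cmod (\<i> + \<beta>)"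
    by (auto intro: power2_less_imp_less)
qed

lemma blaschke_factor_denominator_nonzero:
  assumes "Im \<beta> > 0" "cmod z \<le> 1"
  shows "(1 + \<i> * cnj \<beta>) - (\<i> + cnj \<beta>) * z \<noteq> 0"
proof
  assume "(1 + \<i> * cnj \<beta>) - (\<i> + cnj \<beta>) * z = 0"
  then have "cmod (1 + \<i> * cnj \<beta>) = cmod (\<i> + cnj \<beta>) * cmod z" by (simp flip: norm_mult)
  also have "\<dots> \<le> cmod (\<i> + cnj \<beta>) * 1" using assms by (intro mult_left_mono) auto
  finally show False using blaschke_factor_coeff_less(1)[OF assms(1)] by simp
qed

text \<open>On the circle numerator \<open>n\<close> and denominator \<open>d\<close> satisfy
  \<open>z * cnj d = \<i> * n\<close>, so their moduli agree.\<close>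

lemma cmod_blaschke_factor:
  assumes "Im \<beta> > 0" "cmod z = 1"
  shows "cmod (blaschke_factor \<beta> z) = 1"
proof -
  let ?n = "(1 + \<i> * \<beta>) - (\<i> + \<beta>) * z" and ?d = "(1 + \<i> * cnj \<beta>) - (\<i> + cnj \<beta>) * z"
  have zz: "z * cnj z = 1" using assms by (simp add: complex_norm_square[symmetric])
  have "z * cnj ?d = z - \<i> * \<beta> * z - (- \<i> + \<beta>) * (z * cnj z)" by (simp add: algebra_simps)
  also have "\<dots> = \<i> * ?n" unfolding zz by (simp add: algebra_simps)
  finally have "cmod (z * cnj ?d) = cmod (\<i> * ?n)" by simp
  then have "cmod ?n = cmod ?d" using assms(2) by (simp add: norm_mult del: complex_cnj_diff complex_cnj_add complex_cnj_mult)
  moreover have "cmod ?d \<noteq> 0" using blaschke_factor_denominator_nonzero[of \<beta> z] assms by simp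
  ultimately show ?thesis unfolding blaschke_factor_def norm_divide by (metis divide_self)
qed

definition blaschke_factor' :: "complex \<Rightarrow> complex \<Rightarrow> complex" where
  "blaschke_factor' \<beta> z = (- (\<i> + \<beta>) * ((1 + \<i> * cnj \<beta>) - (\<i> + cnj \<beta>) * z) + ((1 + \<i> * \<beta>) - (\<i> + \<beta>) * z) * (\<i> + cnj \<beta>))
     / ((1 + \<i> * cnj \<beta>) - (\<i> + cnj \<beta>) * z)\<^sup>2"

lemma blaschke_factor_has_derivative:
  assumes "Im \<beta> > 0" "cmod z \<le> 1"
  shows "(blaschke_factor \<beta> has_field_derivative blaschke_factor' \<beta> z) (at z within S)"
  using blaschke_factor_denominator_nonzero[OF assms]
  unfolding blaschke_factor_def[abs_def] blaschke_factor'_def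
  by (auto intro!: derivative_eq_intros simp: power2_eq_square) (simp add: algebra_simps)

lemma has_vector_derivative_cis_compose:
  assumes "(F has_field_derivative F') (at (cis s))"
  shows "((\<lambda>s. F (cis s)) has_vector_derivative (\<i> * cis s * F')) (at s)"
proof -
  have "(F \<circ> cis has_vector_derivative (\<i> * cis s) * F') (at s)"
    by (rule field_vector_diff_chain_at[where f=cis and x=s, OF _ assms]) (use has_vector_derivative_cis_linear[of 1 s UNIV] in simp)
  then show ?thesis by (simp add: o_def)
qed

lemma blaschke_factor_cis_derivative:
  assumes "Im \<beta> > 0"
  shows "((\<lambda>s. blaschke_factor \<beta> (cis s)) has_vector_derivative (\<i> * cis s * blaschke_factor' \<beta> (cis s))) (at s)"
    and "continuous_on UNIV (\<lambda>s. \<i> * cis s * blaschke_factor' \<beta> (cis s))"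
proof -
  show "((\<lambda>s. blaschke_factor \<beta> (cis s)) has_vector_derivative (\<i> * cis s * blaschke_factor' \<beta> (cis s))) (at s)"
    by (rule has_vector_derivative_cis_compose[OF blaschke_factor_has_derivative]) (use assms in auto)
  show "continuous_on UNIV (\<lambda>s. \<i> * cis s * blaschke_factor' \<beta> (cis s))"
    unfolding blaschke_factor'_def by (intro continuous_intros) (use blaschke_factor_denominator_nonzero[OF assms] in auto)
qed

lemma blaschke_factor_C1: "Im \<beta> > 0 \<Longrightarrow> blaschke_factor \<beta> \<in> C1_circle"
  by (rule C1_circleI[OF blaschke_factor_cis_derivative]) (auto simp: cmod_blaschke_factor)

lemma integral_circ_contour:
  assumes "continuous_on (sphere 0 1) F" "(F has_contour_integral I) (circlepath 0 1)"
  shows "(\<integral>s. F (cis s) * (\<i> * cis s) \<partial>circ) = I"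
proof -
  have "((\<lambda>t. F (0 + 1 * cis t) * 1 * \<i> * cis t) has_integral I) {0..2*pi}"
    using assms(2) has_contour_integral_part_circlepath_iff[of 0 "2 * pi" F I 0 1] by (simp add: circlepath_def)
  moreover have "continuous_on {0..2*pi} (\<lambda>s. F (cis s) * (\<i> * cis s))"
    by (intro continuous_intros continuous_on_compose2[OF assms(1)]) auto
  ultimately show ?thesis by (simp add: integral_circ_real integral_unique mult.assoc)
qed

lemma has_contour_integral_circlepath_zero:
  assumes "\<And>z. cmod z \<le> 1 \<Longrightarrow> F field_differentiable at z"
  shows "(F has_contour_integral 0) (circlepath 0 1)"
proof (rule Cauchy_theorem_convex[where S="cball 0 1" and K="{}"])
  show "continuous_on (cball 0 1) F"
    by (intro continuous_at_imp_continuous_on ballI field_differentiable_imp_continuous_at assms) auto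
qed (use assms in auto)

text \<open>The argument principle by hand: on the circle conjugate and reciprocal of the factor
  coincide, so the integrand is its logarithmic derivative \<open>P\<close>. It consists of a simple
  pole at the zero \<open>a\<close> in the disc and a term holomorphic on the closed disc.\<close>

lemma blaschke_factor_degree:
  assumes "Im \<beta> > 0"
  shows "C1_degree (blaschke_factor \<beta>) = 1"
proof -
  define a where "a = (1 + \<i> * \<beta>) / (\<i> + \<beta>)"
  have nz: "\<i> + \<beta> \<noteq> 0" using blaschke_factor_coeff_less(2)[OF assms] by auto
  have a: "cmod a < 1" using blaschke_factor_coeff_less(2)[OF assms] by (auto simp: a_def norm_divide divide_simps)
  define P where "P z = 1 / (z - a) + (\<i> + cnj \<beta>) / ((1 + \<i> * cnj \<beta>) - (\<i> + cnj \<beta>) * z)" for z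
  have "((\<lambda>z. 1 / (z - a)) has_contour_integral (2 * complex_of_real pi * \<i> * 1)) (circlepath 0 1)"
    by (rule Cauchy_integral_circlepath_simple) (use a in auto)
  moreover have "((\<lambda>z. (\<i> + cnj \<beta>) / ((1 + \<i> * cnj \<beta>) - (\<i> + cnj \<beta>) * z)) has_contour_integral 0) (circlepath 0 1)"
    by (rule has_contour_integral_circlepath_zero)
       (intro derivative_intros field_differentiable_const; simp only: blaschke_factor_denominator_nonzero[OF assms] not_False_eq_True)
  ultimately have "(P has_contour_integral (2 * complex_of_real pi * \<i> * 1 + 0)) (circlepath 0 1)"
    unfolding P_def[abs_def] by (rule has_contour_integral_add)
  moreover have "continuous_on (sphere 0 1) P"
    unfolding P_def[abs_def] by (intro continuous_intros) (use a blaschke_factor_denominator_nonzero[OF assms] in auto)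
  ultimately have P: "(\<integral>s. P (cis s) * (\<i> * cis s) \<partial>circ) = 2 * complex_of_real pi * \<i>"
    using integral_circ_contour by simp
  have "cnj (blaschke_factor \<beta> (cis s)) * (\<i> * cis s * blaschke_factor' \<beta> (cis s)) = P (cis s) * (\<i> * cis s)" for s
  proof -
    define z n d where "z = cis s" "n = (1 + \<i> * \<beta>) - (\<i> + \<beta>) * z" "d = (1 + \<i> * cnj \<beta>) - (\<i> + cnj \<beta>) * z"
    have d: "d \<noteq> 0" unfolding z_n_d_def by (rule blaschke_factor_denominator_nonzero) (use assms in auto)
    have m1: "cmod (blaschke_factor \<beta> z) = 1" using assms by (simp add: cmod_blaschke_factor z_n_d_def)
    then have n: "n \<noteq> 0" by (auto simp: blaschke_factor_def z_n_d_def)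
    have "blaschke_factor \<beta> z * d = n" using d by (simp add: blaschke_factor_def z_n_d_def(2,3)[symmetric])
    then have "cnj (blaschke_factor \<beta> z) * n = d" using cnj_mult_self_unit[OF m1] by (metis mult.assoc mult_1_left)
    then have c: "cnj (blaschke_factor \<beta> z) = d / n" using n by (metis nonzero_mult_div_cancel_right)
    have "n = - (\<i> + \<beta>) * (z - a)" using nz by (simp add: a_def z_n_d_def(2) field_simps)
    then have "1 / (z - a) = - (\<i> + \<beta>) / n" using nz n by auto
    then have "P z = - (\<i> + \<beta>) / n + (\<i> + cnj \<beta>) / d" by (simp add: P_def z_n_d_def(3))
    also have "\<dots> = d / n * blaschke_factor' \<beta> z"
      using n d unfolding blaschke_factor'_def z_n_d_def(2,3)[symmetric] by (simp add: divide_simps power2_eq_square)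
    finally show ?thesis unfolding z_n_d_def(1)[symmetric] c by (simp add: mult_ac)
  qed
  then show ?thesis by (simp only: C1_degree_eq[OF blaschke_factor_cis_derivative[OF assms]] P) simp
qed

definition blaschke_circle :: "real \<Rightarrow> (nat \<Rightarrow> complex) \<Rightarrow> nat \<Rightarrow> complex \<Rightarrow> complex" where
  "blaschke_circle \<theta> \<beta> k z = cis \<theta> * (\<Prod>j=1..k. blaschke_factor (\<beta> j) z)"

lemma blaschke_circle_C1_degree:
  assumes "\<forall>j\<in>{1..k}. Im (\<beta> j) > 0"
  shows "blaschke_circle \<theta> \<beta> k \<in> C1_circle \<and> C1_degree (blaschke_circle \<theta> \<beta> k) = of_nat k"
  using assms
proof (induction k)
  case 0
  then show ?case using C1_circle_const[of \<theta>] by (simp add: blaschke_circle_def[abs_def])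
next
  case (Suc k)
  have e: "blaschke_circle \<theta> \<beta> (Suc k) = (\<lambda>z. blaschke_circle \<theta> \<beta> k z * blaschke_factor (\<beta> (Suc k)) z)"
    by (rule ext) (simp add: blaschke_circle_def prod.atLeast1_atMost_eq mult.assoc)
  have k: "blaschke_circle \<theta> \<beta> k \<in> C1_circle" "C1_degree (blaschke_circle \<theta> \<beta> k) = of_nat k" using Suc by auto
  have b: "Im (\<beta> (Suc k)) > 0" using Suc.prems by auto
  show ?case unfolding e using C1_circle_mult[OF k(1) blaschke_factor_C1[OF b]] k(2) blaschke_factor_degree[OF b] by simp
qed

lemma blaschke_circle_field_differentiable:
  assumes "\<forall>j\<in>{1..k}. Im (\<beta> j) > 0" "cmod z \<le> 1"
  shows "blaschke_circle \<theta> \<beta> k field_differentiable at z"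
  using assms(1)
proof (induction k)
  case 0
  then show ?case by (simp add: blaschke_circle_def[abs_def])
next
  case (Suc k)
  have e: "blaschke_circle \<theta> \<beta> (Suc k) = (\<lambda>z. blaschke_circle \<theta> \<beta> k z * blaschke_factor (\<beta> (Suc k)) z)"
    by (rule ext) (simp add: blaschke_circle_def prod.atLeast1_atMost_eq mult.assoc)
  have "blaschke_factor (\<beta> (Suc k)) field_differentiable at z"
    using blaschke_factor_has_derivative[OF _ assms(2)] Suc.prems by (force simp: field_differentiable_def)
  then show ?case unfolding e using Suc by (intro field_differentiable_mult) auto
qed

lemma fc_blaschke_circle_negative:
  assumes "\<forall>j\<in>{1..k}. Im (\<beta> j) > 0" "n > 0"
  shows "fc (blaschke_circle \<theta> \<beta> k) (- int n) = 0"
proof -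
  \<comment> \<open>The factor \<open>\<i> * cis s\<close> from \<open>dz\<close> supplies the
    missing power of \<open>z\<close>, and \<open>n > 0\<close> makes the subtraction exact;
    Cauchy's theorem then gives 0.\<close>
  let ?F = "\<lambda>z. blaschke_circle \<theta> \<beta> k z * z ^ (n - 1)"
  have fd: "?F field_differentiable at z" if "cmod z \<le> 1" for z
    using blaschke_circle_field_differentiable[OF assms(1) that] by (intro field_differentiable_mult field_differentiable_power) auto
  have "continuous_on (sphere 0 1) ?F"
    by (intro continuous_at_imp_continuous_on ballI field_differentiable_imp_continuous_at fd) auto
  then have "(\<integral>s. ?F (cis s) * (\<i> * cis s) \<partial>circ) = 0"
    using integral_circ_contour has_contour_integral_circlepath_zero[of ?F] fd by blast
  also have "(\<lambda>s. ?F (cis s) * (\<i> * cis s)) = (\<lambda>s. \<i> * (blaschke_circle \<theta> \<beta> k (cis s) * cis (- (of_int (- int n) * s))))"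
  proof
    fix s
    have "cis s ^ (n - 1) * cis s = cis (- (of_int (- int n) * s))"
      using power_minus_mult[OF assms(2), of "cis s"] by (simp add: Complex.DeMoivre)
    then show "?F (cis s) * (\<i> * cis s) = \<i> * (blaschke_circle \<theta> \<beta> k (cis s) * cis (- (of_int (- int n) * s)))"
      by (metis mult.assoc mult.left_commute)
  qed
  finally show ?thesis by (simp add: fc_def)
qed

text \<open>Without negative frequencies \<open>freq\<close> and \<open>sfreq\<close> coincide, so
  the seminorm is the degree times \<open>4 * pi\<^sup>2\<close>.\<close>

lemma gagliardo_analytic:
  assumes f: "f \<in> C1_circle" and neg: "\<And>n. n > 0 \<Longrightarrow> fc f (- int n) = 0"
  shows "of_real (enn2real (gagliardo_circle f)) = 4 * pi\<^sup>2 * C1_degree f"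
proof -
  have h: "f \<in> hhalf_circle" using f C1_circle_subset_hhalf by blast
  have "freq f = sfreq f"
  proof
    fix n show "freq f n = sfreq f n" using neg[of n] by (cases "n = 0") (auto simp: freq_def sfreq_def)
  qed
  then have "fourier_degree f = enn2real (gagliardo_circle f) / (4 * pi\<^sup>2)"
    using hhalf_circle_freq_sums[OF h] by (simp add: fourier_degree_def sums_iff)
  then show ?thesis by (simp add: fourier_degree_C1[OF f])
qed

lemma gagliardo_blaschke_circle:
  assumes "\<forall>j\<in>{1..k}. Im (\<beta> j) > 0"
  shows "gagliardo_circle (blaschke_circle \<theta> \<beta> k) = ennreal (4 * pi\<^sup>2 * real k)"
proof -
  have c: "blaschke_circle \<theta> \<beta> k \<in> C1_circle" "C1_degree (blaschke_circle \<theta> \<beta> k) = of_nat k" using blaschke_circle_C1_degree[OF assms] by auto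
  have "complex_of_real (enn2real (gagliardo_circle (blaschke_circle \<theta> \<beta> k))) = complex_of_real (4 * pi\<^sup>2 * real k)"
    using gagliardo_analytic[OF c(1) fc_blaschke_circle_negative[OF assms]] c(2) by simp
  then have "enn2real (gagliardo_circle (blaschke_circle \<theta> \<beta> k)) = 4 * pi\<^sup>2 * real k" by (simp only: of_real_eq_iff)
  moreover have "gagliardo_circle (blaschke_circle \<theta> \<beta> k) < \<infinity>"
    using hhalf_circleD(3) c(1) C1_circle_subset_hhalf by blast
  ultimately show ?thesis by (metis ennreal_enn2real infinity_ennreal_def)
qed

section \<open>Bubbles supported in the interval\<close>

text \<open>On the circle \<open>(1 - \<i> * z) / (z - \<i>)\<close> is the real number
  \<open>sline s\<close>; the factors \<open>z - \<i>\<close> of numerator and denominator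
  cancel.\<close>

lemma blaschke_factor_line:
  assumes "sin s \<noteq> 1"
  shows "blaschke_factor \<beta> (cis s) = (of_real (sline s) - \<beta>) / (of_real (sline s) - cnj \<beta>)"
proof -
  define z where "z = cis s"
  have S: "1 - sin s \<noteq> 0" using assms by simp
  have zi: "z - \<i> \<noteq> 0" using assms by (auto simp: z_def complex_eq_iff)
  have "(1 - \<i> * z) * of_real (1 - sin s) = of_real (cos s) * (z - \<i>)"
    using sin_cos_squared_add[of s] by (auto simp: z_def complex_eq_iff power2_eq_square algebra_simps)
  then have "(1 - \<i> * z) / (z - \<i>) = of_real (cos s) / of_real (1 - sin s)"
    using zi S by (simp add: frac_eq_eq del: of_real_diff)
  then have x: "of_real (sline s) = (1 - \<i> * z) / (z - \<i>)"
    by (simp add: sline_eq)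
  have "of_real (sline s) - b = ((1 + \<i> * b) - (\<i> + b) * z) / (z - \<i>)" for b
    unfolding x using zi by (simp add: field_simps)
  then show ?thesis using zi by (simp add: blaschke_factor_def z_def)
qed

lemma sin_arctan_neq_1: "sin (2 * arctan x - pi / 2) \<noteq> 1"
  using one_minus_sin_pos[of "2 * arctan x - pi / 2"] arctan_bounded[of x] by auto

lemma lift_blaschke_circle:
  "lift (blaschke_circle \<theta> \<beta> k) x = cis \<theta> * (\<Prod>j=1..k. (of_real x - \<beta> j) / (of_real x - cnj (\<beta> j)))"
  unfolding lift_def blaschke_circle_def blaschke_factor_line[OF sin_arctan_neq_1] sline_arctan ..

section \<open>The phase correction inside the interval\<close>

lemma has_derivative_min_sq:
  "((\<lambda>y::real. (min y 0)\<^sup>2) has_real_derivative 2 * min x 0) (at x)"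
proof -
  consider "x < 0" | "x > 0" | "x = 0" by linarith
  then show ?thesis
  proof cases
    case 1
    have "((\<lambda>y::real. y\<^sup>2) has_real_derivative 2 * x) (at x)" by (auto intro!: derivative_eq_intros)
    then have "((\<lambda>y::real. (min y 0)\<^sup>2) has_real_derivative 2 * x) (at x)"
      by (rule has_field_derivative_transform_within_open[of _ _ _ "{..<0}"]) (use 1 in auto)
    then show ?thesis using 1 by simp
  next
    case 2
    have "((\<lambda>y::real. 0) has_real_derivative 0) (at x)" by simp
    then have "((\<lambda>y::real. (min y 0)\<^sup>2) has_real_derivative 0) (at x)"
      by (rule has_field_derivative_transform_within_open[of _ _ _ "{0<..}"]) (use 2 in auto)
    then show ?thesis using 2 by simp
  next
    case 3
    \<comment> \<open>The square makes the cut-off differentiable at 0: the difference quotient is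
      at most \<open>|h|\<close> in size.\<close>
    have "((\<lambda>h::real. (min h 0)\<^sup>2 / h) \<longlongrightarrow> 0) (at 0)"
    proof (rule Lim_null_comparison)
      show "\<forall>\<^sub>F h::real in at 0. norm ((min h 0)\<^sup>2 / h) \<le> \<bar>h\<bar>"
        by (auto simp: min_def power2_eq_square intro!: always_eventually)
      show "((\<lambda>h::real. \<bar>h\<bar>) \<longlongrightarrow> 0) (at 0)"
        using tendsto_rabs_zero[OF tendsto_ident_at[of "0::real" UNIV]] by simp
    qed
    then show ?thesis using 3 by (simp add: DERIV_def)
  qed
qed

text \<open>A \<open>C\<^sup>1\<close> extension of \<open>1 / x\<close> from \<open>\<bar>x\<bar> \<ge> 1\<close> (i.e.\ \<open>Im z \<ge> 0\<close>, where \<open>1 / x = Re z / (1 + Im z)\<close>)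
  to the whole circle.\<close>

definition recip :: "complex \<Rightarrow> real" where
  "recip z = Re z / (1 + Im z + (min (Im z) 0)\<^sup>2)"

text \<open>\<open>1 + Im z\<close> alone vanishes at \<open>z = - \<i>\<close>, the point over
  \<open>x = 0\<close>. The square, active only for \<open>Im z < 0\<close>, removes this zero,
  since \<open>1 + y + y\<^sup>2 = (1 + y / 2)\<^sup>2 + 3 / 4 * y\<^sup>2\<close>.\<close>

lemma recip_denominator_pos: "0 < 1 + y + (min y 0)\<^sup>2" for y :: real
proof (cases "y \<ge> 0")
  case False
  have "0 < (1 + y / 2)\<^sup>2 + 3 / 4 * y\<^sup>2" using False by (intro add_nonneg_pos) auto
  then show ?thesis using False by (simp add: power2_eq_square algebra_simps)
qed simp

definition recip' :: "real \<Rightarrow> real" where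
  "recip' s = (- sin s * (1 + sin s + (min (sin s) 0)\<^sup>2) - cos s * (cos s + 2 * min (sin s) 0 * cos s))
     / (1 + sin s + (min (sin s) 0)\<^sup>2)\<^sup>2"

lemma recip_derivative: "((\<lambda>s. recip (cis s)) has_real_derivative recip' s) (at s)"
proof -
  have "((\<lambda>s. (min (sin s) 0)\<^sup>2) has_real_derivative 2 * min (sin s) 0 * cos s) (at s)"
    by (rule DERIV_chain2[OF has_derivative_min_sq]) (auto intro!: derivative_eq_intros)
  then have "((\<lambda>s. (1 + sin s) + (min (sin s) 0)\<^sup>2) has_real_derivative cos s + 2 * min (sin s) 0 * cos s) (at s)"
    by (rule DERIV_add[rotated]) (auto intro!: derivative_eq_intros)
  from DERIV_divide[OF DERIV_cos this]
  have "((\<lambda>s. cos s / (1 + sin s + (min (sin s) 0)\<^sup>2)) has_real_derivative recip' s) (at s)"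
    using recip_denominator_pos[of "sin s"] unfolding recip'_def power2_eq_square[of "1 + sin s + _"] by simp
  then show ?thesis by (simp add: recip_def)
qed

lemma recip'_continuous: "continuous_on UNIV recip'"
  unfolding recip'_def[abs_def] by (intro continuous_intros) (use recip_denominator_pos in \<open>auto simp: less_imp_neq[symmetric]\<close>)

lemma cmod_cis_diff_le: "cmod (cis a - cis b) \<le> \<bar>a - b\<bar>"
proof -
  have "cmod (cis a - cis b) \<le> 1 * norm (a - b)"
  proof (rule differentiable_bound[of UNIV])
    show "(cis has_derivative (\<lambda>h. h *\<^sub>R (\<i> * cis x))) (at x within UNIV)" for x
      using has_vector_derivative_cis_linear[of 1 x UNIV] by (simp add: has_vector_derivative_def)
    show "onorm (\<lambda>h. h *\<^sub>R (\<i> * cis x)) \<le> 1" for x :: real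
      by (rule onorm_le) (simp add: norm_mult)
  qed auto
  then show ?thesis by simp
qed

lemma abs_arctan_diff_le: "\<bar>arctan a - arctan b\<bar> \<le> \<bar>a - b\<bar>"
proof -
  have "norm (arctan a - arctan b) \<le> 1 * norm (a - b)"
  proof (rule field_differentiable_bound[of UNIV])
    show "(arctan has_field_derivative inverse (1 + x\<^sup>2)) (at x within UNIV)" for x
      using DERIV_arctan by simp
    show "norm (inverse (1 + x\<^sup>2)) \<le> 1" for x :: real
      by (simp add: inverse_le_1_iff)
  qed auto
  then show ?thesis by simp
qed

text \<open>As both maps are unimodular, the increment of the product is at most the sum of the
  increments. Young's inequality then keeps a weight close to 1 on the main factor and puts the
  large weight on the small one.\<close>

lemma gagliardo_circle_mult:
  assumes f: "f \<in> C1_circle" and g: "g \<in> C1_circle" and \<epsilon>: "0 < \<epsilon>"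
  shows "gagliardo_circle (\<lambda>z. f z * g z) \<le>
    ennreal (1 + \<epsilon>) * gagliardo_circle f + ennreal (1 + 1 / \<epsilon>) * gagliardo_circle g"
proof -
  have f': "f \<in> hhalf_circle" and g': "g \<in> hhalf_circle" using f g C1_circle_subset_hhalf by blast+
  note m [measurable] = hhalf_circleD(1)[OF f'] hhalf_circleD(1)[OF g']
  have fm [measurable]: "(\<lambda>s. f (cis s) * g (cis s)) \<in> borel_measurable circ" by measurable
  have n: "cmod (f (cis s)) = 1" "cmod (g (cis s)) = 1" for s
    using f g by (auto simp: C1_circle_def)
  let ?q = "\<lambda>h p. (cmod (h (cis (fst p)) - h (cis (snd p))))\<^sup>2 / (cmod (cis (fst p) - cis (snd p)))\<^sup>2"
  have le: "ennreal (?q (\<lambda>z. f z * g z) p) \<le> ennreal (1 + \<epsilon>) * ennreal (?q f p) + ennreal (1 + 1 / \<epsilon>) * ennreal (?q g p)" for p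
  proof -
    define x y where "x = cmod (f (cis (fst p)) - f (cis (snd p)))" "y = cmod (g (cis (fst p)) - g (cis (snd p)))"
    define D where "D = (cmod (cis (fst p) - cis (snd p)))\<^sup>2"
    have "f (cis (fst p)) * g (cis (fst p)) - f (cis (snd p)) * g (cis (snd p)) =
      (f (cis (fst p)) - f (cis (snd p))) * g (cis (fst p)) + f (cis (snd p)) * (g (cis (fst p)) - g (cis (snd p)))"
      by (simp add: algebra_simps)
    then have "cmod (f (cis (fst p)) * g (cis (fst p)) - f (cis (snd p)) * g (cis (snd p))) \<le> x + y"
      using norm_triangle_ineq[of "(f (cis (fst p)) - f (cis (snd p))) * g (cis (fst p))" "f (cis (snd p)) * (g (cis (fst p)) - g (cis (snd p)))"]
      by (simp add: norm_mult n x_y_def)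
    then have "(cmod (f (cis (fst p)) * g (cis (fst p)) - f (cis (snd p)) * g (cis (snd p))))\<^sup>2 \<le> (x + y)\<^sup>2"
      by (intro power_mono) auto
    also have "(x + y)\<^sup>2 \<le> (1 + \<epsilon>) * x\<^sup>2 + (1 + 1 / \<epsilon>) * y\<^sup>2"
    proof -
      have "0 \<le> (\<epsilon> * x - y)\<^sup>2 / \<epsilon>" using \<epsilon> by simp
      then show ?thesis using \<epsilon> by (simp add: power2_eq_square field_simps)
    qed
    finally have "?q (\<lambda>z. f z * g z) p \<le> ((1 + \<epsilon>) * x\<^sup>2 + (1 + 1 / \<epsilon>) * y\<^sup>2) / D"
      unfolding D_def by (intro divide_right_mono) auto
    also have "\<dots> = (1 + \<epsilon>) * ?q f p + (1 + 1 / \<epsilon>) * ?q g p" by (simp add: x_y_def D_def add_divide_distrib)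
    finally have "ennreal (?q (\<lambda>z. f z * g z) p) \<le> ennreal ((1 + \<epsilon>) * ?q f p + (1 + 1 / \<epsilon>) * ?q g p)"
      by (rule ennreal_leI)
    also have "\<dots> = ennreal (1 + \<epsilon>) * ennreal (?q f p) + ennreal (1 + 1 / \<epsilon>) * ennreal (?q g p)"
    proof -
      have e: "ennreal (a * x + b * y) = ennreal a * ennreal x + ennreal b * ennreal y"
        if "0 \<le> a" "0 \<le> x" "0 \<le> b" "0 \<le> y" for a b x y
        using that by (simp add: ennreal_mult')
      show ?thesis using \<epsilon> by (intro e) auto
    qed
    finally show ?thesis .
  qed
  have "gagliardo_circle (\<lambda>z. f z * g z) \<le> (\<integral>\<^sup>+p. ennreal (1 + \<epsilon>) * ennreal (?q f p) + ennreal (1 + 1 / \<epsilon>) * ennreal (?q g p) \<partial>(circ \<Otimes>\<^sub>M circ))"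
    unfolding gagliardo_circle_circ2[of "\<lambda>z. f z * g z", OF fm] by (intro nn_integral_mono le)
  also have "\<dots> = (\<integral>\<^sup>+p. ennreal (1 + \<epsilon>) * ennreal (?q f p) \<partial>(circ \<Otimes>\<^sub>M circ)) + (\<integral>\<^sup>+p. ennreal (1 + 1 / \<epsilon>) * ennreal (?q g p) \<partial>(circ \<Otimes>\<^sub>M circ))"
    by (rule nn_integral_add) measurable
  also have "(\<integral>\<^sup>+p. ennreal (1 + \<epsilon>) * ennreal (?q f p) \<partial>(circ \<Otimes>\<^sub>M circ)) = ennreal (1 + \<epsilon>) * gagliardo_circle f"
    unfolding gagliardo_circle_circ2[of f, OF m(1)] by (rule nn_integral_cmult) measurable
  also have "(\<integral>\<^sup>+p. ennreal (1 + 1 / \<epsilon>) * ennreal (?q g p) \<partial>(circ \<Otimes>\<^sub>M circ)) = ennreal (1 + 1 / \<epsilon>) * gagliardo_circle g"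
    unfolding gagliardo_circle_circ2[of g, OF m(2)] by (rule nn_integral_cmult) measurable
  finally show ?thesis .
qed

text \<open>Where \<open>recip\<close> is \<open>1 / x\<close>, this is the reciprocal of the
  \<open>m\<close>-th power of the factor with zero at \<open>\<i> * \<epsilon>\<close>. The
  arctangent gives a phase that is single-valued on the circle, hence degree 0, and with a Lipschitz
  bound proportional to \<open>\<epsilon>\<close>.\<close>

definition phase_corr :: "nat \<Rightarrow> real \<Rightarrow> complex \<Rightarrow> complex" where
  "phase_corr m \<epsilon> z = cis (2 * real m * arctan (\<epsilon> * recip z))"

lemma phase_corr_C1: "phase_corr m \<epsilon> \<in> C1_circle" "C1_degree (phase_corr m \<epsilon>) = 0"
proof -
  let ?d = "\<lambda>s. 2 * real m * (\<epsilon> * recip' s / (1 + (\<epsilon> * recip (cis s))\<^sup>2))"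
  have d: "((\<lambda>s. 2 * real m * arctan (\<epsilon> * recip (cis s))) has_real_derivative ?d s) (at s)" for s
    by (auto intro!: derivative_eq_intros recip_derivative simp: inverse_eq_divide)
  have rc: "continuous_on UNIV (\<lambda>s. recip (cis s))"
    using recip_derivative by (meson continuous_at_imp_continuous_on DERIV_isCont)
  have nz: "1 + (\<epsilon> * recip (cis s))\<^sup>2 \<noteq> 0" for s by (metis add_pos_nonneg less_numeral_extra(3) zero_le_power2 zero_less_one)
  have c: "continuous_on UNIV ?d"
    by (intro continuous_intros rc recip'_continuous ballI nz)
  show "phase_corr m \<epsilon> \<in> C1_circle" "C1_degree (phase_corr m \<epsilon>) = 0"
    using C1_circle_cis[of "\<lambda>z. 2 * real m * arctan (\<epsilon> * recip z)", OF d c] by (simp_all add: phase_corr_def[abs_def])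
qed

text \<open>The phase has Lipschitz constant \<open>2 * real m * \<bar>\<epsilon>\<bar> * L\<close>,
  with \<open>L\<close> that of \<open>recip\<close>; squaring gives the quadratic decay with
  \<open>C\<close> independent of \<open>m\<close> and \<open>\<epsilon>\<close>.\<close>

lemma gagliardo_corr:
  obtains C where "0 \<le> C" "\<And>m \<epsilon>. gagliardo_circle (phase_corr m \<epsilon>) \<le> ennreal (C * (real m)\<^sup>2 * \<epsilon>\<^sup>2)"
proof -
  have rd: "\<And>s. ((\<lambda>s. recip (cis s)) has_vector_derivative recip' s) (at s)"
    using recip_derivative by (simp add: has_real_derivative_iff_has_vector_derivative)
  obtain L where L: "0 \<le> L" "\<And>s t. norm (recip (cis s) - recip (cis t)) \<le> L * cmod (cis s - cis t)"
    using cis_C1_lipschitz[OF rd recip'_continuous] by blast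
  have "gagliardo_circle (phase_corr m \<epsilon>) \<le> ennreal ((16 * pi\<^sup>2 * L\<^sup>2) * (real m)\<^sup>2 * \<epsilon>\<^sup>2)" for m \<epsilon>
  proof -
    have "gagliardo_circle (phase_corr m \<epsilon>) \<le> ennreal ((2 * real m * \<bar>\<epsilon>\<bar> * L)\<^sup>2 * (2 * pi)\<^sup>2)"
    proof (rule gagliardo_circle_lipschitz)
      show "(\<lambda>s. phase_corr m \<epsilon> (cis s)) \<in> borel_measurable circ"
        using phase_corr_C1 C1_circle_subset_hhalf by (blast intro: hhalf_circleD(1))
      fix s t
      have "cmod (phase_corr m \<epsilon> (cis s) - phase_corr m \<epsilon> (cis t)) \<le> \<bar>2 * real m * arctan (\<epsilon> * recip (cis s)) - 2 * real m * arctan (\<epsilon> * recip (cis t))\<bar>"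
        unfolding phase_corr_def by (rule cmod_cis_diff_le)
      also have "\<dots> = 2 * real m * \<bar>arctan (\<epsilon> * recip (cis s)) - arctan (\<epsilon> * recip (cis t))\<bar>"
        by (simp add: abs_mult flip: right_diff_distrib)
      also have "\<dots> \<le> 2 * real m * \<bar>\<epsilon> * recip (cis s) - \<epsilon> * recip (cis t)\<bar>"
        by (intro mult_left_mono abs_arctan_diff_le) auto
      also have "\<dots> = 2 * real m * \<bar>\<epsilon>\<bar> * norm (recip (cis s) - recip (cis t))"
        by (simp add: abs_mult flip: right_diff_distrib)
      also have "\<dots> \<le> 2 * real m * \<bar>\<epsilon>\<bar> * (L * cmod (cis s - cis t))"
        by (intro mult_left_mono L) auto
      finally show "cmod (phase_corr m \<epsilon> (cis s) - phase_corr m \<epsilon> (cis t)) \<le> 2 * real m * \<bar>\<epsilon>\<bar> * L * cmod (cis s - cis t)" by simp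
    qed (use L in simp)
    then show ?thesis by (simp add: power_mult_distrib mult_ac)
  qed
  then show ?thesis using that[of "16 * pi\<^sup>2 * L\<^sup>2"] by simp
qed

section \<open>The minimisation problem\<close>

lemma energy_eq:
  assumes "u \<in> hhalf_line"
  shows "energy u = ennreal (enn2real (gagliardo_circle (u \<circ> stereo)) / (2 * pi))"
proof -
  have m: "u \<in> borel_measurable borel" using assms by (simp add: hhalf_line_def)
  have fin: "gagliardo_circle (u \<circ> stereo) < \<infinity>" using hhalf_circleD(3)[OF hhalf_line_imp_circle[OF assms]] .
  have "energy u = ennreal (1 / (2 * pi)) * ennreal (enn2real (gagliardo_circle (u \<circ> stereo)))"
    using fin by (simp add: energy_def gagliardo_line_circle[OF m])
  also have "\<dots> = ennreal (1 / (2 * pi) * enn2real (gagliardo_circle (u \<circ> stereo)))"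
    by (rule ennreal_mult[symmetric]) auto
  finally show ?thesis by simp
qed

text \<open>The degree condition holds for all extensions; here it is specialised to the Fourier
  series.\<close>

lemma admissibleD:
  assumes "u \<in> admissible g d"
  shows "u \<in> hhalf_line" "fourier_degree (u \<circ> stereo) = of_int d"
proof -
  show "u \<in> hhalf_line" using assms by (simp add: admissible_def)
  have "complex_of_real (fourier_degree (u \<circ> stereo)) = of_int d"
    using assms degree_extension_fourier_degree by (simp add: admissible_def line_has_degree_def circle_has_degree_def)
  then show "fourier_degree (u \<circ> stereo) = of_int d" by (metis of_real_eq_iff of_real_of_int_eq)
qed

text \<open>The constant is \<open>4 pi\<^sup>2 / (2 pi)\<close>: the Fourier factor of the seminorm
  over the normalisation of the energy.\<close>

lemma energy_lower_bound:
  assumes "u \<in> admissible g d"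
  shows "ennreal (2 * pi * \<bar>d\<bar>) \<le> energy u"
proof -
  note u = admissibleD[OF assms]
  have "\<bar>real_of_int d\<bar> \<le> enn2real (gagliardo_circle (u \<circ> stereo)) / (4 * pi\<^sup>2)"
    using fourier_degree_bound[OF hhalf_line_imp_circle[OF u(1)]] u(2) by simp
  then have "2 * pi * \<bar>real_of_int d\<bar> \<le> enn2real (gagliardo_circle (u \<circ> stereo)) / (2 * pi)"
    by (simp add: field_simps power2_eq_square)
  then show ?thesis unfolding energy_eq[OF u(1)] by (intro ennreal_leI) simp
qed

lemma lift_admissible:
  assumes "G \<in> C1_circle" "C1_degree G = of_int d" "\<And>x. x \<notin> {-1<..<1} \<Longrightarrow> lift G x = g x"
  shows "lift G \<in> admissible g d"
  using lift_C1[OF assms(1)] assms(2,3)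
  by (simp add: admissible_def line_has_degree_def circle_has_degree_def)

lemma energy_lift: "G \<in> C1_circle \<Longrightarrow> energy (lift G) = ennreal (1 / (2 * pi)) * gagliardo_circle G"
  by (simp add: energy_def lift_C1)

lemma energy_lift_blaschke_circle:
  assumes "\<forall>j\<in>{1..k}. Im (\<beta> j) > 0"
  shows "energy (lift (blaschke_circle \<theta> \<beta> k)) = ennreal (2 * pi * real k)"
proof -
  have "energy (lift (blaschke_circle \<theta> \<beta> k)) = ennreal (1 / (2 * pi)) * ennreal (4 * pi\<^sup>2 * real k)"
    using blaschke_circle_C1_degree[OF assms] by (simp add: energy_lift gagliardo_blaschke_circle[OF assms])
  also have "\<dots> = ennreal (1 / (2 * pi) * (4 * pi\<^sup>2 * real k))"
    by (rule ennreal_mult[symmetric]) auto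
  finally show ?thesis by (simp add: power2_eq_square)
qed

lemma sline_square:
  assumes "sin s \<noteq> 1"
  shows "(sline s)\<^sup>2 = (1 + sin s) / (1 - sin s)"
proof -
  have "(cos s)\<^sup>2 = (1 + sin s) * (1 - sin s)" using sin_cos_squared_add[of s] by (simp add: algebra_simps power2_eq_square)
  then show ?thesis using assms by (simp add: sline_eq power_divide power2_eq_square)
qed

text \<open>By \<open>sline_square\<close>, \<open>\<bar>sline s\<bar> \<ge> 1\<close> amounts to
  \<open>1 + sin s \<ge> 1 - sin s\<close>. The exterior of \<open>I\<close> thus becomes the upper
  arc, where \<open>recip\<close> is \<open>1 / x\<close> and from which unique continuation
  starts.\<close>

lemma sline_outside_iff:
  assumes "sin s \<noteq> 1"
  shows "sline s \<notin> {-1<..<1} \<longleftrightarrow> sin s \<ge> 0"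
proof -
  have p: "0 < 1 - sin s" by (rule one_minus_sin_pos'[OF assms])
  have "sline s \<notin> {-1<..<1} \<longleftrightarrow> \<not> \<bar>sline s\<bar> < 1" by (auto simp: abs_less_iff)
  also have "\<dots> \<longleftrightarrow> 1 \<le> (sline s)\<^sup>2" by (simp add: abs_square_less_1[symmetric] not_less)
  also have "\<dots> \<longleftrightarrow> sin s \<ge> 0" using p by (simp add: sline_square[OF assms] le_divide_eq)
  finally show ?thesis .
qed

text \<open>The Cayley transform \<open>(1 + \<i> t) / (1 - \<i> t)\<close>, cleared of its
  denominator.\<close>

lemma cis_two_arctan: "(1 - \<i> * of_real t) * cis (2 * arctan t) = 1 + \<i> * of_real t"
proof -
  have n: "sqrt (1 + t\<^sup>2) \<noteq> 0" "(sqrt (1 + t\<^sup>2))\<^sup>2 = 1 + t\<^sup>2" by (auto simp: add_nonneg_eq_0_iff)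
  have "cis (arctan t) = (1 + \<i> * of_real t) / of_real (sqrt (1 + t\<^sup>2))"
    by (simp add: complex_eq_iff cos_arctan sin_arctan Re_divide_of_real Im_divide_of_real)
  then have "cis (2 * arctan t) = ((1 + \<i> * of_real t) / of_real (sqrt (1 + t\<^sup>2)))\<^sup>2"
    by (metis Complex.DeMoivre of_nat_numeral)
  also have "\<dots> = (1 + \<i> * of_real t)\<^sup>2 / of_real (1 + t\<^sup>2)"
    unfolding power_divide by (metis n(2) of_real_power)
  finally have c: "cis (2 * arctan t) = (1 + \<i> * of_real t)\<^sup>2 / of_real (1 + t\<^sup>2)" .
  have p: "(1 - \<i> * of_real t) * (1 + \<i> * of_real t) = of_real (1 + t\<^sup>2)"
    by (simp add: algebra_simps power2_eq_square)
  have "of_real (1 + t\<^sup>2) \<noteq> (0::complex)" unfolding of_real_eq_0_iff by (metis n(1) real_sqrt_zero)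
  then have "(1 - \<i> * of_real t) * (1 + \<i> * of_real t) * (1 + \<i> * of_real t) / of_real (1 + t\<^sup>2) = 1 + \<i> * of_real t"
    unfolding p by simp
  then show ?thesis unfolding c by (simp only: power2_eq_square mult.assoc times_divide_eq_right)
qed

text \<open>Off \<open>I\<close> the correction cancels a bubble with zero at \<open>i\<epsilon>\<close>, since \<open>(x - i\<epsilon>) / (x + i\<epsilon>) = cis (-2 arctan (\<epsilon> / x))\<close>.\<close>

lemma blaschke_factor_corr:
  assumes "sin s \<ge> 0" "sin s \<noteq> 1" "0 < \<epsilon>"
  shows "blaschke_factor (\<i> * of_real \<epsilon>) (cis s) ^ m * phase_corr m \<epsilon> (cis s) = 1"
proof -
  define x where "x = sline s"
  have "x * (cos s / (1 + sin s)) = (cos s)\<^sup>2 / ((1 - sin s) * (1 + sin s))"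
    by (simp add: x_def sline_eq power2_eq_square)
  also have "(cos s)\<^sup>2 = (1 - sin s) * (1 + sin s)" using sin_cos_squared_add[of s] by (simp add: algebra_simps power2_eq_square)
  also have "(1 - sin s) * (1 + sin s) / ((1 - sin s) * (1 + sin s)) = 1" using assms by simp
  finally have "x * (cos s / (1 + sin s)) = 1" .
  moreover have "recip (cis s) = cos s / (1 + sin s)" using assms by (simp add: recip_def)
  ultimately have xr: "x * recip (cis s) = 1" by (simp only:)
  define t where "t = \<epsilon> * recip (cis s)"
  have x: "x \<noteq> 0" "of_real \<epsilon> = complex_of_real x * of_real t"
  proof -
    show "x \<noteq> 0" using xr by auto
    have "\<epsilon> = x * t" using xr by (simp add: t_def mult.left_commute)
    then show "of_real \<epsilon> = complex_of_real x * of_real t" by simp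
  qed
  have "blaschke_factor (\<i> * of_real \<epsilon>) (cis s) = (of_real x - \<i> * of_real \<epsilon>) / (of_real x + \<i> * of_real \<epsilon>)"
    using blaschke_factor_line[OF assms(2), of "\<i> * of_real \<epsilon>"] by (simp add: x_def)
  also have "\<dots> = (of_real x * (1 - \<i> * of_real t)) / (of_real x * (1 + \<i> * of_real t))"
    unfolding x(2) by (simp add: algebra_simps)
  also have "\<dots> = (1 - \<i> * of_real t) / (1 + \<i> * of_real t)" using x(1) by simp
  finally have "blaschke_factor (\<i> * of_real \<epsilon>) (cis s) * cis (2 * arctan t) = ((1 - \<i> * of_real t) * cis (2 * arctan t)) / (1 + \<i> * of_real t)"
    by simp
  also have "\<dots> = 1" unfolding cis_two_arctan by (simp add: complex_eq_iff)
  finally have "(blaschke_factor (\<i> * of_real \<epsilon>) (cis s) * cis (2 * arctan t)) ^ m = 1" by simp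
  moreover have "phase_corr m \<epsilon> (cis s) = cis (2 * arctan t) ^ m"
    by (simp add: phase_corr_def t_def Complex.DeMoivre mult_ac)
  ultimately show ?thesis by (simp add: power_mult_distrib)
qed

text \<open>\<open>C\<close> does not depend on \<open>\<epsilon>\<close>, so the infimum follows as
  the extra zeros approach the real axis. The case \<open>d = k\<close>, without bubbles, is
  included.\<close>

lemma bubbling:
  assumes \<beta>: "\<forall>j\<in>{1..k}. Im (\<beta> j) > 0" and kd: "k \<le> d"
  obtains C where "0 \<le> C" "\<And>\<epsilon>. 0 < \<epsilon> \<Longrightarrow> \<epsilon> \<le> 1 \<Longrightarrow>
    \<exists>u\<in>admissible (lift (blaschke_circle \<theta> \<beta> k)) (int d). energy u \<le> ennreal (2 * pi * real d + C * \<epsilon>)"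
proof -
  define m where "m = d - k"
  obtain C where C: "0 \<le> C" "\<And>m \<epsilon>. gagliardo_circle (phase_corr m \<epsilon>) \<le> ennreal (C * (real m)\<^sup>2 * \<epsilon>\<^sup>2)"
    using gagliardo_corr by blast
  \<comment> \<open>The first part is the loss in the factor \<open>1 + \<epsilon>\<close>; the
    second comes from \<open>(1 + 1 / \<epsilon>) * \<epsilon>\<^sup>2 \<le> 2 * \<epsilon>\<close>
    for \<open>\<epsilon> \<le> 1\<close>.\<close>
  define C' where "C' = 1 / (2 * pi) * (4 * pi\<^sup>2 * real d + 2 * (C * (real m)\<^sup>2))"
  have "\<exists>u\<in>admissible (lift (blaschke_circle \<theta> \<beta> k)) (int d). energy u \<le> ennreal (2 * pi * real d + C' * \<epsilon>)"
    if \<epsilon>: "0 < \<epsilon>" "\<epsilon> \<le> 1" for \<epsilon>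
  proof -
    \<comment> \<open>The \<open>k\<close> zeros of \<open>g\<close> are kept and the other
      \<open>d - k\<close> put at \<open>\<i> * \<epsilon>\<close>, so the energy before the
      correction is exactly \<open>2 * pi * d\<close>.\<close>
    define \<beta>' where "\<beta>' j = (if j \<le> k then \<beta> j else \<i> * of_real \<epsilon>)" for j
    have \<beta>': "\<forall>j\<in>{1..d}. Im (\<beta>' j) > 0" using \<beta> \<epsilon> by (auto simp: \<beta>'_def)
    note b = blaschke_circle_C1_degree[OF \<beta>', of \<theta>]
    define G where "G = (\<lambda>z. blaschke_circle \<theta> \<beta>' d z * phase_corr m \<epsilon> z)"
    have G: "G \<in> C1_circle" "C1_degree G = of_int (int d)"
      using C1_circle_mult[of "blaschke_circle \<theta> \<beta>' d" "phase_corr m \<epsilon>"] b phase_corr_C1[of m \<epsilon>] by (simp_all add: G_def)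
    have split: "blaschke_circle \<theta> \<beta>' d z = blaschke_circle \<theta> \<beta> k z * blaschke_factor (\<i> * of_real \<epsilon>) z ^ m" for z
    proof -
      have "{1..d} = {1..k} \<union> {k+1..d}" using kd by auto
      then have "(\<Prod>j=1..d. blaschke_factor (\<beta>' j) z) = (\<Prod>j=1..k. blaschke_factor (\<beta>' j) z) * (\<Prod>j=k+1..d. blaschke_factor (\<beta>' j) z)"
        by (simp add: prod.union_disjoint)
      also have "(\<Prod>j=1..k. blaschke_factor (\<beta>' j) z) = (\<Prod>j=1..k. blaschke_factor (\<beta> j) z)"
        by (intro prod.cong) (auto simp: \<beta>'_def)
      also have "(\<Prod>j=k+1..d. blaschke_factor (\<beta>' j) z) = (\<Prod>j=k+1..d. blaschke_factor (\<i> * of_real \<epsilon>) z)"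
        by (intro prod.cong) (auto simp: \<beta>'_def)
      finally show ?thesis by (simp add: blaschke_circle_def m_def)
    qed
    have "lift G x = lift (blaschke_circle \<theta> \<beta> k) x" if "x \<notin> {-1<..<1}" for x
    proof -
      define s where "s = 2 * arctan x - pi / 2"
      have s: "sin s \<noteq> 1" "sline s = x" unfolding s_def by (rule sin_arctan_neq_1, rule sline_arctan)
      then have "sin s \<ge> 0" using sline_outside_iff[OF s(1)] that by simp
      then have "G (cis s) = blaschke_circle \<theta> \<beta> k (cis s)"
        using blaschke_factor_corr[OF _ s(1) \<epsilon>(1), of m] by (simp add: G_def split mult.assoc)
      then show ?thesis by (simp add: lift_def s_def)
    qed
    then have "lift G \<in> admissible (lift (blaschke_circle \<theta> \<beta> k)) (int d)" by (rule lift_admissible[OF G])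
    moreover have "energy (lift G) \<le> ennreal (2 * pi * real d + C' * \<epsilon>)"
    proof -
      have "gagliardo_circle G \<le> ennreal (1 + \<epsilon>) * gagliardo_circle (blaschke_circle \<theta> \<beta>' d) + ennreal (1 + 1 / \<epsilon>) * gagliardo_circle (phase_corr m \<epsilon>)"
        unfolding G_def by (rule gagliardo_circle_mult) (use b phase_corr_C1 \<epsilon> in auto)
      also have "\<dots> \<le> ennreal (1 + \<epsilon>) * ennreal (4 * pi\<^sup>2 * real d) + ennreal (1 + 1 / \<epsilon>) * ennreal (C * (real m)\<^sup>2 * \<epsilon>\<^sup>2)"
        by (intro add_mono mult_left_mono C) (simp_all add: gagliardo_blaschke_circle[OF \<beta>'])
      also have "\<dots> = ennreal ((1 + \<epsilon>) * (4 * pi\<^sup>2 * real d)) + ennreal ((1 + 1 / \<epsilon>) * (C * (real m)\<^sup>2 * \<epsilon>\<^sup>2))"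
        using \<epsilon> C(1) by (subst (1 2) ennreal_mult) auto
      also have "\<dots> = ennreal ((1 + \<epsilon>) * (4 * pi\<^sup>2 * real d) + (1 + 1 / \<epsilon>) * (C * (real m)\<^sup>2 * \<epsilon>\<^sup>2))"
        by (rule ennreal_plus[symmetric]) (use \<epsilon> C(1) in auto)
      finally have "energy (lift G) \<le> ennreal (1 / (2 * pi)) * ennreal ((1 + \<epsilon>) * (4 * pi\<^sup>2 * real d) + (1 + 1 / \<epsilon>) * (C * (real m)\<^sup>2 * \<epsilon>\<^sup>2))"
        unfolding energy_lift[OF G(1)] by (intro mult_left_mono) auto
      also have "\<dots> = ennreal (1 / (2 * pi) * ((1 + \<epsilon>) * (4 * pi\<^sup>2 * real d) + (1 + 1 / \<epsilon>) * (C * (real m)\<^sup>2 * \<epsilon>\<^sup>2)))"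
        by (rule ennreal_mult[symmetric]) (use \<epsilon> C(1) in auto)
      also have "\<dots> \<le> ennreal (2 * pi * real d + C' * \<epsilon>)"
      proof (rule ennreal_leI)
        have "(1 + 1 / \<epsilon>) * \<epsilon>\<^sup>2 = \<epsilon> + \<epsilon> * \<epsilon>" using \<epsilon> by (simp add: field_simps power2_eq_square)
        also have "\<dots> \<le> \<epsilon> + 1 * \<epsilon>" using \<epsilon> by (intro add_left_mono mult_right_mono) auto
        finally have "(C * (real m)\<^sup>2) * ((1 + 1 / \<epsilon>) * \<epsilon>\<^sup>2) \<le> (C * (real m)\<^sup>2) * (2 * \<epsilon>)"
          using C(1) by (intro mult_left_mono) auto
        then have "(1 + \<epsilon>) * (4 * pi\<^sup>2 * real d) + (1 + 1 / \<epsilon>) * (C * (real m)\<^sup>2 * \<epsilon>\<^sup>2)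
            \<le> 4 * pi\<^sup>2 * real d + (4 * pi\<^sup>2 * real d + 2 * (C * (real m)\<^sup>2)) * \<epsilon>"
          by (simp add: algebra_simps)
        then have "1 / (2 * pi) * ((1 + \<epsilon>) * (4 * pi\<^sup>2 * real d) + (1 + 1 / \<epsilon>) * (C * (real m)\<^sup>2 * \<epsilon>\<^sup>2))
            \<le> 1 / (2 * pi) * (4 * pi\<^sup>2 * real d + (4 * pi\<^sup>2 * real d + 2 * (C * (real m)\<^sup>2)) * \<epsilon>)"
          by (intro mult_left_mono) auto
        also have "\<dots> = 2 * pi * real d + C' * \<epsilon>" by (simp add: C'_def field_simps power2_eq_square)
        finally show "1 / (2 * pi) * ((1 + \<epsilon>) * (4 * pi\<^sup>2 * real d) + (1 + 1 / \<epsilon>) * (C * (real m)\<^sup>2 * \<epsilon>\<^sup>2)) \<le> 2 * pi * real d + C' * \<epsilon>" .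
      qed
      finally show ?thesis .
    qed
    ultimately show ?thesis by blast
  qed
  moreover have "0 \<le> C'" using C(1) by (simp add: C'_def)
  ultimately show ?thesis using that by blast
qed

lemma INF_energy_blaschke_circle:
  assumes \<beta>: "\<forall>j\<in>{1..k}. Im (\<beta> j) > 0" and kd: "k \<le> d"
  shows "(INF u\<in>admissible (lift (blaschke_circle \<theta> \<beta> k)) (int d). energy u) = ennreal (2 * pi * real d)"
proof (rule antisym)
  show "ennreal (2 * pi * real d) \<le> (INF u\<in>admissible (lift (blaschke_circle \<theta> \<beta> k)) (int d). energy u)"
    using energy_lower_bound by (intro INF_greatest) force
  obtain C where C: "0 \<le> C" "\<And>\<epsilon>. 0 < \<epsilon> \<Longrightarrow> \<epsilon> \<le> 1 \<Longrightarrow>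
    \<exists>u\<in>admissible (lift (blaschke_circle \<theta> \<beta> k)) (int d). energy u \<le> ennreal (2 * pi * real d + C * \<epsilon>)"
    using bubbling[OF assms] by metis
  show "(INF u\<in>admissible (lift (blaschke_circle \<theta> \<beta> k)) (int d). energy u) \<le> ennreal (2 * pi * real d)"
  proof (rule ennreal_le_epsilon)
    fix e :: real assume e: "0 < e"
    \<comment> \<open>\<open>C + 1\<close> rules out division by 0, and the cap 1 meets the range
      allowed in \<open>bubbling\<close>.\<close>
    define \<epsilon> where "\<epsilon> = min 1 (e / (C + 1))"
    have \<epsilon>: "0 < \<epsilon>" "\<epsilon> \<le> 1" using e C(1) by (auto simp: \<epsilon>_def)
    have "C * \<epsilon> \<le> (C + 1) * (e / (C + 1))" using C(1) e by (intro mult_mono) (auto simp: \<epsilon>_def)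
    also have "\<dots> = e" using C(1) by simp
    finally have Ce: "C * \<epsilon> \<le> e" .
    obtain u where u: "u \<in> admissible (lift (blaschke_circle \<theta> \<beta> k)) (int d)" "energy u \<le> ennreal (2 * pi * real d + C * \<epsilon>)"
      using C(2)[OF \<epsilon>] by blast
    have "(INF u\<in>admissible (lift (blaschke_circle \<theta> \<beta> k)) (int d). energy u) \<le> energy u" by (rule INF_lower[OF u(1)])
    also have "\<dots> \<le> ennreal (2 * pi * real d + e)" using u(2) Ce by (meson add_left_mono ennreal_leI order_trans)
    also have "\<dots> = ennreal (2 * pi * real d) + ennreal e" using e by (intro ennreal_plus) auto
    finally show "(INF u\<in>admissible (lift (blaschke_circle \<theta> \<beta> k)) (int d). energy u) \<le> ennreal (2 * pi * real d) + ennreal e" .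
  qed
qed

text \<open>The difference from the Blaschke product vanishes on the arc
  \<open>sin s \<ge> 0\<close> and has no negative frequencies, so
  \<open>unique_continuation\<close> equates all Fourier coefficients, and these determine the
  degree. For \<open>d > k\<close> the conclusion excludes minimizers.\<close>

lemma minimizer_degree:
  assumes \<beta>: "\<forall>j\<in>{1..k}. Im (\<beta> j) > 0"
    and u: "u \<in> admissible (lift (blaschke_circle \<theta> \<beta> k)) (int d)" and e: "energy u = ennreal (2 * pi * real d)"
  shows "d = k"
proof -
  let ?f = "u \<circ> stereo" and ?b = "blaschke_circle \<theta> \<beta> k"
  note u' = admissibleD[OF u]
  have f: "?f \<in> hhalf_circle" by (rule hhalf_line_imp_circle[OF u'(1)])
  have bC: "?b \<in> C1_circle" "C1_degree ?b = of_nat k" using blaschke_circle_C1_degree[OF \<beta>] by auto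
  have b: "?b \<in> hhalf_circle" using bC C1_circle_subset_hhalf by blast
  have "enn2real (gagliardo_circle ?f) / (2 * pi) = 2 * pi * real d"
    using e unfolding energy_eq[OF u'(1)] by (subst (asm) ennreal_inj) auto
  then have "fourier_degree ?f = enn2real (gagliardo_circle ?f) / (4 * pi\<^sup>2)"
    using u'(2) by (simp add: field_simps power2_eq_square)
  then have fneg: "fc ?f (- int n) = 0" if "n > 0" for n
    using fourier_degree_eq_imp_fc_negative[OF f _ that] by blast
  have bneg: "fc ?b (- int n) = 0" if "n > 0" for n by (rule fc_blaschke_circle_negative[OF \<beta> that])
  note mf = hhalf_circleD[OF f] and mb = hhalf_circleD[OF b]
  have ae1: "AE s in circ. cmod (?f (cis s)) \<le> 1" "AE s in circ. cmod (?b (cis s)) \<le> 1"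
    using mf(2) mb(2) by (auto elim: eventually_mono)
  have fcd: "fc (\<lambda>z. ?f z - ?b z) n = fc ?f n - fc ?b n" for n
    by (rule fc_diff[OF mf(1) mb(1) ae1])
  have diff0: "fc (\<lambda>z. ?f z - ?b z) (int n) = 0" for n
  proof (rule unique_continuation)
    show "(\<lambda>s. ?f (cis s) - ?b (cis s)) \<in> borel_measurable circ" using mf(1) mb(1) by (rule borel_measurable_diff)
    show "AE s in circ. cmod (?f (cis s) - ?b (cis s)) \<le> 2"
      using ae1 by eventually_elim (metis add_mono norm_triangle_ineq4 one_add_one order_trans)
    have "AE x in lborel. x \<notin> {-1<..<1} \<longrightarrow> u x = lift ?b x" using u by (simp add: admissible_def)
    from AE_circI[OF AE_sline[OF this]] AE_circI[OF AE_sin_neq_1]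
    show "AE s in circ. 0 \<le> sin s \<longrightarrow> ?f (cis s) - ?b (cis s) = 0"
    proof eventually_elim
      case (elim s)
      then show ?case using sline_outside_iff[OF elim(2)] lift_stereo[OF elim(2), of ?b] by (simp add: sline_def)
    qed
    show "fc (\<lambda>z. ?f z - ?b z) (- int n) = 0" if "n > 0" for n
      by (simp only: fcd fneg[OF that] bneg[OF that] diff_self)
  qed
  have "fc ?f (int n) = fc ?b (int n)" for n using diff0[of n] unfolding fcd by simp
  \<comment> \<open>For \<open>n = 0\<close> the frequency \<open>- int n\<close> is 0 and belongs
    to the nonnegative ones just treated.\<close>
  moreover have "fc ?f (- int n) = fc ?b (- int n)" for n
    using fneg[of n] bneg[of n] calculation[of 0] by (cases "n = 0") auto
  ultimately have "sfreq ?f = sfreq ?b" by (simp add: sfreq_def[abs_def])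
  then have "complex_of_real (fourier_degree ?f) = of_nat k" using fourier_degree_C1[OF bC(1)] bC(2) by (simp add: fourier_degree_def)
  then show ?thesis using u'(2) by (metis of_int_of_nat_eq of_nat_eq_iff of_real_of_int_eq)
qed

lemma blaschke_pos_lift:
  assumes "h \<in> blaschke_pos k"
  obtains \<theta> \<beta> where "\<forall>j\<in>{1..k}. Im (\<beta> j) > 0" "(\<lambda>x. h (complex_of_real x)) = lift (blaschke_circle \<theta> \<beta> k)"
proof -
  from assms obtain \<theta> \<beta> where b: "\<forall>j\<in>{1..k}. Im (\<beta> j) > 0"
    and h: "\<forall>z. Im z \<ge> 0 \<longrightarrow> h z = cis \<theta> * (\<Prod>j=1..k. (z - \<beta> j) / (z - cnj (\<beta> j)))"
    unfolding blaschke_pos_def by blast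
  have "(\<lambda>x. h (complex_of_real x)) = lift (blaschke_circle \<theta> \<beta> k)" using h by (auto simp: lift_blaschke_circle)
  with b show ?thesis by (rule that)
qed

lemma energy_blaschke_pos:
  fixes k :: int
  assumes "k > 0" and h: "h \<in> blaschke_pos (nat k)" and g: "g = (\<lambda>x. h (complex_of_real x))"
  shows "energy g = ennreal (2 * pi * k)"
    and "\<And>d. d \<ge> k \<Longrightarrow> (INF u\<in>admissible g d. energy u) = ennreal (2 * pi * d)"
    and "\<And>d u. d > k \<Longrightarrow> u \<in> admissible g d \<Longrightarrow> energy u \<noteq> ennreal (2 * pi * d)"
proof -
  obtain \<theta> \<beta> where \<beta>: "\<forall>j\<in>{1..nat k}. Im (\<beta> j) > 0" and g': "g = lift (blaschke_circle \<theta> \<beta> (nat k))"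
    using blaschke_pos_lift[OF h] unfolding g by blast
  show "energy g = ennreal (2 * pi * k)" using energy_lift_blaschke_circle[OF \<beta>] \<open>k > 0\<close> by (simp add: g')
  show "(INF u\<in>admissible g d. energy u) = ennreal (2 * pi * d)" if "d \<ge> k" for d
    using INF_energy_blaschke_circle[OF \<beta>, of "nat d"] \<open>k > 0\<close> that by (simp add: g')
  show "energy u \<noteq> ennreal (2 * pi * d)" if "d > k" "u \<in> admissible g d" for d u
    using minimizer_degree[OF \<beta>, of u \<theta> "nat d"] \<open>k > 0\<close> that by (auto simp: g')
qed

section \<open>Complex conjugation and negative degrees\<close>

lemma hhalf_circle_cnj: "f \<in> hhalf_circle \<Longrightarrow> (\<lambda>z. cnj (f z)) \<in> hhalf_circle"
  by (auto simp: hhalf_circle_def gagliardo_circle_def simp flip: complex_cnj_diff)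

text \<open>Since a degree is quantified over all extensions, its change of sign under conjugation
  is obtained by transporting the extensions. The outer \<open>cnj\<close> matches
  \<open>C1_degree (\<lambda>z. cnj (f z)) = - cnj (C1_degree f)\<close>, which comes directly from
  conjugating the integral.\<close>

lemma degree_extension_cnj:
  assumes D: "degree_extension D"
  shows "degree_extension (\<lambda>f. - cnj (D (\<lambda>z. cnj (f z))))"
  unfolding degree_extension_def
proof (intro conjI ballI allI impI)
  fix f assume f: "f \<in> C1_circle"
  from C1_circleE[OF f] obtain F where F: "\<And>s. ((\<lambda>s. f (cis s)) has_vector_derivative F s) (at s)"
    "continuous_on UNIV F" "\<And>s. cmod (f (cis s)) = 1" by metis
  have F': "((\<lambda>s. cnj (f (cis s))) has_vector_derivative cnj (F s)) (at s)" for s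
    using F(1) by (rule has_vector_derivative_cnj)
  have c': "continuous_on UNIV (\<lambda>s. cnj (F s))" by (intro continuous_intros F)
  have "(\<lambda>z. cnj (f z)) \<in> C1_circle" by (rule C1_circleI[OF F' c']) (simp add: F)
  then have "D (\<lambda>z. cnj (f z)) = C1_degree (\<lambda>z. cnj (f z))" using D by (simp add: degree_extension_def)
  also have "\<dots> = 1 / (2 * complex_of_real pi * \<i>) * (\<integral>s. cnj (cnj (f (cis s)) * F s) \<partial>circ)"
    unfolding C1_degree_eq[OF F' c'] by simp
  also have "\<dots> = - cnj (C1_degree f)"
    unfolding C1_degree_eq[OF F(1,2)] Bochner_Integration.integral_cnj by simp
  finally show "- cnj (D (\<lambda>z. cnj (f z))) = C1_degree f" by simp
next
  fix f \<epsilon> assume f: "f \<in> hhalf_circle" and \<epsilon>: "(0::real) < \<epsilon>"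
  obtain \<delta> where \<delta>: "\<delta> > 0" "\<And>h. h \<in> hhalf_circle \<Longrightarrow>
      hhalf_circle_norm_sq (\<lambda>z. h z - cnj (f z)) < ennreal (\<delta>\<^sup>2) \<Longrightarrow> cmod (D h - D (\<lambda>z. cnj (f z))) < \<epsilon>"
    using D hhalf_circle_cnj[OF f] \<epsilon> unfolding degree_extension_def by meson
  show "\<exists>\<delta>>0. \<forall>h\<in>hhalf_circle. hhalf_circle_norm_sq (\<lambda>z. h z - f z) < ennreal (\<delta>\<^sup>2) \<longrightarrow>
      cmod (- cnj (D (\<lambda>z. cnj (h z))) - - cnj (D (\<lambda>z. cnj (f z)))) < \<epsilon>"
  proof (intro exI[of _ \<delta>] conjI ballI impI \<delta>(1))
    fix h assume h: "h \<in> hhalf_circle" and lt: "hhalf_circle_norm_sq (\<lambda>z. h z - f z) < ennreal (\<delta>\<^sup>2)"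
    have "hhalf_circle_norm_sq (\<lambda>z. cnj (h z) - cnj (f z)) = hhalf_circle_norm_sq (\<lambda>z. h z - f z)"
      by (simp add: hhalf_circle_norm_sq_def gagliardo_circle_def flip: complex_cnj_diff)
    then have "cmod (D (\<lambda>z. cnj (h z)) - D (\<lambda>z. cnj (f z))) < \<epsilon>"
      using \<delta>(2)[OF hhalf_circle_cnj[OF h]] lt by simp
    moreover have "- cnj (D (\<lambda>z. cnj (h z))) - - cnj (D (\<lambda>z. cnj (f z))) = - cnj (D (\<lambda>z. cnj (h z)) - D (\<lambda>z. cnj (f z)))"
      by simp
    ultimately show "cmod (- cnj (D (\<lambda>z. cnj (h z))) - - cnj (D (\<lambda>z. cnj (f z)))) < \<epsilon>"
      by (simp only: norm_minus_cancel complex_mod_cnj)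
  qed
qed

lemma energy_cnj: "energy (\<lambda>x. cnj (u x)) = energy u"
  by (simp add: energy_def gagliardo_line_def flip: complex_cnj_diff)

lemma admissible_cnj:
  assumes "u \<in> admissible g d"
  shows "(\<lambda>x. cnj (u x)) \<in> admissible (\<lambda>x. cnj (g x)) (- d)"
proof -
  have "line_has_degree (\<lambda>x. cnj (u x)) (- d)"
    unfolding line_has_degree_def circle_has_degree_def
  proof (intro allI impI)
    fix D assume "degree_extension D"
    then have "degree_extension (\<lambda>f. - cnj (D (\<lambda>z. cnj (f z))))" by (rule degree_extension_cnj)
    then have "- cnj (D (\<lambda>z. cnj ((u \<circ> stereo) z))) = of_int d"
      using assms by (simp add: admissible_def line_has_degree_def circle_has_degree_def)
    then have "- D (\<lambda>z. cnj ((u \<circ> stereo) z)) = cnj (of_int d)" by (metis complex_cnj_cnj complex_cnj_minus)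
    then show "D ((\<lambda>x. cnj (u x)) \<circ> stereo) = of_int (- d)"
      by (simp add: o_def minus_equation_iff[of "D _"])
  qed
  moreover have "gagliardo_line (\<lambda>x. cnj (u x)) = gagliardo_line u"
    by (simp add: gagliardo_line_def flip: complex_cnj_diff)
  ultimately show ?thesis using assms by (auto simp: admissible_def hhalf_line_def elim: eventually_mono)
qed

lemma admissible_cnj_image:
  "admissible (\<lambda>x. cnj (g x)) (- d) = (\<lambda>u x. cnj (u x)) ` admissible g d"
proof (intro equalityI subsetI)
  fix u assume "u \<in> admissible (\<lambda>x. cnj (g x)) (- d)"
  from admissible_cnj[OF this] have "(\<lambda>x. cnj (u x)) \<in> admissible g d" by simp
  then show "u \<in> (\<lambda>u x. cnj (u x)) ` admissible g d"
    by (intro image_eqI[of _ _ "\<lambda>x. cnj (u x)"]) auto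
qed (auto intro: admissible_cnj)

theorem theorem1p4:
  fixes k :: int and h :: "complex \<Rightarrow> complex" and g :: "real \<Rightarrow> complex"
  assumes "k \<noteq> 0"
    and "h \<in> blaschke k"
    and "g = (\<lambda>x. h (complex_of_real x))"
  shows "(INF u\<in>admissible g k. energy u) = ennreal (2 * pi * real_of_int \<bar>k\<bar>) \<and>
         ennreal (2 * pi * real_of_int \<bar>k\<bar>) = energy g \<and>
         (\<forall>d::int. (d > k \<and> k > 0) \<or> (d < k \<and> k < 0) \<longrightarrow>
            (INF u\<in>admissible g d. energy u) = ennreal (2 * pi * real_of_int \<bar>d\<bar>) \<and>
            \<not> (\<exists>u\<in>admissible g d. energy u = (INF v\<in>admissible g d. energy v)))"
proof (cases "k > 0")
  case True
  then have "h \<in> blaschke_pos (nat k)" using assms(2) by (simp add: blaschke_def)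
  note pos = energy_blaschke_pos[OF True this assms(3)]
  have "(INF u\<in>admissible g d. energy u) = ennreal (2 * pi * real_of_int \<bar>d\<bar>) \<and>
      \<not> (\<exists>u\<in>admissible g d. energy u = (INF v\<in>admissible g d. energy v))" if "d > k" for d
    using pos(2,3)[of d] that True by auto
  moreover have "(INF u\<in>admissible g k. energy u) = ennreal (2 * pi * real_of_int \<bar>k\<bar>)"
    using pos(2)[of k] True by simp
  moreover have "ennreal (2 * pi * real_of_int \<bar>k\<bar>) = energy g" using pos(1) True by simp
  moreover have "\<not> k < 0" using True by simp
  ultimately show ?thesis by blast
next
  case False
  then have k: "- k > 0" using assms(1) by simp
  obtain h' where h': "h' \<in> blaschke_pos (nat (- k))" "h = (\<lambda>z. cnj (h' z))"
    using assms(2) False by (auto simp: blaschke_def)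
  define g' where "g' = (\<lambda>x. h' (complex_of_real x))"
  note pos = energy_blaschke_pos[OF k h'(1) g'_def]
  have g: "g = (\<lambda>x. cnj (g' x))" by (simp add: assms(3) h'(2) g'_def)
  have adm: "admissible g d = (\<lambda>u x. cnj (u x)) ` admissible g' (- d)" for d
    using admissible_cnj_image[of g' "- d"] by (simp add: g)
  have INF: "(INF u\<in>admissible g d. energy u) = (INF u\<in>admissible g' (- d). energy u)" for d
    unfolding adm by (simp add: image_image energy_cnj)
  have "(INF u\<in>admissible g d. energy u) = ennreal (2 * pi * real_of_int \<bar>d\<bar>) \<and>
      \<not> (\<exists>u\<in>admissible g d. energy u = (INF v\<in>admissible g d. energy v))" if "d < k" for d
    unfolding INF using pos(2,3)[of "- d"] that k by (auto simp: adm energy_cnj)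
  moreover have "ennreal (2 * pi * real_of_int \<bar>k\<bar>) = energy g" using pos(1) k by (simp add: g energy_cnj)
  moreover have "(INF u\<in>admissible g k. energy u) = ennreal (2 * pi * real_of_int \<bar>k\<bar>)"
    using pos(2)[of "- k"] k by (simp add: INF)
  ultimately show ?thesis using False by blast
qed

end
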